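(* Let $E/\mathbb{Q}$ be an elliptic curve with conductor $N_E$, let $\ell \geq 3$ be a prime, and let $K$ be a quadratic number field such that there exists a point $P \in E(K)[\ell] \setminus E(\mathbb{Q})$. Then: (1) for every prime $p \neq \ell$ that ramifies in $K$, $E$ has additive reduction at $p$, i.e. $p^2 \mid N_E$; (2) if $\ell > 3$ and $p = \ell$ ramifies in $K$, then $E$ has additive reduction at $p$, i.e. $p^2 \mid N_E$.
   Context: $E(K)[\ell]$ denotes the group of points of $E(K)$ of order dividing $\ell$. *)

theory Defs
  imports
    "HOL-Analysis.Analysis"
    "HOL-Computational_Algebra.Computational_Algebra"
    "HOL-Number_Theory.Cong"
    "HOL-Algebra.Algebra"
    "HOL-Algebra.Algebraic_Closure_Type"
begin

hide_const (open) Divisibility.prime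

section \<open>Subfields, rings of integers, ramification\<close>

text \<open>
  Fields are subsets of an arbitrary ambient field of characteristic zero, so that an abstract
  field (\<open>UNIV\<close> of its type) and a subfield of the complex numbers are both covered.
\<close>

abbreviation ring_on :: "'k::field set \<Rightarrow> 'k ring" where
  "ring_on S \<equiv> ring_of_type_algebra\<lparr>carrier := S\<rparr>"

definition quadratic_number_field :: "'k::field_char_0 set \<Rightarrow> bool" where
  "quadratic_number_field K \<longleftrightarrow>
     subfield K ring_of_type_algebra \<and>
     vector_space.dim (\<lambda>(c::rat) x. of_rat c * x) K = 2"

definition ring_of_integers :: "'k::field_char_0 set \<Rightarrow> 'k ring" where
  "ring_of_integers K = ring_on {x \<in> K. algebraic_int x}"

text \<open>
  \<open>ideals_set R\<close> is the multiplicative monoid of ideals of \<open>R\<close>, so the powers and the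
  divisibility below are those of ideals.
\<close>

definition ramifies_in :: "nat \<Rightarrow> 'k::field_char_0 set \<Rightarrow> bool" where
  "ramifies_in p K \<longleftrightarrow>
     (let R = ring_of_integers K in
      \<exists>\<pp>. primeideal \<pp> R \<and>
          (\<pp> [^]\<^bsub>ideals_set R\<^esub> (2::nat)) divides\<^bsub>ideals_set R\<^esub> (PIdl\<^bsub>R\<^esub> (of_nat p)))"


section \<open>Weierstrass equations and their points\<close>

text \<open>The equation \<open>y\<^sup>2 + a1 x y + a3 y = x\<^sup>3 + a2 x\<^sup>2 + a4 x + a6\<close>.\<close>

datatype 'a weierstrass = Weierstrass (a1: 'a) (a2: 'a) (a3: 'a) (a4: 'a) (a6: 'a)

definition disc :: "'a::comm_ring_1 weierstrass \<Rightarrow> 'a" where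
  "disc W =
     (let b2 = a1 W ^ 2 + 4 * a2 W;
          b4 = 2 * a4 W + a1 W * a3 W;
          b6 = a3 W ^ 2 + 4 * a6 W;
          b8 = a1 W ^ 2 * a6 W + 4 * a2 W * a6 W - a1 W * a3 W * a4 W + a2 W * a3 W ^ 2 - a4 W ^ 2
      in - (b2 ^ 2 * b8) - 8 * b4 ^ 3 - 27 * b6 ^ 2 + 9 * b2 * b4 * b6)"

definition elliptic_curve :: "'a::field weierstrass \<Rightarrow> bool" where
  "elliptic_curve W \<longleftrightarrow> disc W \<noteq> 0"

datatype 'a point = Infinity | Affine 'a 'a

fun on_curve :: "'a::comm_ring_1 weierstrass \<Rightarrow> 'a point \<Rightarrow> bool" where
  "on_curve W Infinity \<longleftrightarrow> True"
| "on_curve W (Affine x y) \<longleftrightarrow>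
     y ^ 2 + a1 W * x * y + a3 W * y = x ^ 3 + a2 W * x ^ 2 + a4 W * x + a6 W"

definition points :: "'a::comm_ring_1 weierstrass \<Rightarrow> 'a set \<Rightarrow> 'a point set" where
  "points W K = {P. on_curve W P \<and> set_point P \<subseteq> K}"

text \<open>
  The chord-and-tangent law with neutral element \<open>Infinity\<close>. The line through the two points
  (the tangent line if they coincide) is \<open>y = \<lambda> x + \<nu>\<close>.
\<close>

fun point_add :: "'a::field weierstrass \<Rightarrow> 'a point \<Rightarrow> 'a point \<Rightarrow> 'a point" where
  "point_add W Infinity Q = Q"
| "point_add W P Infinity = P"
| "point_add W (Affine x1 y1) (Affine x2 y2) =
     (if x1 = x2 \<and> y1 + y2 + a1 W * x2 + a3 W = 0 then Infinity
      else let l = (if x1 = x2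
                    then (3 * x1 ^ 2 + 2 * a2 W * x1 + a4 W - a1 W * y1) / (2 * y1 + a1 W * x1 + a3 W)
                    else (y2 - y1) / (x2 - x1));
               v = y1 - l * x1;
               x3 = l ^ 2 + a1 W * l - a2 W - x1 - x2
           in Affine x3 (- (l + a1 W) * x3 - v - a3 W))"

definition point_mult :: "'a::field weierstrass \<Rightarrow> nat \<Rightarrow> 'a point \<Rightarrow> 'a point" where
  "point_mult W n P = (point_add W P ^^ n) Infinity"

definition torsion :: "'a::field weierstrass \<Rightarrow> 'a set \<Rightarrow> nat \<Rightarrow> 'a point set" where
  "torsion W K n = {P \<in> points W K. point_mult W n P = Infinity}"

abbreviation base_change :: "rat weierstrass \<Rightarrow> 'k::field_char_0 weierstrass" where
  "base_change \<equiv> map_weierstrass of_rat"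


section \<open>Minimal models and reduction types\<close>

text \<open>
  \<open>W'\<close> arises from \<open>W\<close> by the substitution \<open>x = u\<^sup>2 x' + r\<close>, \<open>y = u\<^sup>3 y' + s u\<^sup>2 x' + t\<close>.
\<close>

definition isomorphic :: "'a::field weierstrass \<Rightarrow> 'a weierstrass \<Rightarrow> bool" where
  "isomorphic W W' \<longleftrightarrow> (\<exists>u r s t. u \<noteq> 0 \<and>
     u * a1 W' = a1 W + 2 * s \<and>
     u ^ 2 * a2 W' = a2 W - s * a1 W + 3 * r - s ^ 2 \<and>
     u ^ 3 * a3 W' = a3 W + r * a1 W + 2 * t \<and>
     u ^ 4 * a4 W' = a4 W - s * a3 W + 2 * r * a2 W - (t + r * s) * a1 W + 3 * r ^ 2 - 2 * s * t \<and>
     u ^ 6 * a6 W' = a6 W + r * a4 W + r ^ 2 * a2 W + r ^ 3 - t * a3 W - t ^ 2 - r * t * a1 W)"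

definition integral_model :: "rat weierstrass \<Rightarrow> int weierstrass \<Rightarrow> bool" where
  "integral_model E W \<longleftrightarrow> isomorphic E (map_weierstrass of_int W)"

text \<open>
  Minimality at \<open>p\<close> among equations over the integers. Allowing coefficients that are only
  integral at \<open>p\<close> would give the same minimal valuation: a substitution with \<open>u\<close> prime to \<open>p\<close>
  removes the other denominators and does not change the valuation of the discriminant at \<open>p\<close>.
\<close>

definition minimal_model :: "nat \<Rightarrow> rat weierstrass \<Rightarrow> int weierstrass \<Rightarrow> bool" where
  "minimal_model p E W \<longleftrightarrow> integral_model E W \<and>
     (\<forall>W'. integral_model E W' \<longrightarrow> multiplicity (int p) (disc W) \<le> multiplicity (int p) (disc W'))"

text \<open>
  Singular points of the reduction modulo \<open>p\<close>. The point at infinity is never singular, and a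
  singular point of a Weierstrass cubic over the perfect field with \<open>p\<close> elements is rational over
  that field, so it is represented by integers.
\<close>

definition singular_mod :: "nat \<Rightarrow> int weierstrass \<Rightarrow> int \<Rightarrow> int \<Rightarrow> bool" where
  "singular_mod p W x y \<longleftrightarrow>
     [y ^ 2 + a1 W * x * y + a3 W * y = x ^ 3 + a2 W * x ^ 2 + a4 W * x + a6 W] (mod int p) \<and>
     [a1 W * y = 3 * x ^ 2 + 2 * a2 W * x + a4 W] (mod int p) \<and>
     [2 * y + a1 W * x + a3 W = 0] (mod int p)"

text \<open>
  At a singular point with abscissa \<open>x\<close> the tangent cone is \<open>Y\<^sup>2 + a1 X Y - (3 x + a2) X\<^sup>2\<close>.
  The point is a cusp if this form is a square \<open>(Y - \<alpha> X)\<^sup>2\<close>, and a node otherwise; the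
  slope of a double tangent is again rational over the prime field.
\<close>

definition double_tangent_mod :: "nat \<Rightarrow> int weierstrass \<Rightarrow> int \<Rightarrow> bool" where
  "double_tangent_mod p W x \<longleftrightarrow>
     (\<exists>\<alpha>. [a1 W = - 2 * \<alpha>] (mod int p) \<and> [- (3 * x + a2 W) = \<alpha> ^ 2] (mod int p))"

definition good_reduction :: "rat weierstrass \<Rightarrow> nat \<Rightarrow> bool" where
  "good_reduction E p \<longleftrightarrow> (\<exists>W. minimal_model p E W \<and> \<not> int p dvd disc W)"

definition multiplicative_reduction :: "rat weierstrass \<Rightarrow> nat \<Rightarrow> bool" where
  "multiplicative_reduction E p \<longleftrightarrow>
     (\<exists>W x y. minimal_model p E W \<and> singular_mod p W x y \<and> \<not> double_tangent_mod p W x)"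

definition additive_reduction :: "rat weierstrass \<Rightarrow> nat \<Rightarrow> bool" where
  "additive_reduction E p \<longleftrightarrow>
     (\<exists>W x y. minimal_model p E W \<and> singular_mod p W x y \<and> double_tangent_mod p W x)"


section \<open>The conductor\<close>

text \<open>Lower ramification groups of \<open>L\<close> over the rationals at the prime ideal \<open>\<PP>\<close>.\<close>

definition field_automorphisms :: "'k::field set \<Rightarrow> ('k \<Rightarrow> 'k) set" where
  "field_automorphisms L = ring_iso (ring_on L) (ring_on L) \<inter> extensional L"

definition ramification_group ::
    "'k::field_char_0 set \<Rightarrow> 'k set \<Rightarrow> nat \<Rightarrow> ('k \<Rightarrow> 'k) set" where
  "ramification_group L \<PP> i =
     (let R = ring_of_integers L in
      {\<sigma> \<in> field_automorphisms L.
         \<forall>x \<in> carrier R. \<sigma> x - x \<in> \<PP> [^]\<^bsub>ideals_set R\<^esub> (Suc i)})"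

text \<open>
  The wild part of the conductor exponent,
  \<open>\<delta> = \<Sum>i\<ge>1. (|G\<^sub>i| / |G\<^sub>0|) dim (E[q] / E[q]\<^sup>G\<^sup>i)\<close> over the field with \<open>q\<close> elements, where
  \<open>q \<noteq> p\<close> is a prime and \<open>G\<^sub>i\<close> are the ramification groups of \<open>\<rat>(E[q])\<close> at a prime
  above \<open>p\<close>. The value depends neither on \<open>q\<close> nor on the prime above \<open>p\<close>. All but
  finitely many terms vanish, and the dimension is computed as a logarithm of cardinalities.
\<close>

definition wild_conductor_exponent :: "rat weierstrass \<Rightarrow> nat \<Rightarrow> real" where
  "wild_conductor_exponent E p =
     (let q = (if p = 2 then 3 else 2);
          T = torsion (base_change E :: complex weierstrass) UNIV q;
          L = generate_field ring_of_type_algebra (\<Union> (set_point ` T));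
          \<PP> = (SOME I. primeideal I (ring_of_integers L) \<and> of_nat p \<in> I);
          G = ramification_group L \<PP>
      in \<Sum>\<^sub>\<infinity> i \<in> {1..}. real (card (G i)) / real (card (G 0)) *
           log (real q) (real (card T) / real (card {P \<in> T. \<forall>\<sigma> \<in> G i. map_point \<sigma> P = P})))"

text \<open>The wild part is an integer; the floor only serves as a coercion.\<close>

definition conductor_exponent :: "rat weierstrass \<Rightarrow> nat \<Rightarrow> nat" where
  "conductor_exponent E p =
     (if additive_reduction E p then 2 + nat \<lfloor>wild_conductor_exponent E p\<rfloor>
      else if multiplicative_reduction E p then 1
      else 0)"

definition conductor :: "rat weierstrass \<Rightarrow> nat" where
  "conductor E = (\<Prod>p \<in> {p. prime p \<and> \<not> good_reduction E p}. p ^ conductor_exponent E p)"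

end

theory Submission
  imports Defs "HOL-Computational_Algebra.Formal_Laurent_Series" "HOL-Library.Set_Algebras"
begin

text \<open>
  Write \<open>\<sigma>\<close> for the conjugation of \<open>K\<close>. The point \<open>Q = P - \<sigma> P\<close> is nonzero, killed by \<open>l\<close>,
  and satisfies \<open>\<sigma> Q = - Q\<close>; the same holds for its nonzero multiples. So these points have
  rational \<open>x\<close>, while \<open>2 y + a1 x + a3\<close> is a rational multiple of \<open>s\<close>, where \<open>K = \<rat>(s)\<close> and
  \<open>d = s\<^sup>2\<close> is an integer. Take an integral model minimal at the ramified prime \<open>p\<close>.

  No such point lies in the kernel of reduction: with \<open>u = 1 / x(Q)\<close> divisible by \<open>p\<close>, the addition
  formulas give \<open>x(Q) / x(m Q) \<equiv> m\<^sup>2 + b2 u m\<^sup>2 (m\<^sup>2 - 1) / 12\<close> modulo \<open>p\<^sup>2\<close>, and comparing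
  the multiples \<open>m = (l - 1) / 2\<close> and \<open>m = (l + 1) / 2\<close>, which are opposite, forces \<open>p = l = 3\<close>.
  Since \<open>\<sigma>\<close> is trivial on the residue field at \<open>p\<close>, the points reduce to points of order dividing
  2, so a nonsingular reduction would put the double into the kernel of reduction. Hence \<open>Q\<close> and
  \<open>2 Q\<close> reduce to a singular point. The tangent at \<open>Q\<close> has slope \<open>\<lambda>\<close> with
  \<open>2 \<lambda> + a1\<close> a rational multiple of \<open>s\<close>, and \<open>(2 \<lambda> + a1)\<^sup>2 = b2 + 8 x(Q) + 4 x(2 Q)\<close>; ramification
  then makes the right-hand side divisible by \<open>p\<close>, which says that the singular point is a cusp.

  The group law is obtained from the class group of the affine coordinate ring: \<open>P\<close> is sent to the
  class of its maximal ideal, an injective map compatible with chord-and-tangent addition.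
\<close>

section \<open>Weierstrass equations\<close>

text \<open>A reduction map on points over \<open>K\<close> would require a prime above
  \<open>p\<close> and its residue field. Instead the argument is carried out on rational abscissas.
  Doubling is \<open>phi2 / psi2_sq\<close>, and a common root of numerator and denominator modulo
  \<open>p\<close> is a singular point; the abscissas of \<open>P + Q\<close> and
  \<open>P - Q\<close> have sum and product rational in those of \<open>P\<close> and
  \<open>Q\<close>. Ramification enters only through numbers \<open>d e^2\<close> that are squares
  modulo 4. Two such numbers occur, the squares of \<open>2 y + a1 x + a3\<close> and of
  \<open>2 \<lambda> + a1\<close>, and this form covers \<open>p = 2\<close> as well. The precision
  \<open>p^2\<close> in the kernel of reduction is forced by the case \<open>p = l\<close>: the
  constant terms for the two opposite multiples differ by \<open>l\<close>, which gives no
  contradiction modulo \<open>p\<close>. Associativity, needed to speak of orders and multiples,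
  would split into many cases with large identities if checked on the formulas. For ideal classes it
  is associativity of multiplication of sets, and injectivity uses only pole orders at infinity and
  evaluation at points.\<close>

definition b2 :: "'a::comm_ring_1 weierstrass \<Rightarrow> 'a" where
  "b2 W = a1 W ^ 2 + 4 * a2 W"

definition b4 :: "'a::comm_ring_1 weierstrass \<Rightarrow> 'a" where
  "b4 W = 2 * a4 W + a1 W * a3 W"

definition b6 :: "'a::comm_ring_1 weierstrass \<Rightarrow> 'a" where
  "b6 W = a3 W ^ 2 + 4 * a6 W"

definition b8 :: "'a::comm_ring_1 weierstrass \<Rightarrow> 'a" where
  "b8 W = a1 W ^ 2 * a6 W + 4 * a2 W * a6 W - a1 W * a3 W * a4 W + a2 W * a3 W ^ 2 - a4 W ^ 2"

lemma disc_eq: "disc W = - (b2 W ^ 2 * b8 W) - 8 * b4 W ^ 3 - 27 * b6 W ^ 2 + 9 * b2 W * b4 W * b6 W"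
  by (simp add: disc_def b2_def b4_def b6_def b8_def Let_def)

text \<open>Moving \<open>(x, y)\<close> to the origin turns the value of the equation and of its
  partial derivatives at the point into the last three coefficients, up to sign. Passing through
  \<open>b2\<close> to \<open>b8\<close> keeps the identities small.\<close>

lemma disc_translate:
  fixes W :: "'a::idom weierstrass"
  shows "disc W = disc (Weierstrass (a1 W) (a2 W + 3 * x) (a3 W + a1 W * x + 2 * y)
     (a4 W + 2 * a2 W * x - a1 W * y + 3 * x ^ 2)
     (a6 W + a4 W * x + a2 W * x ^ 2 + x ^ 3 - a3 W * y - y ^ 2 - a1 W * x * y))" (is "_ = disc ?V")
proof -
  have c2: "b2 ?V = b2 W + 12 * x" unfolding b2_def weierstrass.sel by Groebner_Basis.algebra
  have c4: "b4 ?V = b4 W + x * b2 W + 6 * x^2" unfolding b4_def b2_def weierstrass.sel by Groebner_Basis.algebra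
  have c6: "b6 ?V = b6 W + 2 * x * b4 W + x^2 * b2 W + 4 * x^3" unfolding b6_def b4_def b2_def weierstrass.sel by Groebner_Basis.algebra
  have c8: "b8 ?V = b8 W + 3 * x * b6 W + 3 * x^2 * b4 W + x^3 * b2 W + 3 * x^4"
    unfolding b8_def b6_def b4_def b2_def weierstrass.sel by Groebner_Basis.algebra
  have e: "4 * b8 W = b2 W * b6 W - b4 W ^ 2" unfolding b8_def b6_def b4_def b2_def weierstrass.sel by Groebner_Basis.algebra
  show ?thesis unfolding disc_eq c2 c4 c6 c8 using e by Groebner_Basis.algebra
qed

text \<open>Applied below with \<open>k = 0\<close> over a field and with \<open>k = p\<close> over the integers.\<close>

lemma singular_dvd_disc:
  fixes W :: "'a::idom weierstrass"
  assumes F: "k dvd y ^ 2 + a1 W * x * y + a3 W * y - (x ^ 3 + a2 W * x ^ 2 + a4 W * x + a6 W)"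
    and Fx: "k dvd a1 W * y - (3 * x ^ 2 + 2 * a2 W * x + a4 W)"
    and Fy: "k dvd 2 * y + a1 W * x + a3 W"
  shows "k dvd disc W"
proof -
  define a where "a = a3 W + a1 W * x + 2 * y"
  define b where "b = a4 W + 2 * a2 W * x - a1 W * y + 3 * x ^ 2"
  define c where "c = a6 W + a4 W * x + a2 W * x ^ 2 + x ^ 3 - a3 W * y - y ^ 2 - a1 W * x * y"
  have "k dvd a" using Fy by (simp add: a_def algebra_simps)
  moreover have "k dvd b" using Fx unfolding b_def
    by (subst dvd_minus_iff[symmetric]) (simp add: algebra_simps)
  moreover have "k dvd c" using F unfolding c_def
    by (subst dvd_minus_iff[symmetric]) (simp add: algebra_simps)
  ultimately show ?thesis
    unfolding disc_translate[of W x y] a_def[symmetric] b_def[symmetric] c_def[symmetric]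
    by (auto simp: disc_def Let_def power2_eq_square power3_eq_cube intro!: dvd_add dvd_diff)
qed

lemma nonsingular:
  fixes W :: "'a::field weierstrass"
  assumes "disc W \<noteq> 0" "on_curve W (Affine x y)" "2 * y + a1 W * x + a3 W = 0"
  shows "3 * x ^ 2 + 2 * a2 W * x + a4 W - a1 W * y \<noteq> 0"
proof
  assume "3 * x ^ 2 + 2 * a2 W * x + a4 W - a1 W * y = 0"
  then have "0 dvd disc W" using assms(2,3)
    by (intro singular_dvd_disc[of 0 y W x]) (auto simp: algebra_simps)
  then show False using assms(1) by simp
qed

section \<open>Functions on the curve as Laurent series at infinity\<close>

text \<open>\<open>U\<close> and \<open>V\<close> are the coordinate functions expanded in a local
  parameter at infinity, where they have poles of order 2 and 3. Laurent series form a field, so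
  ideal classes can be compared without constructing the function field, and the order serves as a
  degree.\<close>

locale weierstrass_functions =
  fixes W :: "'a::field_char_0 weierstrass" and U V :: "'a fls"
  assumes disc_nz: "disc W \<noteq> 0"
    and ordX: "fls_subdegree U = - 2" and ordY: "fls_subdegree V = - 3"
    and equation: "V ^ 2 + fls_const (a1 W) * U * V + fls_const (a3 W) * V =
      U ^ 3 + fls_const (a2 W) * U ^ 2 + fls_const (a4 W) * U + fls_const (a6 W)"
begin

abbreviation cc :: "'a \<Rightarrow> 'a fls" where "cc \<equiv> fls_const"

lemma cc_add: "cc (a + b) = cc a + cc b" by (simp add: fls_plus_const)
lemma cc_diff: "cc (a - b) = cc a - cc b" by (simp add: fls_minus_const)
lemma cc_mult: "cc (a * b) = cc a * cc b" by simp
lemmas cc_simps = cc_add cc_diff cc_mult fls_const_uminus fls_const_power fls_const_numeral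

section \<open>Orders at infinity of polynomials in \<open>U\<close> and \<open>V\<close>\<close>

definition ev :: "'a poly \<Rightarrow> 'a fls" where "ev p = poly (map_poly cc p) U"

lemma ev_pCons [simp]: "ev (pCons a p) = cc a + U * ev p"
  by (simp add: ev_def map_poly_pCons)

lemma ev_0 [simp]: "ev 0 = 0" by (simp add: ev_def)

lemma ev_add: "ev (p + q) = ev p + ev q"
  by (induction p q rule: poly_induct2) (auto simp: cc_add algebra_simps)

lemma ev_smult: "ev (Polynomial.smult c p) = cc c * ev p"
  by (induction p) (auto simp: algebra_simps)

lemma ev_mult: "ev (p * q) = ev p * ev q"
  by (induction p) (auto simp: ev_add ev_smult algebra_simps)

lemma U_nz: "U \<noteq> 0" and V_nz: "V \<noteq> 0" using ordX ordY by auto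

lemma ord_ev: "p \<noteq> 0 \<Longrightarrow> ev p \<noteq> 0 \<and> fls_subdegree (ev p) = - 2 * int (Polynomial.degree p)"
proof (induction p)
  case (pCons a p)
  show ?case
  proof (cases "p = 0")
    case True
    then show ?thesis using pCons by auto
  next
    case False
    then have nz: "U * ev p \<noteq> 0" and o: "fls_subdegree (U * ev p) = - 2 - 2 * int (Polynomial.degree p)"
      using pCons U_nz ordX by auto
    have "fls_subdegree (cc a) = 0" by simp
    then have "fls_subdegree (U * ev p + cc a) = fls_subdegree (U * ev p)"
      using o nz by (intro fls_subdegree_add_eq1) auto
    then have "fls_subdegree (ev (pCons a p)) = - 2 * int (Polynomial.degree (pCons a p))"
      using o False by (simp add: add.commute)
    then show ?thesis using False by auto
  qed
qed auto

text \<open>\<open>ev p\<close> has even order and \<open>ev q * V\<close> odd order, so their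
  leading terms cannot cancel.\<close>

lemma ord_fun:
  assumes "z = ev p + ev q * V"
  shows "p \<noteq> 0 \<Longrightarrow> z \<noteq> 0 \<and> fls_subdegree z \<le> - 2 * int (Polynomial.degree p)"
    and "q \<noteq> 0 \<Longrightarrow> z \<noteq> 0 \<and> fls_subdegree z \<le> - 3 - 2 * int (Polynomial.degree q)"
proof -
  have q: "q \<noteq> 0 \<Longrightarrow> ev q * V \<noteq> 0 \<and> fls_subdegree (ev q * V) = - 3 - 2 * int (Polynomial.degree q)"
    using ord_ev[of q] V_nz ordY by auto
  have both: "z \<noteq> 0 \<and> fls_subdegree z \<le> - 2 * int (Polynomial.degree p) \<and> fls_subdegree z \<le> - 3 - 2 * int (Polynomial.degree q)"
    if "p \<noteq> 0" "q \<noteq> 0"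
  proof -
    note op = ord_ev[OF that(1)] and oq = q[OF that(2)]
    have "fls_subdegree (ev p) \<noteq> fls_subdegree (ev q * V)" using op oq by presburger
    then consider "fls_subdegree (ev p) < fls_subdegree (ev q * V)" | "fls_subdegree (ev q * V) < fls_subdegree (ev p)"
      by linarith
    then have "fls_subdegree z \<le> - 2 * int (Polynomial.degree p) \<and> fls_subdegree z \<le> - 3 - 2 * int (Polynomial.degree q)"
    proof cases
      case 1
      then have "fls_subdegree z = fls_subdegree (ev p)" unfolding assms using op
        by (intro fls_subdegree_add_eq1) auto
      then show ?thesis using 1 op oq by simp
    next
      case 2
      then have "fls_subdegree z = fls_subdegree (ev q * V)" unfolding assms using oq
        by (intro fls_subdegree_add_eq2) auto
      then show ?thesis using 2 op oq by simp
    qed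
    moreover from this have "z \<noteq> 0" by auto
    ultimately show ?thesis by simp
  qed
  show "z \<noteq> 0 \<and> fls_subdegree z \<le> - 2 * int (Polynomial.degree p)" if "p \<noteq> 0"
    using both[OF that] ord_ev[OF that] assms by (cases "q = 0") auto
  show "z \<noteq> 0 \<and> fls_subdegree z \<le> - 3 - 2 * int (Polynomial.degree q)" if "q \<noteq> 0"
    using both[OF _ that] q[OF that] assms by (cases "p = 0") auto
qed

lemma fun_eqD:
  assumes "ev p + ev q * V = ev p' + ev q' * V"
  shows "p = p'" "q = q'"
proof -
  have "0 = ev (p + Polynomial.smult (-1) p') + ev (q + Polynomial.smult (-1) q') * V"
    using assms by (simp add: ev_add ev_smult algebra_simps del: Polynomial.smult_minus_left)
  from ord_fun[OF this] show "p = p'" "q = q'" by auto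
qed

section \<open>The affine coordinate ring, free with basis \<open>1\<close>, \<open>V\<close> over
  the polynomials in \<open>U\<close>, and its ideals\<close>

definition R :: "'a fls set" where "R = {ev p + ev q * V | p q. True}"

lemma RI: "z = ev p + ev q * V \<Longrightarrow> z \<in> R" by (auto simp: R_def)

lemma R_cc [simp]: "cc c \<in> R" by (rule RI[of _ "[:c:]" 0]) simp
lemma R_0 [simp]: "0 \<in> R" using R_cc[of 0] by simp
lemma R_1 [simp]: "1 \<in> R" using R_cc[of 1] by simp
lemma R_X [simp]: "U \<in> R" by (rule RI[of _ "[:0,1:]" 0]) simp
lemma R_Y [simp]: "V \<in> R" by (rule RI[of _ 0 "[:1:]"]) simp

lemma R_add [simp]: "r \<in> R \<Longrightarrow> s \<in> R \<Longrightarrow> r + s \<in> R"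
proof -
  assume "r \<in> R" "s \<in> R"
  then obtain p q p' q' where "r = ev p + ev q * V" "s = ev p' + ev q' * V" by (auto simp: R_def)
  then show ?thesis by (intro RI[of _ "p + p'" "q + q'"]) (simp add: ev_add algebra_simps)
qed

definition cubic :: "'a poly" where "cubic = [:a6 W, a4 W, a2 W, 1:]"

lemma fun_mult:
  "(ev p + ev q * V) * (ev p' + ev q' * V) =
    ev (p * p' + q * q' * cubic) + ev (p * q' + q * p' + q * q' * [:- a3 W, - a1 W:]) * V"
proof -
  have c: "ev cubic = V ^ 2 + cc (a1 W) * U * V + cc (a3 W) * V"
    unfolding equation cubic_def by (simp add: algebra_simps power2_eq_square power3_eq_cube)
  have l: "ev [:- a3 W, - a1 W:] = - (cc (a1 W) * U + cc (a3 W))" by (simp add: algebra_simps)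
  show ?thesis unfolding ev_add ev_mult c l by Groebner_Basis.algebra
qed

lemma R_mult [simp]: "r \<in> R \<Longrightarrow> s \<in> R \<Longrightarrow> r * s \<in> R"
  unfolding R_def using fun_mult by blast

lemma R_minus [simp]: "r \<in> R \<Longrightarrow> - r \<in> R"
  using R_mult[OF R_cc[of "-1"], of r] by simp

lemma R_diff [simp]: "r \<in> R \<Longrightarrow> s \<in> R \<Longrightarrow> r - s \<in> R"
  using R_add[of r "- s"] by simp

text \<open>
  An ideal is represented by a set of generators, so that the product of ideals is the elementwise
  product of sets; \<open>\<asymp>\<close> below is equality of ideal classes.
\<close>

inductive_set mspan :: "'a fls set \<Rightarrow> 'a fls set" for A where
  zero: "0 \<in> mspan A"
| step: "r \<in> R \<Longrightarrow> a \<in> A \<Longrightarrow> x \<in> mspan A \<Longrightarrow> r * a + x \<in> mspan A"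

lemma mspan_add: "x \<in> mspan A \<Longrightarrow> y \<in> mspan A \<Longrightarrow> x + y \<in> mspan A"
  by (induction rule: mspan.induct) (auto simp: add.assoc intro: mspan.step)

lemma mspan_scale: "x \<in> mspan A \<Longrightarrow> r \<in> R \<Longrightarrow> r * x \<in> mspan A"
proof (induction rule: mspan.induct)
  case (step s a x)
  have "(r * s) * a + r * x \<in> mspan A" using step by (intro mspan.step) auto
  then show ?case by (simp add: algebra_simps)
qed (auto intro: mspan.zero)

lemma mspan_gen: "r \<in> R \<Longrightarrow> a \<in> A \<Longrightarrow> r * a \<in> mspan A"
  using mspan.step[OF _ _ mspan.zero] by simp

lemma mspan_base: "a \<in> A \<Longrightarrow> a \<in> mspan A"
  using mspan_gen[OF R_1] by simp

lemma mspan_subI: "A \<subseteq> mspan B \<Longrightarrow> mspan A \<subseteq> mspan B"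
proof
  fix x assume s: "A \<subseteq> mspan B" and "x \<in> mspan A"
  from this(2) show "x \<in> mspan B"
    by induction (use s in \<open>auto intro: mspan.zero mspan_add mspan_scale\<close>)
qed

lemma mspan_eqI: "A \<subseteq> mspan B \<Longrightarrow> B \<subseteq> mspan A \<Longrightarrow> mspan A = mspan B"
  by (simp add: mspan_subI subset_antisym)

lemma mspan_mult: "x \<in> mspan A \<Longrightarrow> b \<in> B \<Longrightarrow> x * b \<in> mspan (A * B)"
  by (induction rule: mspan.induct)
     (auto simp: algebra_simps intro!: mspan.zero mspan_add mspan_gen set_times_intro)

lemma mspan_mult_cong: "mspan A = mspan A' \<Longrightarrow> mspan (A * B) = mspan (A' * B)"
proof (rule mspan_eqI)
  assume e: "mspan A = mspan A'"
  have "a \<in> mspan A'" if "a \<in> A" for a using mspan_base[OF that] e by simp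
  then show "A * B \<subseteq> mspan (A' * B)" by (auto elim!: set_times_elim intro: mspan_mult)
  have "a \<in> mspan A" if "a \<in> A'" for a using mspan_base[OF that] e by simp
  then show "A' * B \<subseteq> mspan (A * B)" by (auto elim!: set_times_elim intro: mspan_mult)
qed

lemma mspan_mult_cong': "mspan A = mspan A' \<Longrightarrow> mspan (B * A) = mspan (B * A')"
  using mspan_mult_cong[of A A' B] by (simp add: mult.commute)

definition eqv :: "'a fls set \<Rightarrow> 'a fls set \<Rightarrow> bool" (infix "\<asymp>" 50) where
  "A \<asymp> B \<longleftrightarrow> (\<exists>h. h \<noteq> 0 \<and> mspan ({h} * A) = mspan B)"

lemma single_times: "{a} * {b} = {a * b :: 'a fls}" by (auto simp: set_times_def)

lemma inverse_single_times: "h \<noteq> 0 \<Longrightarrow> {inverse h} * ({h} * A) = (A :: 'a fls set)"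
  by (simp add: mult.assoc[symmetric] single_times set_one[symmetric] del: set_one)

text \<open>Allowing a factor on each side avoids fractions; the factor between the classes is
  \<open>u / v\<close>.\<close>

lemma eqvI:
  assumes "u \<noteq> 0" "v \<noteq> 0" "mspan ({u} * A) = mspan ({v} * B)"
  shows "A \<asymp> B"
proof -
  have "mspan ({inverse v} * ({u} * A)) = mspan ({inverse v} * ({v} * B))"
    by (rule mspan_mult_cong'[OF assms(3)])
  moreover have "{inverse v} * ({v} * B) = B"
    using assms(2) by (rule inverse_single_times)
  moreover have "{inverse v} * ({u} * A) = {inverse v * u} * A"
    by (simp only: mult.assoc[symmetric] single_times)
  ultimately show ?thesis using assms unfolding eqv_def by (intro exI[of _ "inverse v * u"]) simp
qed

lemma eqv_refl: "A \<asymp> A"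
  by (rule eqvI[of 1 1]) auto

lemma eqv_sym: "A \<asymp> B \<Longrightarrow> B \<asymp> A"
  unfolding eqv_def[of A] by (metis eqvI mult_1 set_one zero_neq_one)

lemma eqv_trans: "A \<asymp> B \<Longrightarrow> B \<asymp> C \<Longrightarrow> A \<asymp> C"
proof -
  assume "A \<asymp> B" "B \<asymp> C"
  then obtain h k where h: "h \<noteq> 0" "mspan ({h} * A) = mspan B" and k: "k \<noteq> 0" "mspan ({k} * B) = mspan C"
    by (auto simp: eqv_def)
  have "mspan ({k} * ({h} * A)) = mspan C" using mspan_mult_cong'[OF h(2), of "{k}"] k by simp
  then have "mspan ({k * h} * A) = mspan C" by (simp only: mult.assoc[symmetric] single_times)
  then show ?thesis using h k unfolding eqv_def by (intro exI[of _ "k * h"]) auto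
qed

lemma eqv_mult: "A \<asymp> B \<Longrightarrow> A * C \<asymp> B * C"
  unfolding eqv_def by (metis mspan_mult_cong mult.assoc)

lemma eqv_mult2: "A \<asymp> B \<Longrightarrow> C \<asymp> D \<Longrightarrow> A * C \<asymp> B * D"
  by (metis eqv_mult eqv_trans mult.commute)

text \<open>Evaluation at a point of the curve is a ring homomorphism that kills both generators. A
  Laurent series has no value at the point, so evaluation is expressed by the coordinates
  \<open>p\<close> and \<open>q\<close>, which \<open>fun_eqD\<close> makes unique.\<close>

lemma mspan_vanish:
  assumes c: "on_curve W (Affine x y)" and z: "z \<in> mspan {U - cc x, V - cc y}"
    and e: "z = ev p + ev q * V"
  shows "poly p x + poly q x * y = 0"
  using z e
proof (induction z arbitrary: p q rule: mspan.induct)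
  case zero
  then have "ev 0 + ev 0 * V = ev p + ev q * V" by simp
  from fun_eqD[OF this] show ?case by auto
next
  case (step r a z)
  from step obtain p1 q1 where r: "r = ev p1 + ev q1 * V" by (auto simp: R_def)
  obtain p2 q2 where a: "a = ev p2 + ev q2 * V" "poly p2 x + poly q2 x * y = 0"
  proof (cases "a = U - cc x")
    case True
    then show ?thesis by (intro that[of "[:-x, 1:]" 0]) auto
  next
    case False
    then have "a = V - cc y" using step by auto
    then show ?thesis by (intro that[of "[:-y:]" "[:1:]"]) auto
  qed
  define p' q' where "p' = p1 * p2 + q1 * q2 * cubic"
    and "q' = p1 * q2 + q1 * p2 + q1 * q2 * [:- a3 W, - a1 W:]"
  have ra: "r * a = ev p' + ev q' * V" unfolding r a(1) p'_def q'_def by (rule fun_mult)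
  have cu: "poly cubic x = y ^ 2 + a1 W * x * y + a3 W * y"
    using c by (simp add: cubic_def power2_eq_square power3_eq_cube algebra_simps)
  \<comment> \<open>Replacing \<open>V^2\<close> by means of the equation does not change values at
    a point of the curve.\<close>
  have "poly p' x + poly q' x * y = (poly p1 x + poly q1 x * y) * (poly p2 x + poly q2 x * y)"
    unfolding p'_def q'_def poly_add poly_mult cu
    by (simp add: power2_eq_square algebra_simps)
  then have v': "poly p' x + poly q' x * y = 0" using a by simp
  have "z = ev (p + Polynomial.smult (-1) p') + ev (q + Polynomial.smult (-1) q') * V"
    using step.prems ra by (simp add: ev_add ev_smult algebra_simps del: Polynomial.smult_minus_left)
  from step.IH[OF this] v' show ?case by (simp add: algebra_simps)
qed

lemma mspan_R: "A \<subseteq> R \<Longrightarrow> z \<in> mspan A \<Longrightarrow> z \<in> R"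
  by (rotate_tac, induction rule: mspan.induct) auto

lemma degree_le_1_cases:
  assumes "Polynomial.degree p \<le> 1"
  obtains a b where "p = [:a, b:]"
proof -
  obtain a q where p: "p = pCons a q" by (cases p)
  then have "Polynomial.degree q = 0" using assms by (cases "q = 0") auto
  then obtain b where "q = [:b:]" by (elim degree_eq_zeroE)
  then show ?thesis using p that by simp
qed

text \<open>A term in \<open>V\<close> forces order at most \<open>- 3\<close> and a nonconstant
  polynomial in \<open>U\<close> at most \<open>- 2\<close>. The missing order \<open>- 1\<close>,
  characteristic of genus one, is what makes the class map injective.\<close>

lemma ord_R:
  assumes "z \<in> R" "z \<noteq> 0" "fls_subdegree z \<ge> - 1"
  shows "\<exists>c. z = cc c"
proof -
  obtain p q where e: "z = ev p + ev q * V" using assms by (auto simp: R_def)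
  have "q = 0" using ord_fun(2)[OF e] assms by force
  moreover have "Polynomial.degree p = 0" using ord_fun(1)[OF e] assms by (cases "p = 0") auto
  ultimately show ?thesis using e by (elim degree_eq_zeroE) auto
qed

fun gens :: "'a point \<Rightarrow> 'a fls set" where
  "gens Infinity = {1}"
| "gens (Affine x y) = {U - cc x, V - cc y}"

lemma gens_R: "gens P \<subseteq> R" by (cases P) auto

lemma ord_mspan:
  assumes "on_curve W (Affine x y)" "z \<in> mspan (gens (Affine x y))" "z \<noteq> 0"
  shows "fls_subdegree z \<le> - 2"
proof (rule ccontr)
  assume "\<not> ?thesis"
  moreover have "z \<in> R" using assms mspan_R[OF gens_R] by blast
  ultimately obtain c where c: "z = cc c" using ord_R assms by force
  then have "z = ev [:c:] + ev 0 * V" by simp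
  from mspan_vanish[OF assms(1) _ this] assms(2,3) c show False by simp
qed

lemma ord_Ux: "U - cc x \<noteq> 0 \<and> fls_subdegree (U - cc x) = - 2"
proof -
  have "fls_subdegree (U - cc x) = fls_subdegree U"
    using ordX U_nz by (intro fls_subdegree_diff_eq1) auto
  then show ?thesis using ordX by force
qed

lemma ord_Vy: "V - cc y \<noteq> 0 \<and> fls_subdegree (V - cc y) = - 3"
proof -
  have "fls_subdegree (V - cc y) = fls_subdegree V"
    using ordY V_nz by (intro fls_subdegree_diff_eq1) auto
  then show ?thesis using ordY by force
qed

text \<open>A generator would have order \<open>- 2\<close>, and \<open>V - cc y\<close> would be its multiple by a function of order \<open>- 1\<close>.\<close>

lemma not_principal:
  assumes c: "on_curve W (Affine x y)"
  shows "\<not> gens Infinity \<asymp> gens (Affine x y)"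
proof
  assume "gens Infinity \<asymp> gens (Affine x y)"
  then obtain h where h: "h \<noteq> 0" and e: "mspan {h} = mspan (gens (Affine x y))"
    by (auto simp: eqv_def set_times_def)
  have multiple: "\<exists>r\<in>R. z = r * h" if "z \<in> mspan {h}" for z
    using that
  proof (induction rule: mspan.induct)
    case zero show ?case by (rule bexI[of _ 0]) auto
  next
    case (step r a x)
    then obtain s where "s \<in> R" "x = s * h" by auto
    then show ?case using step by (intro bexI[of _ "r + s"]) (auto simp: algebra_simps)
  qed
  have oh: "fls_subdegree h \<le> - 2"
    using ord_mspan[OF c _ h] mspan_base[of h "{h}"] e by simp
  have "U - cc x \<in> mspan {h}" "V - cc y \<in> mspan {h}" unfolding e by (auto intro: mspan_base)
  then obtain r s where r: "r \<in> R" "U - cc x = r * h" and s: "s \<in> R" "V - cc y = s * h"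
    using multiple by metis
  have rn: "r \<noteq> 0" and sn: "s \<noteq> 0" using r s ord_Ux[of x] ord_Vy[of y] by auto
  have or: "fls_subdegree r + fls_subdegree h = - 2" and os: "fls_subdegree s + fls_subdegree h = - 3"
    using ord_Ux[of x] ord_Vy[of y] r s rn sn h by auto
  obtain c where "r = cc c" using ord_R[OF r(1) rn] or oh by auto
  then have "fls_subdegree h = - 2" using or by simp
  then have s1: "fls_subdegree s = - 1" using os by simp
  then obtain c where "s = cc c" using ord_R[OF s(1) sn] by auto
  then show False using s1 by simp
qed

text \<open>
  The ideal of a point has elements of order \<open>- 2\<close> but of no larger order, so a factor between two such
  ideals has order 0. It maps \<open>U - cc x1\<close> and \<open>V - cc y1\<close> to functions of order \<open>- 2\<close> and \<open>- 3\<close>, and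
  comparing coefficients gives the claim.
\<close>

lemma eqv_affine_inj:
  assumes c: "on_curve W (Affine x1 y1)" "on_curve W (Affine x2 y2)"
    and "gens (Affine x1 y1) \<asymp> gens (Affine x2 y2)"
  shows "x1 = x2 \<and> y1 = y2"
proof -
  let ?A = "gens (Affine x1 y1)" and ?B = "gens (Affine x2 y2)"
  obtain h where h: "h \<noteq> 0" and e: "mspan ({h} * ?A) = mspan ?B"
    using assms(3) by (auto simp: eqv_def)
  define a b where "a = h * (U - cc x1)" and "b = h * (V - cc y1)"
  have a: "a \<in> mspan ?B" and b: "b \<in> mspan ?B"
    unfolding e[symmetric] a_def b_def by (auto intro!: mspan_base set_times_intro)
  have an: "a \<noteq> 0" "fls_subdegree a = fls_subdegree h - 2"
    and bn: "b \<noteq> 0" "fls_subdegree b = fls_subdegree h - 3"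
    using ord_Ux[of x1] ord_Vy[of y1] h by (auto simp: a_def b_def)
  have "fls_subdegree h \<le> 0" using ord_mspan[OF c(2) a an(1)] an(2) by simp
  \<comment> \<open>Multiplication by \<open>inverse h\<close> maps the second ideal to the first,
    so the bound just obtained also applies to \<open>inverse h\<close>.\<close>
  moreover have "fls_subdegree h \<ge> 0"
  proof -
    have "mspan ({inverse h} * ({h} * ?A)) = mspan ({inverse h} * ?B)"
      by (rule mspan_mult_cong'[OF e])
    moreover have "{inverse h} * ({h} * ?A) = ?A"
      using h by (rule inverse_single_times)
    ultimately have "inverse h * (U - cc x2) \<in> mspan ?A"
      by (auto intro!: mspan_base set_times_intro)
    from ord_mspan[OF c(1) this] ord_Ux[of x2] h show ?thesis by simp
  qed
  ultimately have h0: "fls_subdegree h = 0" by simp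
  obtain p q where p: "a = ev p + ev q * V" using mspan_R[OF gens_R a] by (auto simp: R_def)
  obtain p' q' where p': "b = ev p' + ev q' * V" using mspan_R[OF gens_R b] by (auto simp: R_def)
  have "q = 0" using ord_fun(2)[OF p] an h0 by force
  have "Polynomial.degree p \<le> 1" using ord_fun(1)[OF p] an h0 by (cases "p = 0") auto
  then obtain m k where pk: "p = [:m, k:]"
    by (rule degree_le_1_cases)
  have va: "m + k * x2 = 0"
    using mspan_vanish[OF c(2) _ p] a \<open>q = 0\<close> pk by (simp add: algebra_simps)
  have q'd: "Polynomial.degree q' = 0" using ord_fun(2)[OF p'] bn h0 by (cases "q' = 0") auto
  then obtain n where qn: "q' = [:n:]" by (metis degree_eq_zeroE)
  \<comment> \<open>Both sides are \<open>h (U - cc x1) (V - cc y1)\<close>; comparing their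
    coordinates eliminates \<open>h\<close>.\<close>
  have "a * (V - cc y1) = b * (U - cc x1)" by (simp add: a_def b_def)
  moreover have "a * (V - cc y1) = ev (Polynomial.smult (-y1) p) + ev p * V"
    using \<open>q = 0\<close> by (simp add: p ev_smult algebra_simps del: Polynomial.smult_minus_left)
  moreover have "b * (U - cc x1) = ev (p' * [:-x1, 1:]) + ev (q' * [:-x1, 1:]) * V"
    by (simp add: p' ev_mult algebra_simps del: mult_pCons_right)
  ultimately have "ev (Polynomial.smult (-y1) p) + ev p * V = ev (p' * [:-x1, 1:]) + ev (q' * [:-x1, 1:]) * V"
    by simp
  from fun_eqD[OF this] have e1: "Polynomial.smult (-y1) p = p' * [:-x1, 1:]" and e2: "p = q' * [:-x1, 1:]"
    by auto
  have kn: "k = n" "m = - x1 * n" using e2 by (simp_all add: pk qn)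
  have k0: "k \<noteq> 0"
  proof
    assume "k = 0"
    then have "p = 0" using kn pk by simp
    then show False using p an \<open>q = 0\<close> by simp
  qed
  have x: "x1 = x2" using va kn k0 by (simp add: algebra_simps)
  have "p' * [:-x1, 1:] = Polynomial.smult (-y1 * n) 1 * [:-x1, 1:]"
    unfolding e1[symmetric] e2 qn by (simp add: algebra_simps)
  then have "p' = [:- y1 * n:]" by (metis mult_cancel_right pCons_eq_0_iff one_neq_zero smult_one)
  then have "- y1 * n + n * y2 = 0"
    using mspan_vanish[OF c(2) _ p'] b qn by simp
  then show ?thesis using x kn k0 by (simp add: algebra_simps)
qed

lemma eqv_inj:
  assumes "on_curve W P" "on_curve W Q" "gens P \<asymp> gens Q"
  shows "P = Q"
proof (cases P)
  case Infinity
  then show ?thesis using assms not_principal by (cases Q) auto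
next
  case (Affine x y)
  then show ?thesis using assms not_principal[of x y] eqv_affine_inj[of x y] eqv_sym[OF assms(3)]
    by (cases Q) auto
qed

section \<open>Chord-and-tangent addition as multiplication of ideal classes\<close>

lemma R_numeral [simp]: "numeral n \<in> R"
  using R_cc[of "numeral n"] by (simp only: fls_const_numeral)

lemma mspan_comb2: "r \<in> R \<Longrightarrow> s \<in> R \<Longrightarrow> a \<in> A \<Longrightarrow> b \<in> A \<Longrightarrow> z = r * a + s * b \<Longrightarrow> z \<in> mspan A"
  by (simp add: mspan_add mspan_gen)

lemma mspan_comb3:
  "r \<in> R \<Longrightarrow> s \<in> R \<Longrightarrow> t \<in> R \<Longrightarrow> a \<in> A \<Longrightarrow> b \<in> A \<Longrightarrow> c \<in> A \<Longrightarrow> z = r * a + s * b + t * c \<Longrightarrow> z \<in> mspan A"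
  by (simp add: mspan_add mspan_gen)

lemma pair_times: "{a, b} * {c, d} = {a * c, a * d, b * c, b * (d :: 'a fls)}"
  by (auto simp: set_times_def)

lemma single_times_pair: "{a} * {c, d} = {a * c, a * (d :: 'a fls)}"
  by (auto simp: set_times_def)

text \<open>The vertical line through the two points cuts out exactly them, so the product of their
  ideals is generated by \<open>U - cc x\<close>. For distinct points this follows because
  \<open>b - b'\<close> is a nonzero constant; if the points coincide, the nonvanishing derivative
  \<open>k\<close> in the direction of \<open>x\<close> takes its place, and here smoothness is
  used.\<close>

lemma gens_neg:
  assumes c: "on_curve W (Affine x y)" and y': "y' = - y - a1 W * x - a3 W"
  shows "gens (Affine x y) * gens (Affine x y') \<asymp> gens Infinity"
proof -
  define a b b' where "a = U - cc x" and "b = V - cc y" and "b' = V - cc y'"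
  define q where "q = U ^ 2 + U * cc x + cc x ^ 2 + cc (a2 W) * (U + cc x) + cc (a4 W) - cc (a1 W) * V"
  have [simp]: "a \<in> R" "b \<in> R" "b' \<in> R" by (auto simp: a_def b_def b'_def)
  have [simp]: "q \<in> R" by (simp add: q_def power2_eq_square)
  have ccurve: "cc y ^ 2 + cc (a1 W) * cc x * cc y + cc (a3 W) * cc y =
      cc x ^ 3 + cc (a2 W) * cc x ^ 2 + cc (a4 W) * cc x + cc (a6 W)"
    using arg_cong[OF c[unfolded on_curve.simps], of cc] by (simp only: cc_simps)
  have y'': "cc y' = - cc y - cc (a1 W) * cc x - cc (a3 W)" by (simp add: y' cc_simps del: fls_const_mult_const)
  have bb': "b * b' = a * q"
    using equation ccurve unfolding a_def b_def b'_def q_def y'' by Groebner_Basis.algebra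
  let ?S = "{a * a, a * b', b * a, b * b'}"
  have "{a} \<subseteq> mspan ?S"
  proof (cases "y = y'")
    case False
    have "b - b' = cc (y' - y)" by (simp add: b_def b'_def cc_simps del: fls_const_mult_const)
    then have "cc (inverse (y' - y)) * (b - b') = 1" using False by simp
    then have "a = cc (inverse (y' - y)) * (b * a) + (- cc (inverse (y' - y))) * (a * b')" by Groebner_Basis.algebra
    then have "a \<in> mspan ?S" by (rule mspan_comb2[rotated 4]) auto
    then show ?thesis by simp
  next
    case True
    define k where "k = 3 * x ^ 2 + 2 * a2 W * x + a4 W - a1 W * y"
    have k: "k \<noteq> 0" unfolding k_def using True y' c by (intro nonsingular[OF disc_nz c]) (simp add: algebra_simps)
    have "cc k = 3 * cc x ^ 2 + 2 * cc (a2 W) * cc x + cc (a4 W) - cc (a1 W) * cc y"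
      by (simp add: k_def cc_simps del: fls_const_mult_const)
    then have e: "cc k = q - (U + 2 * cc x + cc (a2 W)) * a + cc (a1 W) * b"
      unfolding q_def a_def b_def by Groebner_Basis.algebra
    have "cc (inverse k) * cc k = 1" using k by simp
    then have "a = cc (inverse k) * (b * b') + (- (cc (inverse k) * (U + 2 * cc x + cc (a2 W)))) * (a * a)
        + (cc (inverse k) * cc (a1 W)) * (b * a)"
      using e bb' by Groebner_Basis.algebra
    then have "a \<in> mspan ?S" by (rule mspan_comb3[rotated 6]) simp_all
    then show ?thesis by simp
  qed
  moreover have "?S \<subseteq> mspan {a}"
  proof -
    have "a * a \<in> mspan {a}" "b' * a \<in> mspan {a}" "b * a \<in> mspan {a}" "q * a \<in> mspan {a}"
      by (auto intro: mspan_gen)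
    then show ?thesis unfolding bb' by (simp add: mult.commute)
  qed
  ultimately have "mspan {a} = mspan ?S" by (rule mspan_eqI)
  then have "mspan ({a} * {1}) = mspan ({1} * ?S)"
    by (simp add: set_one[symmetric] del: set_one)
  then have "{1} \<asymp> ?S" using ord_Ux[of x] by (intro eqvI[of a 1]) (auto simp: a_def)
  then show ?thesis by (simp add: eqv_sym pair_times a_def b_def b'_def)
qed

text \<open>Vieta's formulas with the third root defined by the sum of the roots. If the two given
  roots coincide, vanishing of the derivative replaces the second equation.\<close>

lemma cubic_roots:
  fixes x1 x2 x3 A B C :: 'a
  assumes "x1 ^ 3 + A * x1 ^ 2 + B * x1 + C = 0"
    and "if x1 = x2 then 3 * x1 ^ 2 + 2 * A * x1 + B = 0 else x2 ^ 3 + A * x2 ^ 2 + B * x2 + C = 0"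
    and "x1 + x2 + x3 = - A"
  shows "B = x1 * x2 + x1 * x3 + x2 * x3" "C = - (x1 * x2 * x3)"
proof -
  show B: "B = x1 * x2 + x1 * x3 + x2 * x3"
  proof (cases "x1 = x2")
    case False
    have "(x1 - x2) * (B - (x1 * x2 + x1 * x3 + x2 * x3)) = 0"
      using assms False by simp Groebner_Basis.algebra
    then show ?thesis using False by simp
  next
    case True
    then have "3 * x1 ^ 2 + 2 * A * x1 + B = 0" "x1 + x1 + x3 = - A" using assms by simp_all
    then have "B = x1 * x1 + x1 * x3 + x1 * x3" by Groebner_Basis.algebra
    then show ?thesis using True by simp
  qed
  show "C = - (x1 * x2 * x3)" using assms(1,3) B by Groebner_Basis.algebra
qed

text \<open>
  With \<open>L\<close> the line through the two points and \<open>M\<close> its conjugate up to sign, \<open>L M\<close> is the product of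
  the three \<open>U - xi\<close>. Dividing \<open>(U - x3) (U - x1, L) (U - x2, L)\<close> by \<open>L\<close> leaves the ideal
  generated by \<open>M\<close> and \<open>(U - x3) (U - x1, U - x2, L)\<close>; here \<open>U - x1\<close>, \<open>U - x2\<close>, \<open>L\<close> and \<open>M\<close>
  have no common zero.
\<close>

lemma gens_line:
  assumes c1: "y1 ^ 2 + a1 W * x1 * y1 + a3 W * y1 = x1 ^ 3 + a2 W * x1 ^ 2 + a4 W * x1 + a6 W"
    and c2: "y2 ^ 2 + a1 W * x2 * y2 + a3 W * y2 = x2 ^ 3 + a2 W * x2 ^ 2 + a4 W * x2 + a6 W"
    and l1: "y1 = l * x1 + v" and l2: "y2 = l * x2 + v"
    and tan: "x1 = x2 \<Longrightarrow> l * (2 * y1 + a1 W * x1 + a3 W) = 3 * x1 ^ 2 + 2 * a2 W * x1 + a4 W - a1 W * y1"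
    and nz: "x1 = x2 \<Longrightarrow> 2 * y1 + a1 W * x1 + a3 W \<noteq> 0"
    and x3: "x3 = l ^ 2 + a1 W * l - a2 W - x1 - x2" and y3: "y3 = - (l + a1 W) * x3 - v - a3 W"
  shows "gens (Affine x1 y1) * gens (Affine x2 y2) \<asymp> gens (Affine x3 y3)"
proof -
  define p q r where "p = U - cc x1" and "q = U - cc x2" and "r = U - cc x3"
  define L M where "L = V - cc l * U - cc v" and "M = V + (cc (a1 W) + cc l) * U + cc (a3 W) + cc v"
  have [simp]: "p \<in> R" "q \<in> R" "r \<in> R" "L \<in> R" "M \<in> R"
    by (auto simp: p_def q_def r_def L_def M_def)
  \<comment> \<open>The coefficients of the monic cubic that remains when \<open>y = l x + v\<close>
    is substituted into the equation.\<close>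
  define A B C where "A = a2 W - l ^ 2 - a1 W * l" and "B = a4 W - 2 * l * v - a1 W * v - a3 W * l"
    and "C = a6 W - v ^ 2 - a3 W * v"
  have k1: "x1 ^ 3 + A * x1 ^ 2 + B * x1 + C = 0"
    using c1 l1 unfolding A_def B_def C_def by Groebner_Basis.algebra
  have k2: "if x1 = x2 then 3 * x1 ^ 2 + 2 * A * x1 + B = 0 else x2 ^ 3 + A * x2 ^ 2 + B * x2 + C = 0"
  proof (cases "x1 = x2")
    case True
    have "3 * x1 ^ 2 + 2 * A * x1 + B = 0"
      using tan[OF True] l1 unfolding A_def B_def by Groebner_Basis.algebra
    then show ?thesis using True by simp
  next
    case False
    have "x2 ^ 3 + A * x2 ^ 2 + B * x2 + C = 0"
      using c2 l2 unfolding A_def B_def C_def by Groebner_Basis.algebra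
    then show ?thesis using False by simp
  qed
  have s: "x1 + x2 + x3 = - A" by (simp add: x3 A_def)
  from cubic_roots[OF k1 k2 s] have
    BC: "a4 W = x1 * x2 + x1 * x3 + x2 * x3 + (2 * l * v + a1 W * v + a3 W * l)"
      "a6 W = - (x1 * x2 * x3) + (v ^ 2 + a3 W * v)" "a2 W = l ^ 2 + a1 W * l - x1 - x2 - x3"
    using s by (auto simp: A_def B_def C_def algebra_simps)
  have LM: "L * M = p * q * r"
    using equation unfolding L_def M_def p_def q_def r_def
    unfolding BC[THEN arg_cong, of cc] cc_simps by Groebner_Basis.algebra
  have e1: "cc y1 = cc l * cc x1 + cc v" "cc y2 = cc l * cc x2 + cc v"
    by (simp_all add: l1 l2 cc_simps del: fls_const_mult_const)
  have g1: "mspan (gens (Affine x1 y1)) = mspan {p, L}"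
    unfolding gens.simps p_def[symmetric]
  proof (rule mspan_eqI)
    have "V - cc y1 = cc l * p + 1 * L" by (simp add: p_def L_def e1 algebra_simps)
    then have "V - cc y1 \<in> mspan {p, L}" by (rule mspan_comb2[rotated 4]) auto
    then show "{p, V - cc y1} \<subseteq> mspan {p, L}" by (auto intro: mspan_base)
    have "L = (- cc l) * p + 1 * (V - cc y1)" by (simp add: p_def L_def e1 algebra_simps)
    then have "L \<in> mspan {p, V - cc y1}" by (rule mspan_comb2[rotated 4]) auto
    then show "{p, L} \<subseteq> mspan {p, V - cc y1}" by (auto intro: mspan_base)
  qed
  have g2: "mspan (gens (Affine x2 y2)) = mspan {q, L}"
    unfolding gens.simps q_def[symmetric]
  proof (rule mspan_eqI)
    have "V - cc y2 = cc l * q + 1 * L" by (simp add: q_def L_def e1 algebra_simps)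
    then have "V - cc y2 \<in> mspan {q, L}" by (rule mspan_comb2[rotated 4]) auto
    then show "{q, V - cc y2} \<subseteq> mspan {q, L}" by (auto intro: mspan_base)
    have "L = (- cc l) * q + 1 * (V - cc y2)" by (simp add: q_def L_def e1 algebra_simps)
    then have "L \<in> mspan {q, V - cc y2}" by (rule mspan_comb2[rotated 4]) auto
    then show "{q, L} \<subseteq> mspan {q, V - cc y2}" by (auto intro: mspan_base)
  qed
  have e3: "cc y3 = - (cc l + cc (a1 W)) * cc x3 - cc v - cc (a3 W)" by (simp add: y3 cc_simps del: fls_const_mult_const)
  have g3: "mspan (gens (Affine x3 y3)) = mspan {r, M}"
    unfolding gens.simps r_def[symmetric]
  proof (rule mspan_eqI)
    have "V - cc y3 = (- (cc l + cc (a1 W))) * r + 1 * M" by (simp add: r_def M_def e3 algebra_simps)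
    then have "V - cc y3 \<in> mspan {r, M}" by (rule mspan_comb2[rotated 4]) auto
    then show "{r, V - cc y3} \<subseteq> mspan {r, M}" by (auto intro: mspan_base)
    have "M = (cc l + cc (a1 W)) * r + 1 * (V - cc y3)" by (simp add: r_def M_def e3 algebra_simps)
    then have "M \<in> mspan {r, V - cc y3}" by (rule mspan_comb2[rotated 4]) auto
    then show "{r, M} \<subseteq> mspan {r, V - cc y3}" by (auto intro: mspan_base)
  qed
  have "mspan ({r} * ({p, L} * {q, L})) = mspan ({L} * {r, M})"
  proof (rule mspan_eqI)
    let ?S = "{r * (p * q), r * (p * L), r * (L * q), r * (L * L)}"
    have S: "{r} * ({p, L} * {q, L}) = ?S"
      unfolding pair_times by (auto simp: set_times_def)
    have "r * (p * q) = 1 * (L * M)" "r * (p * L) = p * (L * r)" "r * (L * q) = q * (L * r)"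
      "r * (L * L) = L * (L * r)"
      by (simp_all only: LM mult_1 ac_simps)
    then show "{r} * ({p, L} * {q, L}) \<subseteq> mspan ({L} * {r, M})"
      unfolding S single_times_pair by (simp only: insert_subset empty_subsetI mspan_gen R_1
        \<open>p \<in> R\<close> \<open>q \<in> R\<close> \<open>L \<in> R\<close> insertI1 insertI2 simp_thms)
    have "L * M = 1 * (r * (p * q))" using LM by (simp add: ac_simps)
    then have LMS: "L * M \<in> mspan ?S" by (auto intro: mspan_base)
    have "L * r \<in> mspan ?S"
    proof (cases "x1 = x2")
      case False
      define k where "k = inverse (x1 - x2)"
      have "q - p = cc (x1 - x2)" by (simp add: q_def p_def cc_simps del: fls_const_mult_const)
      then have "cc k * (q - p) = 1" using False by (simp add: k_def)
      then have "L * r = cc k * (r * (L * q)) + (- cc k) * (r * (p * L))" by Groebner_Basis.algebra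
      then show ?thesis by (rule mspan_comb2[rotated 4]) auto
    next
      \<comment> \<open>Now \<open>p = q\<close>, and a unit has to come from elsewhere:
        \<open>M\<close> has the nonzero value \<open>2 y1 + a1 x1 + a3\<close> at the point of
        tangency, so it becomes this constant after subtracting multiples of \<open>L\<close> and
        \<open>p\<close>.\<close>
      case True
      define k where "k = 2 * y1 + a1 W * x1 + a3 W"
      have "cc k = 2 * cc y1 + cc (a1 W) * cc x1 + cc (a3 W)" by (simp add: k_def cc_simps del: fls_const_mult_const)
      then have k: "cc k = M - L - (cc (a1 W) + 2 * cc l) * p"
        unfolding M_def L_def p_def e1 by Groebner_Basis.algebra
      have "cc (inverse k) * cc k = 1" using nz[OF True] by (simp add: k_def)
      then have "L * r = (cc (inverse k) * r) * (r * (p * q)) + (- cc (inverse k)) * (r * (L * L))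
          + (- (cc (inverse k) * (cc (a1 W) + 2 * cc l))) * (r * (p * L))"
        using k LM by Groebner_Basis.algebra
      then show ?thesis by (rule mspan_comb3[rotated 6]) simp_all
    qed
    then show "{L} * {r, M} \<subseteq> mspan ({r} * ({p, L} * {q, L}))"
      unfolding S single_times_pair using LMS by auto
  qed
  moreover have "mspan ({r} * (gens (Affine x1 y1) * gens (Affine x2 y2))) = mspan ({r} * ({p, L} * {q, L}))"
    by (rule mspan_mult_cong'[OF trans[OF mspan_mult_cong[OF g1] mspan_mult_cong'[OF g2]]])
  moreover have "mspan ({L} * gens (Affine x3 y3)) = mspan ({L} * {r, M})"
    by (rule mspan_mult_cong'[OF g3])
  moreover have "r \<noteq> 0" using ord_Ux by (simp add: r_def)
  moreover have "L \<noteq> 0" 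
  proof
    assume "L = 0"
    then have "ev [:v, l:] + ev 0 * V = ev 0 + ev [:1:] * V" by (simp add: L_def algebra_simps)
    from fun_eqD[OF this] show False by simp
  qed
  ultimately show ?thesis by (intro eqvI[of r L]) auto
qed

lemma gens_add:
  assumes "on_curve W P" "on_curve W Q"
  shows "gens P * gens Q \<asymp> gens (point_add W P Q)"
proof (cases P)
  case Infinity
  then show ?thesis by (simp add: eqv_refl set_one[symmetric] del: set_one)
next
  case P: (Affine x1 y1)
  show ?thesis
  proof (cases Q)
    case Infinity
    then show ?thesis using P by (simp add: eqv_refl set_one[symmetric] del: set_one)
  next
    case Q: (Affine x2 y2)
    note c = assms[unfolded P Q on_curve.simps]
    show ?thesis
    proof (cases "x1 = x2 \<and> y1 + y2 + a1 W * x2 + a3 W = 0")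
      case True
      then have "y2 = - y1 - a1 W * x1 - a3 W" by (simp add: algebra_simps eq_neg_iff_add_eq_0)
      from gens_neg[OF assms(1)[unfolded P] this] True P Q show ?thesis by simp
    next
      case False
      have eq: "y1 = y2" if "x1 = x2"
      proof -
        have "(y1 - y2) * (y1 + y2 + a1 W * x2 + a3 W) = 0"
          using c that by Groebner_Basis.algebra
        then show ?thesis using that False by simp
      qed
      define l where "l = (if x1 = x2
                    then (3 * x1 ^ 2 + 2 * a2 W * x1 + a4 W - a1 W * y1) / (2 * y1 + a1 W * x1 + a3 W)
                    else (y2 - y1) / (x2 - x1))"
      define v where "v = y1 - l * x1"
      define x3 where "x3 = l ^ 2 + a1 W * l - a2 W - x1 - x2"
      have r: "point_add W P Q = Affine x3 (- (l + a1 W) * x3 - v - a3 W)"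
        using False by (simp add: P Q l_def v_def x3_def Let_def)
      have nz: "x1 = x2 \<Longrightarrow> 2 * y1 + a1 W * x1 + a3 W \<noteq> 0" using False eq by auto
      show ?thesis unfolding r unfolding P Q
      proof (rule gens_line[OF c])
        show "y1 = l * x1 + v" by (simp add: v_def)
        show "y2 = l * x2 + v"
        proof (cases "x1 = x2")
          case True
          then show ?thesis using eq by (simp add: v_def)
        next
          case False
          then have "l * (x2 - x1) = y2 - y1" by (simp add: l_def)
          then show ?thesis by (simp add: v_def algebra_simps)
        qed
        show "l * (2 * y1 + a1 W * x1 + a3 W) = 3 * x1 ^ 2 + 2 * a2 W * x1 + a4 W - a1 W * y1" if "x1 = x2"
          using that nz by (simp add: l_def)
      qed (use nz x3_def in auto)
    qed
  qed
qed

end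

text \<open>With \<open>U = 1 / t^2\<close>, completing the square in the equation leaves the task
  of extracting a square root of \<open>4 U^3 + b2 U^2 + 2 b4 U + b6\<close>. This is
  \<open>4 / t^6\<close> times a power series \<open>H\<close> with constant term 1, which has a
  square root.\<close>

lemma exists_functions:
  fixes W :: "'a::field_char_0 weierstrass"
  assumes "disc W \<noteq> 0"
  shows "\<exists>U V. weierstrass_functions W U V"
proof -
  define t :: "'a fls" where "t = fls_X"
  define s :: "'a fls" where "s = fls_X_inv"
  have st: "s * t = 1" by (simp add: s_def t_def fls_X_inv_times_conv_shift fls_X_conv_shift_1)
  define H where "H = 1 + fps_const (b2 W / 4) * fps_X ^ 2 + fps_const (b4 W / 2) * fps_X ^ 4 + fps_const (b6 W / 4) * fps_X ^ 6"
  \<comment> \<open>The constant function supplies 1 as the square root of the constant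
    coefficient.\<close>
  define r where "r = fps_radical (\<lambda>_ _. 1) 2 H"
  have H0: "H $ 0 = 1" by (simp add: H_def)
  have r2: "r ^ 2 = H"
    using power_radical[of H "\<lambda>_ _. 1" 1] H0 unfolding r_def by (simp add: numeral_2_eq_2)
  define h where "h = fps_to_fls r"
  have h2: "h ^ 2 = 1 + fls_const (b2 W / 4) * t ^ 2 + fls_const (b4 W / 2) * t ^ 4 + fls_const (b6 W / 4) * t ^ 6"
    unfolding h_def t_def fps_to_fls_power[symmetric] r2 H_def
    by (simp add: fls_plus_const fps_to_fls_plus fps_to_fls_power fls_times_fps_to_fls)
  have r0: "r $ 0 \<noteq> 0" using H0 r2 by (metis fps_nth_power_0 power_zero_numeral zero_neq_one)
  have hd: "fls_subdegree h = 0" "h \<noteq> 0"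
    using r0 by (auto simp: h_def fls_subdegree_fls_to_fps)
  define U where "U = s ^ 2"
  define e where "e = 2 * s ^ 3 * h"
  have e2: "e ^ 2 = 4 * U ^ 3 + fls_const (b2 W) * U ^ 2 + 2 * fls_const (b4 W) * U + fls_const (b6 W)"
  proof -
    have "fls_const (b2 W) = 4 * fls_const (b2 W / 4)" "fls_const (b4 W) = 2 * fls_const (b4 W / 2)"
      "fls_const (b6 W) = 4 * fls_const (b6 W / 4)"
      by (simp_all flip: fls_const_numeral)
    then show ?thesis using h2 st unfolding e_def U_def by Groebner_Basis.algebra
  qed
  define m where "m = fls_const (a1 W) * U + fls_const (a3 W)"
  define V where "V = (e - m) / 2"
  have V: "2 * V = e - m" by (simp add: V_def)
  have "weierstrass_functions W U V"
  proof
    show "fls_subdegree U = - 2" by (simp add: U_def s_def)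
    have od: "fls_subdegree e = - 3" "e \<noteq> 0" using hd by (auto simp: e_def s_def)
    have "fls_subdegree m \<ge> - 2 \<or> m = 0"
    proof (cases "m = 0")
      case False
      have "fls_nth m k = 0" if "k < - 2" for k
        using that unfolding m_def U_def s_def by (simp add: fls_X_inv_power_nth)
      then show ?thesis using fls_subdegree_geI[OF False] by blast
    qed simp
    then have "fls_subdegree (e - m) = - 3"
      using od fls_subdegree_diff_eq1[of e m] by (cases "m = 0") auto
    then have "fls_subdegree (2 * V) = - 3" unfolding V .
    moreover from this have "V \<noteq> 0" by auto
    ultimately show "fls_subdegree V = - 3" using fls_subdegree_mult[of 2 V] by simp
    have b: "fls_const (b2 W) = fls_const (a1 W) ^ 2 + 4 * fls_const (a2 W)"
       "fls_const (b4 W) = 2 * fls_const (a4 W) + fls_const (a1 W) * fls_const (a3 W)"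
       "fls_const (b6 W) = fls_const (a3 W) ^ 2 + 4 * fls_const (a6 W)"
      by (simp_all only: b2_def b4_def b6_def fls_plus_const[symmetric] fls_const_mult_const[symmetric] fls_const_power fls_const_numeral)
    have "4 * (V ^ 2 + fls_const (a1 W) * U * V + fls_const (a3 W) * V) =
      4 * (U ^ 3 + fls_const (a2 W) * U ^ 2 + fls_const (a4 W) * U + fls_const (a6 W))"
      using e2 V unfolding m_def b by Groebner_Basis.algebra
    moreover have "(4 :: 'a fls) \<noteq> 0"
      using fls_const_nonzero[of "4 :: 'a"] by (simp only: fls_const_numeral zero_neq_numeral[symmetric] simp_thms)
    ultimately show "V ^ 2 + fls_const (a1 W) * U * V + fls_const (a3 W) * V =
      U ^ 3 + fls_const (a2 W) * U ^ 2 + fls_const (a4 W) * U + fls_const (a6 W)"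
      by (simp only: mult_cancel_left simp_thms)
  qed (fact assms)
  then show ?thesis by blast
qed

section \<open>The group of points\<close>

lemma point_add_on_curve:
  fixes W :: "'a::field weierstrass"
  assumes "on_curve W P" "on_curve W Q"
  shows "on_curve W (point_add W P Q)"
proof (cases "P = Infinity \<or> Q = Infinity")
  case True
  then show ?thesis using assms by (cases P) auto
next
  case False
  then obtain x1 y1 x2 y2 where P: "P = Affine x1 y1" and Q: "Q = Affine x2 y2"
    by (metis point.exhaust)
  note c = assms[unfolded P Q on_curve.simps]
  show ?thesis
  proof (cases "x1 = x2 \<and> y1 + y2 + a1 W * x2 + a3 W = 0")
    case True
    then show ?thesis by (simp add: P Q)
  next
    case False
    define l where "l = (if x1 = x2
                    then (3 * x1 ^ 2 + 2 * a2 W * x1 + a4 W - a1 W * y1) / (2 * y1 + a1 W * x1 + a3 W)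
                    else (y2 - y1) / (x2 - x1))"
    define v where "v = y1 - l * x1"
    define x3 where "x3 = l ^ 2 + a1 W * l - a2 W - x1 - x2"
    have r: "point_add W P Q = Affine x3 (- (l + a1 W) * x3 - v - a3 W)"
      using False by (simp add: P Q l_def v_def x3_def Let_def)
    have y1: "y1 = l * x1 + v" by (simp add: v_def)
    show ?thesis
    proof (cases "x1 = x2")
      case True
      have "(y1 - y2) * (y1 + y2 + a1 W * x2 + a3 W) = 0"
        using c True by Groebner_Basis.algebra
      then have eq: "y1 = y2" using True False by simp
      then have "2 * y1 + a1 W * x1 + a3 W \<noteq> 0" using False True by auto
      then have "l * (2 * y1 + a1 W * x1 + a3 W) = 3 * x1 ^ 2 + 2 * a2 W * x1 + a4 W - a1 W * y1"
        using True by (simp add: l_def)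
      then show ?thesis unfolding r on_curve.simps using c(1) y1 True unfolding x3_def
        by Groebner_Basis.algebra
    next
      case False
      have l: "l * (x2 - x1) = y2 - y1" using False by (simp add: l_def)
      then have y2: "y2 = l * x2 + v" by (simp add: v_def algebra_simps)
      \<comment> \<open>The equation at the third point; the equations at the two given points imply
        it after multiplication by \<open>x1 - x2\<close>.\<close>
      define N where "N = (- (l + a1 W) * x3 - v - a3 W) ^ 2 + a1 W * x3 * (- (l + a1 W) * x3 - v - a3 W) +
         a3 W * (- (l + a1 W) * x3 - v - a3 W) - (x3 ^ 3 + a2 W * x3 ^ 2 + a4 W * x3 + a6 W)"
      have "(x1 - x2) * N = 0"
        using c unfolding N_def x3_def y1 y2 by Groebner_Basis.algebra
      then show ?thesis unfolding r on_curve.simps using False by (simp add: N_def)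
    qed
  qed
qed

lemma point_add_assoc:
  fixes W :: "'a::field_char_0 weierstrass"
  assumes "disc W \<noteq> 0" "on_curve W P" "on_curve W Q" "on_curve W S"
  shows "point_add W (point_add W P Q) S = point_add W P (point_add W Q S)"
proof -
  obtain U V where "weierstrass_functions W U V" using exists_functions[OF assms(1)] by blast
  then interpret weierstrass_functions W U V .
  note c = point_add_on_curve[OF assms(2,3)] point_add_on_curve[OF assms(3,4)]
  have "eqv (gens (point_add W (point_add W P Q) S)) ((gens P * gens Q) * gens S)"
    by (rule eqv_sym[OF eqv_trans[OF eqv_mult[OF gens_add[OF assms(2,3)]] gens_add[OF c(1) assms(4)]]])
  moreover have "eqv ((gens P * gens Q) * gens S) (gens (point_add W P (point_add W Q S)))"
    unfolding mult.assoc
    by (rule eqv_trans[OF eqv_mult2[OF eqv_refl gens_add[OF assms(3,4)]] gens_add[OF assms(2) c(2)]])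
  ultimately show ?thesis
    using eqv_inj eqv_trans point_add_on_curve assms by meson
qed

lemma point_add_commute:
  fixes W :: "'a::field weierstrass"
  assumes "on_curve W P" "on_curve W Q"
  shows "point_add W P Q = point_add W Q P"
proof (cases "P = Infinity \<or> Q = Infinity")
  case True
  then show ?thesis by (cases P; cases Q) auto
next
  case False
  then obtain x1 y1 x2 y2 where P: "P = Affine x1 y1" and Q: "Q = Affine x2 y2"
    by (metis point.exhaust)
  note c = assms[unfolded P Q on_curve.simps]
  show ?thesis
  proof (cases "x1 = x2")
    case True
    have "(y1 - y2) * (y1 + y2 + a1 W * x2 + a3 W) = 0"
      using c True by Groebner_Basis.algebra
    then consider "y1 = y2" | "y1 + y2 + a1 W * x2 + a3 W = 0" by auto
    then show ?thesis
    proof cases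
      case 2
      then have "y2 + y1 + a1 W * x1 + a3 W = 0" using True by (simp only: add.commute[of y2])
      then show ?thesis using 2 True by (simp add: P Q)
    qed (simp add: P Q True)
  next
    case False
    define l where "l = (y2 - y1) / (x2 - x1)"
    have l': "(y1 - y2) / (x1 - x2) = l" unfolding l_def by (metis minus_diff_eq minus_divide_divide)
    have "l * (x2 - x1) = y2 - y1" using False by (simp add: l_def)
    then have v: "y2 - l * x2 = y1 - l * x1" by (simp add: algebra_simps)
    define z where "z = l ^ 2 + a1 W * l - a2 W - x1 - x2"
    have "point_add W P Q = Affine z (- (l + a1 W) * z - (y1 - l * x1) - a3 W)"
      using False by (simp add: P Q l_def[symmetric] Let_def z_def)
    moreover have "point_add W Q P = Affine z (- (l + a1 W) * z - (y2 - l * x2) - a3 W)"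
      using False by (simp add: P Q l' Let_def z_def diff_diff_eq add.commute[of x1])
    ultimately show ?thesis using v by simp
  qed
qed

fun point_neg :: "'a::comm_ring_1 weierstrass \<Rightarrow> 'a point \<Rightarrow> 'a point" where
  "point_neg W Infinity = Infinity"
| "point_neg W (Affine x y) = Affine x (- y - a1 W * x - a3 W)"

lemma point_neg_on_curve: "on_curve W P \<Longrightarrow> on_curve W (point_neg W P)"
  by (cases P) (auto simp: power2_eq_square algebra_simps)

lemma point_add_neg: "point_add W (point_neg W P) P = Infinity"
  by (cases P) auto

definition point_group :: "'a::field weierstrass \<Rightarrow> 'a point monoid" where
  "point_group W = \<lparr>carrier = {P. on_curve W P}, monoid.mult = point_add W, one = Infinity\<rparr>"

lemma point_group_simps [simp]:
  "carrier (point_group W) = {P. on_curve W P}" "\<one>\<^bsub>point_group W\<^esub> = Infinity"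
  "P \<otimes>\<^bsub>point_group W\<^esub> Q = point_add W P Q"
  by (simp_all add: point_group_def)

lemma comm_group_point_group:
  fixes W :: "'a::field_char_0 weierstrass"
  assumes "disc W \<noteq> 0"
  shows "comm_group (point_group W)"
proof (rule comm_groupI; unfold point_group_simps mem_Collect_eq)
  fix P assume P: "on_curve W P"
  show "\<exists>Q\<in>{P. on_curve W P}. point_add W Q P = Infinity"
    using point_neg_on_curve[OF P] point_add_neg by blast
next
  fix P Q assume "on_curve W P" "on_curve W Q"
  then show "point_add W P Q = point_add W Q P" by (rule point_add_commute)
qed (auto simp: point_add_on_curve point_add_assoc[OF assms])

text \<open>Turns iterated addition into powers in a group, so that the theory of orders of elements
  applies.\<close>

lemma point_mult_eq_pow:
  fixes W :: "'a::field_char_0 weierstrass"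
  assumes d: "disc W \<noteq> 0" and P: "on_curve W P"
  shows "point_mult W n P = P [^]\<^bsub>point_group W\<^esub> n"
proof -
  interpret comm_group "point_group W" by (rule comm_group_point_group[OF d])
  show ?thesis
  proof (induction n)
    case (Suc n)
    then show ?case using nat_pow_closed[of P n] P
      by (simp add: point_mult_def point_add_commute)
  qed (simp add: point_mult_def)
qed

lemma point_inv_eq_neg:
  fixes W :: "'a::field_char_0 weierstrass"
  assumes d: "disc W \<noteq> 0" and P: "on_curve W P"
  shows "inv\<^bsub>point_group W\<^esub> P = point_neg W P"
proof -
  interpret comm_group "point_group W" by (rule comm_group_point_group[OF d])
  show ?thesis using P point_neg_on_curve[OF P] point_add_neg[of W P]
    by (intro inv_equality) auto
qed

subsection \<open>Addition formulas for abscissas\<close>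

text \<open>
  \<open>psi2_sq\<close> is the square of the second division polynomial, and \<open>phi2 / psi2_sq\<close> is the duplication
  map on abscissas.
\<close>

definition eta :: "'a::comm_ring_1 weierstrass \<Rightarrow> 'a \<Rightarrow> 'a \<Rightarrow> 'a" where
  "eta W x y = 2 * y + a1 W * x + a3 W"

definition psi2_sq :: "'a::comm_ring_1 weierstrass \<Rightarrow> 'a \<Rightarrow> 'a" where
  "psi2_sq W x = 4 * x ^ 3 + b2 W * x ^ 2 + 2 * b4 W * x + b6 W"

definition phi2 :: "'a::comm_ring_1 weierstrass \<Rightarrow> 'a \<Rightarrow> 'a" where
  "phi2 W x = x ^ 4 - b4 W * x ^ 2 - 2 * b6 W * x - b8 W"

lemma eta_sq:
  fixes W :: "'a::field weierstrass"
  assumes "on_curve W (Affine x y)"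
  shows "eta W x y ^ 2 = psi2_sq W x"
  using assms unfolding eta_def psi2_sq_def b2_def b4_def b6_def on_curve.simps by Groebner_Basis.algebra

lemma b8_eq: "4 * b8 W = b2 W * b6 W - b4 W ^ 2" for W :: "'a::idom weierstrass"
  unfolding b8_def b6_def b4_def b2_def by Groebner_Basis.algebra

text \<open>The square on the left is that of half the derivative of \<open>psi2_sq\<close>, which
  on the curve equals \<open>(2 \<lambda> + a1) (2 y + a1 x + a3)\<close> for the tangent slope
  \<open>\<lambda>\<close>. The identity thus links the slope with duplication, and without
  denominators it also holds over the integers.\<close>

lemma psi2_phi2:
  fixes W :: "'a::idom weierstrass"
  shows "(6 * x ^ 2 + b2 W * x + b4 W) ^ 2 = psi2_sq W x * (b2 W + 8 * x) + 4 * phi2 W x"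
  using b8_eq[of W] unfolding psi2_sq_def phi2_def by Groebner_Basis.algebra

lemma point_add_distinct:
  fixes W :: "'a::field weierstrass"
  assumes "x1 \<noteq> x2"
  obtains x3 y3 where "point_add W (Affine x1 y1) (Affine x2 y2) = Affine x3 y3"
    "4 * x3 * (x1 - x2) ^ 2 = (eta W x1 y1 - eta W x2 y2) ^ 2 - (b2 W + 4 * x1 + 4 * x2) * (x1 - x2) ^ 2"
proof -
  define l where "l = (y2 - y1) / (x2 - x1)"
  define x3 where "x3 = l ^ 2 + a1 W * l - a2 W - x1 - x2"
  have "point_add W (Affine x1 y1) (Affine x2 y2) = Affine x3 (- (l + a1 W) * x3 - (y1 - l * x1) - a3 W)"
    using assms by (simp only: point_add.simps l_def x3_def Let_def simp_thms if_True if_False)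
  moreover have "l * (x2 - x1) = y2 - y1" using assms by (simp add: l_def)
  then have "4 * x3 * (x1 - x2) ^ 2 = (eta W x1 y1 - eta W x2 y2) ^ 2 - (b2 W + 4 * x1 + 4 * x2) * (x1 - x2) ^ 2"
    unfolding x3_def eta_def b2_def by Groebner_Basis.algebra
  ultimately show ?thesis using that by blast
qed

text \<open>In the coordinates \<open>x\<close> and \<open>eta\<close> the curve is
  \<open>eta^2 = psi2_sq\<close>, and \<open>m = 2 l + a1\<close> is the tangent slope there; the
  equation for \<open>m\<close> comes from differentiating.\<close>

lemma point_double:
  fixes W :: "'a::field weierstrass"
  assumes "eta W x y \<noteq> 0"
  obtains m x3 y3 where "point_add W (Affine x y) (Affine x y) = Affine x3 y3"
    "m * eta W x y = 6 * x ^ 2 + b2 W * x + b4 W" "m ^ 2 = b2 W + 8 * x + 4 * x3"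
proof -
  define l where "l = (3 * x ^ 2 + 2 * a2 W * x + a4 W - a1 W * y) / (2 * y + a1 W * x + a3 W)"
  define x3 where "x3 = l ^ 2 + a1 W * l - a2 W - x - x"
  have nz: "2 * y + a1 W * x + a3 W \<noteq> 0" using assms by (simp add: eta_def)
  then have nz': "y + y + a1 W * x + a3 W \<noteq> 0" by (simp only: mult_2 simp_thms)
  have "point_add W (Affine x y) (Affine x y) = Affine x3 (- (l + a1 W) * x3 - (y - l * x) - a3 W)"
    using nz' by (simp only: point_add.simps l_def x3_def Let_def simp_thms if_True if_False)
  moreover have "l * (2 * y + a1 W * x + a3 W) = 3 * x ^ 2 + 2 * a2 W * x + a4 W - a1 W * y"
    using nz by (simp add: l_def)
  then have "(2 * l + a1 W) * eta W x y = 6 * x ^ 2 + b2 W * x + b4 W"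
    unfolding eta_def b2_def b4_def by Groebner_Basis.algebra
  moreover have "(2 * l + a1 W) ^ 2 = b2 W + 8 * x + 4 * x3"
    unfolding x3_def b2_def by Groebner_Basis.algebra
  ultimately show ?thesis using that by blast
qed

lemma eta_neg: "eta W x (- y - a1 W * x - a3 W) = - eta W x y"
  by (simp add: eta_def algebra_simps)

text \<open>Negating the second point changes the sign of its \<open>eta\<close>. Sum and product of
  the two abscissas are therefore even in each \<open>eta\<close>, and \<open>eta_sq\<close>
  expresses them by \<open>x\<close> and \<open>t\<close> alone.\<close>

lemma sum_prod_abscissas:
  fixes W :: "'a::field_char_0 weierstrass"
  assumes c: "on_curve W (Affine x y)" "on_curve W (Affine t w)" and n: "x \<noteq> t"
  obtains xp yp xm ym where
    "point_add W (Affine x y) (Affine t w) = Affine xp yp"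
    "point_add W (Affine x y) (point_neg W (Affine t w)) = Affine xm ym"
    "(xp + xm) * (x - t) ^ 2 = 2 * x * t * (x + t) + b2 W * x * t + b4 W * (x + t) + b6 W"
    "xp * xm * (x - t) ^ 2 = x ^ 2 * t ^ 2 - b4 W * x * t - b6 W * (x + t) - b8 W"
proof -
  obtain xp yp where p: "point_add W (Affine x y) (Affine t w) = Affine xp yp"
    "4 * xp * (x - t) ^ 2 = (eta W x y - eta W t w) ^ 2 - (b2 W + 4 * x + 4 * t) * (x - t) ^ 2"
    using point_add_distinct[OF n] by metis
  obtain xm ym where m: "point_add W (Affine x y) (point_neg W (Affine t w)) = Affine xm ym"
    "4 * xm * (x - t) ^ 2 = (eta W x y + eta W t w) ^ 2 - (b2 W + 4 * x + 4 * t) * (x - t) ^ 2"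
    unfolding point_neg.simps using point_add_distinct[OF n] eta_neg by (metis diff_minus_eq_add)
  note e = eta_sq[OF c(1)] eta_sq[OF c(2)]
  define a b D where "a = eta W x y" and "b = eta W t w" and "D = (x - t) ^ 2"
  note e = e[folded a_def b_def] and pm = p(2)[folded a_def b_def D_def] m(2)[folded a_def b_def D_def]
  have D: "D \<noteq> 0" using n by (simp add: D_def)
  have "8 * ((xp + xm) * D) = 8 * (2 * x * t * (x + t) + b2 W * x * t + b4 W * (x + t) + b6 W)"
    using pm e unfolding psi2_sq_def D_def by Groebner_Basis.algebra
  then have s: "(xp + xm) * D = 2 * x * t * (x + t) + b2 W * x * t + b4 W * (x + t) + b6 W"
    by (rule mult_left_cancel[THEN iffD1, rotated]) simp
  \<comment> \<open>The part common to both abscissas: \<open>4 D\<close> times them is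
    \<open>S - 2 a b\<close> and \<open>S + 2 a b\<close>.\<close>
  define S where "S = psi2_sq W x + psi2_sq W t - (b2 W + 4 * x + 4 * t) * D"
  have "4 * xp * D = S - 2 * a * b" "4 * xm * D = S + 2 * a * b"
    using pm e unfolding S_def by Groebner_Basis.algebra+
  then have "16 * (xp * xm * D) * D = S ^ 2 - 4 * psi2_sq W x * psi2_sq W t"
    using e by Groebner_Basis.algebra
  also have "\<dots> = (16 * x ^ 2 * t ^ 2 - 16 * b4 W * x * t - 16 * b6 W * (x + t) - 4 * (b2 W * b6 W - b4 W ^ 2)) * D"
    unfolding S_def psi2_sq_def D_def by Groebner_Basis.algebra
  also have "\<dots> = 16 * (x ^ 2 * t ^ 2 - b4 W * x * t - b6 W * (x + t) - b8 W) * D"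
    (is "_ = _ * ?p * _") unfolding b8_eq[symmetric] by (simp add: algebra_simps)
  finally have eq: "(16 * D) * (xp * xm * D) = (16 * D) * ?p" by (simp only: ac_simps)
  have "16 * D \<noteq> 0" using D by simp
  from mult_left_cancel[OF this, THEN iffD1, OF eq] have "xp * xm * D = ?p" .
  then show ?thesis by (rule that[OF p(1) m(1) s[unfolded D_def], folded D_def])
qed

section \<open>Change of Weierstrass equation\<close>

fun transform :: "'a::field \<Rightarrow> 'a \<Rightarrow> 'a \<Rightarrow> 'a \<Rightarrow> 'a point \<Rightarrow> 'a point" where
  "transform u r s t Infinity = Infinity"
| "transform u r s t (Affine x y) = Affine (u ^ 2 * x + r) (u ^ 3 * y + s * u ^ 2 * x + t)"

definition transforms :: "'a::field \<Rightarrow> 'a \<Rightarrow> 'a \<Rightarrow> 'a \<Rightarrow> 'a weierstrass \<Rightarrow> 'a weierstrass \<Rightarrow> bool" where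
  "transforms u r s t W W' \<longleftrightarrow> u \<noteq> 0 \<and>
     u * a1 W' = a1 W + 2 * s \<and>
     u ^ 2 * a2 W' = a2 W - s * a1 W + 3 * r - s ^ 2 \<and>
     u ^ 3 * a3 W' = a3 W + r * a1 W + 2 * t \<and>
     u ^ 4 * a4 W' = a4 W - s * a3 W + 2 * r * a2 W - (t + r * s) * a1 W + 3 * r ^ 2 - 2 * s * t \<and>
     u ^ 6 * a6 W' = a6 W + r * a4 W + r ^ 2 * a2 W + r ^ 3 - t * a3 W - t ^ 2 - r * t * a1 W"

lemma isomorphic_iff: "isomorphic W W' \<longleftrightarrow> (\<exists>u r s t. transforms u r s t W W')"
  by (simp add: isomorphic_def transforms_def)

lemma transforms_coeffs:
  assumes "transforms u r s t W W'"
  shows "u \<noteq> 0" "a1 W = u * a1 W' - 2 * s" "a2 W = u ^ 2 * a2 W' + s * a1 W - 3 * r + s ^ 2"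
    "a3 W = u ^ 3 * a3 W' - r * a1 W - 2 * t"
    "a4 W = u ^ 4 * a4 W' + s * a3 W - 2 * r * a2 W + (t + r * s) * a1 W - 3 * r ^ 2 + 2 * s * t"
    "a6 W = u ^ 6 * a6 W' - r * a4 W - r ^ 2 * a2 W - r ^ 3 + t * a3 W + t ^ 2 + r * t * a1 W"
  using assms unfolding transforms_def by (auto simp: algebra_simps)

lemma disc_transforms:
  assumes "transforms u r s t W W'"
  shows "disc W = u ^ 12 * disc W'"
proof -
  note c = transforms_coeffs[OF assms]
  have e2: "b2 W = u ^ 2 * b2 W' - 12 * r"
    unfolding b2_def c(3) c(2) by Groebner_Basis.algebra
  have e4: "b4 W = u ^ 4 * b4 W' - r * b2 W - 6 * r ^ 2"
    unfolding b4_def b2_def c(5) c(4) c(3) c(2) by Groebner_Basis.algebra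
  have e6: "b6 W = u ^ 6 * b6 W' - 2 * r * b4 W - r ^ 2 * b2 W - 4 * r ^ 3"
    unfolding b6_def b4_def b2_def c(6) c(5) c(4) c(3) c(2) by Groebner_Basis.algebra
  have e8: "b8 W = u ^ 8 * b8 W' - 3 * r * b6 W - 3 * r ^ 2 * b4 W - r ^ 3 * b2 W - 3 * r ^ 4"
    unfolding b8_def b6_def b4_def b2_def c(6) c(5) c(4) c(3) c(2) by Groebner_Basis.algebra
  show ?thesis unfolding disc_eq e8 e6 e4 e2 using b8_eq[of W'] by Groebner_Basis.algebra
qed

lemma on_curve_transform:
  assumes "transforms u r s t W W'"
  shows "on_curve W (transform u r s t P) \<longleftrightarrow> on_curve W' P"
proof (cases P)
  case (Affine x y)
  note c = transforms_coeffs[OF assms]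
  let ?x = "u ^ 2 * x + r" and ?y = "u ^ 3 * y + s * u ^ 2 * x + t"
  have "?y ^ 2 + a1 W * ?x * ?y + a3 W * ?y - (?x ^ 3 + a2 W * ?x ^ 2 + a4 W * ?x + a6 W) =
    u ^ 6 * (y ^ 2 + a1 W' * x * y + a3 W' * y - (x ^ 3 + a2 W' * x ^ 2 + a4 W' * x + a6 W'))"
    unfolding c(6) c(5) c(4) c(3) c(2) by Groebner_Basis.algebra
  then show ?thesis using c(1) unfolding Affine transform.simps on_curve.simps
    by (metis eq_iff_diff_eq_0 mult_eq_0_iff power_not_zero)
qed simp

text \<open>The substitution is affine and maps lines to lines; a line of slope \<open>l\<close>
  becomes one of slope \<open>u l + s\<close>.\<close>

lemma point_add_transform:
  assumes tr: "transforms u r s t W W'" and cP: "on_curve W' P" and cQ: "on_curve W' Q"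
  shows "point_add W (transform u r s t P) (transform u r s t Q) = transform u r s t (point_add W' P Q)"
proof (cases "P = Infinity \<or> Q = Infinity")
  case True
  then show ?thesis by (cases P; cases Q) auto
next
  case False
  then obtain x1 y1 x2 y2 where P: "P = Affine x1 y1" and Q: "Q = Affine x2 y2"
    by (metis point.exhaust)
  note c = transforms_coeffs[OF tr]
  define X1 X2 Y1 Y2 where "X1 = u ^ 2 * x1 + r" and "X2 = u ^ 2 * x2 + r"
    and "Y1 = u ^ 3 * y1 + s * u ^ 2 * x1 + t" and "Y2 = u ^ 3 * y2 + s * u ^ 2 * x2 + t"
  note d = X1_def X2_def Y1_def Y2_def
  have x: "X1 = X2 \<longleftrightarrow> x1 = x2" using c(1) by (simp add: d)
  have y: "Y1 + Y2 + a1 W * X2 + a3 W = u ^ 3 * (y1 + y2 + a1 W' * x2 + a3 W')" if "x1 = x2"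
    unfolding d c(4) c(2) that by Groebner_Basis.algebra
  have cond: "(X1 = X2 \<and> Y1 + Y2 + a1 W * X2 + a3 W = 0) \<longleftrightarrow> (x1 = x2 \<and> y1 + y2 + a1 W' * x2 + a3 W' = 0)"
    using x y c(1) by auto
  define L where "L = (if X1 = X2
                    then (3 * X1 ^ 2 + 2 * a2 W * X1 + a4 W - a1 W * Y1) / (2 * Y1 + a1 W * X1 + a3 W)
                    else (Y2 - Y1) / (X2 - X1))"
  define l where "l = (if x1 = x2
                    then (3 * x1 ^ 2 + 2 * a2 W' * x1 + a4 W' - a1 W' * y1) / (2 * y1 + a1 W' * x1 + a3 W')
                    else (y2 - y1) / (x2 - x1))"
  show ?thesis
  proof (cases "x1 = x2 \<and> y1 + y2 + a1 W' * x2 + a3 W' = 0")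
    case True
    then show ?thesis using cond by (simp add: P Q d)
  next
    case False
    have L: "L = u * l + s"
    proof (cases "x1 = x2")
      case True
      have "(y1 - y2) * (y1 + y2 + a1 W' * x2 + a3 W') = 0"
        using cP cQ True unfolding P Q on_curve.simps by Groebner_Basis.algebra
      then have "2 * y1 + a1 W' * x1 + a3 W' \<noteq> 0" using False True by auto
      moreover have "2 * Y1 + a1 W * X1 + a3 W = u ^ 3 * (2 * y1 + a1 W' * x1 + a3 W')"
        unfolding d c(4) c(2) by Groebner_Basis.algebra
      moreover have "3 * X1 ^ 2 + 2 * a2 W * X1 + a4 W - a1 W * Y1 =
          u * u ^ 3 * (3 * x1 ^ 2 + 2 * a2 W' * x1 + a4 W' - a1 W' * y1) + s * (u ^ 3 * (2 * y1 + a1 W' * x1 + a3 W'))"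
        unfolding d c(5) c(4) c(3) c(2) by Groebner_Basis.algebra
      ultimately show ?thesis using True x c(1) by (simp add: L_def l_def add_divide_distrib)
    next
      case False
      have "X2 - X1 = u ^ 2 * (x2 - x1)" "Y2 - Y1 = u * u ^ 2 * (y2 - y1) + s * (u ^ 2 * (x2 - x1))"
        unfolding d by Groebner_Basis.algebra+
      then show ?thesis using False x c(1) by (simp add: L_def l_def add_divide_distrib)
    qed
    define x3 where "x3 = l ^ 2 + a1 W' * l - a2 W' - x1 - x2"
    define X3 where "X3 = L ^ 2 + a1 W * L - a2 W - X1 - X2"
    have r: "point_add W' P Q = Affine x3 (- (l + a1 W') * x3 - (y1 - l * x1) - a3 W')"
      using False by (simp add: P Q l_def x3_def Let_def)
    have "transform u r s t P = Affine X1 Y1" "transform u r s t Q = Affine X2 Y2"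
      by (simp_all add: P Q d)
    then have R: "point_add W (transform u r s t P) (transform u r s t Q) =
        Affine X3 (- (L + a1 W) * X3 - (Y1 - L * X1) - a3 W)"
      using False cond by (simp add: L_def X3_def Let_def)
    have X3: "X3 = u ^ 2 * x3 + r"
      unfolding X3_def x3_def L d c(3) c(2) by Groebner_Basis.algebra
    have "- (L + a1 W) * X3 - (Y1 - L * X1) - a3 W =
        u ^ 3 * (- (l + a1 W') * x3 - (y1 - l * x1) - a3 W') + s * u ^ 2 * x3 + t"
      unfolding X3 L d c(4) c(2) by Groebner_Basis.algebra
    then show ?thesis by (simp add: r R X3)
  qed
qed

lemma point_mult_on_curve:
  fixes W :: "'a::field weierstrass"
  shows "on_curve W P \<Longrightarrow> on_curve W (point_mult W n P)"
  by (induction n) (auto simp: point_mult_def intro: point_add_on_curve)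

lemma point_mult_transform:
  assumes "transforms u r s t W W'" "on_curve W' P"
  shows "point_mult W n (transform u r s t P) = transform u r s t (point_mult W' n P)"
proof (induction n)
  case (Suc n)
  have "point_mult W (Suc n) (transform u r s t P) =
    point_add W (transform u r s t P) (point_mult W n (transform u r s t P))"
    by (simp add: point_mult_def)
  also have "\<dots> = transform u r s t (point_add W' P (point_mult W' n P))"
    unfolding Suc by (rule point_add_transform[OF assms(1,2) point_mult_on_curve[OF assms(2)]])
  finally show ?case by (simp add: point_mult_def)
qed (simp add: point_mult_def)

section \<open>Rational numbers integral at a prime\<close>

locale padic =
  fixes p :: nat
  assumes prime_p: "prime p"
begin

definition pint :: "rat \<Rightarrow> bool" where
  "pint x \<longleftrightarrow> (\<exists>a b. \<not> int p dvd b \<and> x = of_int a / of_int b)"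

text \<open>Membership in the ideal generated by \<open>p^k\<close> in the localization of the
  integers at \<open>p\<close>. Integrality is included, and 0 needs no special convention as it
  would with valuations.\<close>

definition pdvd :: "nat \<Rightarrow> rat \<Rightarrow> bool" where
  "pdvd k x \<longleftrightarrow> (\<exists>y. pint y \<and> x = of_nat p ^ k * y)"

lemma prime_int_p: "prime (int p)" using prime_p by simp

lemma pint_of_int [simp]: "pint (of_int a)"
  unfolding pint_def using prime_int_p by (intro exI[of _ a] exI[of _ 1]) (auto dest: not_prime_unit)

lemma pint_0 [simp]: "pint 0" and pint_1 [simp]: "pint 1" and pint_numeral [simp]: "pint (numeral n)"
  and pint_of_nat [simp]: "pint (of_nat m)"
  using pint_of_int[of 0] pint_of_int[of 1] pint_of_int[of "numeral n"] pint_of_int[of "int m"] by simp_all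

lemma pint_mult [simp]: "pint x \<Longrightarrow> pint y \<Longrightarrow> pint (x * y)"
proof -
  assume "pint x" "pint y"
  then obtain a b c d where "\<not> int p dvd b" "x = of_int a / of_int b" "\<not> int p dvd d" "y = of_int c / of_int d"
    unfolding pint_def by blast
  then show ?thesis unfolding pint_def using prime_int_p
    by (intro exI[of _ "a * c"] exI[of _ "b * d"]) (auto simp: prime_dvd_mult_iff)
qed

lemma pint_add [simp]: "pint x \<Longrightarrow> pint y \<Longrightarrow> pint (x + y)"
proof -
  assume "pint x" "pint y"
  then obtain a b c d where *: "\<not> int p dvd b" "x = of_int a / of_int b" "\<not> int p dvd d" "y = of_int c / of_int d"
    unfolding pint_def by blast
  then have "b \<noteq> 0" "d \<noteq> 0" by auto
  with * show ?thesis unfolding pint_def using prime_int_p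
    by (intro exI[of _ "a * d + c * b"] exI[of _ "b * d"]) (auto simp: prime_dvd_mult_iff field_simps)
qed

lemma pint_minus [simp]: "pint x \<Longrightarrow> pint (- x)"
  using pint_mult[OF pint_of_int[of "- 1"], of x] by simp

lemma pint_diff [simp]: "pint x \<Longrightarrow> pint y \<Longrightarrow> pint (x - y)"
  using pint_add[of x "- y"] by simp

lemma pint_power [simp]: "pint x \<Longrightarrow> pint (x ^ n)"
  by (induction n) auto

lemma pdvd_0: "pdvd 0 x \<longleftrightarrow> pint x" by (simp add: pdvd_def)

lemma pdvd_imp_pint: "pdvd k x \<Longrightarrow> pint x"
  unfolding pdvd_def by auto

lemma pdvd_zero [simp]: "pdvd k 0" unfolding pdvd_def by (intro exI[of _ 0]) simp

lemma pdvd_add: "pdvd k x \<Longrightarrow> pdvd k y \<Longrightarrow> pdvd k (x + y)"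
  unfolding pdvd_def by (metis distrib_left pint_add)

lemma pdvd_minus: "pdvd k x \<Longrightarrow> pdvd k (- x)"
  unfolding pdvd_def by (metis mult_minus_right pint_minus)

lemma pdvd_diff: "pdvd k x \<Longrightarrow> pdvd k y \<Longrightarrow> pdvd k (x - y)"
  using pdvd_add[of k x "- y"] pdvd_minus by simp

lemma pdvd_mult: "pdvd k x \<Longrightarrow> pdvd m y \<Longrightarrow> pdvd (k + m) (x * y)"
proof -
  assume "pdvd k x" "pdvd m y"
  then obtain a b where "pint a" "x = of_nat p ^ k * a" "pint b" "y = of_nat p ^ m * b"
    unfolding pdvd_def by blast
  then show ?thesis unfolding pdvd_def
    by (intro exI[of _ "a * b"]) (simp add: power_add)
qed

lemma pdvd_mult_left: "pdvd k x \<Longrightarrow> pint y \<Longrightarrow> pdvd k (x * y)"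
  using pdvd_mult[of k x 0 y] by (simp add: pdvd_0)

lemma pdvd_mult_right: "pint x \<Longrightarrow> pdvd k y \<Longrightarrow> pdvd k (x * y)"
  using pdvd_mult_left[of k y x] by (simp add: mult.commute)

lemma pdvd_mono: "pdvd k x \<Longrightarrow> m \<le> k \<Longrightarrow> pdvd m x"
proof -
  assume "pdvd k x" "m \<le> k"
  then obtain y where "pint y" "x = of_nat p ^ k * y" unfolding pdvd_def by blast
  moreover have "(of_nat p :: rat) ^ k = of_nat p ^ m * of_nat p ^ (k - m)"
    using \<open>m \<le> k\<close> by (simp flip: power_add)
  ultimately show ?thesis unfolding pdvd_def
    by (intro exI[of _ "of_nat p ^ (k - m) * y"]) simp
qed

lemma pdvd_of_int: "pdvd k (of_int a) \<longleftrightarrow> int p ^ k dvd a"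
proof
  assume "int p ^ k dvd a"
  then obtain c where "a = int p ^ k * c" by blast
  then show "pdvd k (of_int a)" unfolding pdvd_def by (intro exI[of _ "of_int c"]) simp
next
  assume "pdvd k (of_int a)"
  then obtain c b where b: "\<not> int p dvd b" and e: "(of_int a :: rat) = of_nat p ^ k * (of_int c / of_int b)"
    unfolding pdvd_def pint_def by blast
  have "b \<noteq> 0" using b by auto
  then have "(of_int (a * b) :: rat) = of_int (int p ^ k * c)" using e by (simp add: field_simps)
  then have "a * b = int p ^ k * c" by (simp only: of_int_eq_iff)
  moreover have "coprime (int p ^ k) b" using b prime_int_p by (simp add: prime_imp_coprime)
  ultimately show "int p ^ k dvd a" by (metis coprime_dvd_mult_left_iff dvd_triv_left)
qed

lemma not_pint_inverse:
  assumes "\<not> pint x"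
  shows "x \<noteq> 0" "pdvd 1 (1 / x)"
proof -
  show nz: "x \<noteq> 0" using assms by auto
  obtain a b where q: "quotient_of x = (a, b)" by fastforce
  then have x: "x = of_int a / of_int b" and co: "coprime a b" by (auto simp: quotient_of_div quotient_of_coprime)
  have "int p dvd b" using assms x unfolding pint_def by blast
  then obtain c where c: "b = int p * c" by blast
  have "\<not> int p dvd a" using co \<open>int p dvd b\<close> prime_int_p
    by (meson coprime_common_divisor not_prime_unit)
  then have "pint (of_int c / of_int a)" unfolding pint_def by blast
  then show "pdvd 1 (1 / x)" unfolding pdvd_def x c by (intro exI[of _ "of_int c / of_int a"]) simp
qed

lemma unit_inverse:
  assumes "pint x" "\<not> pdvd 1 x"
  shows "x \<noteq> 0" "pint (1 / x)"
proof -
  show nz: "x \<noteq> 0" using assms by auto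
  obtain a b where b: "\<not> int p dvd b" and x: "x = of_int a / of_int b" using assms by (auto simp: pint_def)
  have "\<not> int p dvd a"
  proof
    assume "int p dvd a"
    then obtain c where "a = int p * c" by blast
    then have "x = of_nat p ^ 1 * (of_int c / of_int b)" by (simp add: x)
    moreover have "pint (of_int c / of_int b)" using b by (auto simp: pint_def)
    ultimately show False using assms by (auto simp: pdvd_def)
  qed
  then show "pint (1 / x)" unfolding pint_def x by (intro exI[of _ b] exI[of _ a]) simp
qed

lemma pdvd_1_unit: "\<not> pdvd 1 1"
  using pdvd_of_int[of 1 1] prime_int_p by (auto dest: not_prime_unit)

lemma unitI: "pdvd 1 (x - 1) \<Longrightarrow> \<not> pdvd 1 x"
  using pdvd_diff[of 1 x "x - 1"] pdvd_1_unit by auto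

lemma residue:
  assumes "pint x"
  shows "\<exists>a. pdvd 1 (x - of_int a)"
proof -
  obtain a b where b: "\<not> int p dvd b" and x: "x = of_int a / of_int b" using assms by (auto simp: pint_def)
  have "coprime b (int p)" using prime_imp_coprime[OF prime_int_p b] by (simp add: coprime_commute)
  then obtain c where "[b * c = 1] (mod int p)" using cong_solve_coprime_int by blast
  then have "int p dvd a * (1 - b * c)" by (simp add: cong_iff_dvd_diff dvd_diff_commute)
  then have "pdvd 1 (of_int (a * (1 - b * c)))" by (subst pdvd_of_int) simp
  moreover have "pint (1 / of_int b)" using b unfolding pint_def by (intro exI[of _ 1] exI[of _ b]) simp
  ultimately have "pdvd 1 (of_int (a * (1 - b * c)) * (1 / of_int b))" by (rule pdvd_mult_left)
  moreover have "of_int (a * (1 - b * c)) * (1 / of_int b) = x - of_int (a * c)"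
    using b by (cases "b = 0") (auto simp: x field_simps)
  ultimately show ?thesis by (intro exI[of _ "a * c"]) simp
qed

text \<open>
  The only consequence of ramification used at \<open>p\<close>. For odd \<open>p\<close> every \<open>p\<close>-integral number has the form
  \<open>x\<^sup>2 + 4 t\<close>, so it says that \<open>p\<close>-integral values of \<open>d e\<^sup>2\<close> are divisible by \<open>p\<close>; for \<open>p = 2\<close> the
  restriction to squares modulo 4 is what makes it true also when \<open>d\<close> is 3 modulo 4.
\<close>

definition ramified_disc :: "int \<Rightarrow> bool" where
  "ramified_disc d \<longleftrightarrow> (\<forall>e x t. pint x \<longrightarrow> pint t \<longrightarrow> of_int d * e ^ 2 = x ^ 2 + 4 * t \<longrightarrow> pdvd 1 (x ^ 2 + 4 * t))"

text \<open>If \<open>e\<close> had \<open>p\<close> in its denominator, then \<open>d\<close>,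
  being an integral number divided by \<open>e^2\<close>, would be divisible by
  \<open>p^2\<close>.\<close>

lemma ramified_discI1:
  assumes d: "int p dvd d" and d2: "\<not> int p ^ 2 dvd d"
  shows "ramified_disc d"
  unfolding ramified_disc_def
proof (intro allI impI)
  fix e x t assume x: "pint x" "pint t" and eq: "of_int d * e ^ 2 = x ^ 2 + 4 * t"
  have "pint e"
  proof (rule ccontr)
    assume "\<not> pint e"
    from not_pint_inverse[OF this] have e: "e \<noteq> 0" "pdvd 1 (1 / e)" by auto
    from pdvd_mult[OF e(2) e(2)] have "pdvd 2 ((1 / e) * (1 / e))" by (simp add: numeral_2_eq_2)
    then have "pdvd 2 (((1 / e) * (1 / e)) * (x ^ 2 + 4 * t))" by (rule pdvd_mult_left) (use x in simp)
    moreover have "((1 / e) * (1 / e)) * (x ^ 2 + 4 * t) = of_int d"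
      unfolding eq[symmetric] using e by (simp add: power2_eq_square)
    ultimately show False using d2 pdvd_of_int by simp
  qed
  moreover have "pdvd 1 (of_int d)" using d pdvd_of_int[of 1] by simp
  ultimately show "pdvd 1 (x ^ 2 + 4 * t)" unfolding eq[symmetric] by (intro pdvd_mult_left) auto
qed

lemma odd_square:
  assumes "p = 2" "pint x" "\<not> pdvd 1 x"
  shows "pdvd 2 (x ^ 2 - 1)"
proof -
  obtain a where a: "pdvd 1 (x - of_int a)" using residue[OF assms(2)] by blast
  have "odd a"
  proof
    assume "even a"
    then have "pdvd 1 (of_int a)" using pdvd_of_int[of 1 a] assms by simp
    from pdvd_add[OF a this] assms show False by simp
  qed
  then obtain b where b: "a = 2 * b + 1" by (elim oddE)
  obtain y where y: "pint y" "x - of_int a = of_nat p ^ 1 * y" using a unfolding pdvd_def by blast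
  then have x: "x = 2 * (y + of_int b) + 1" using assms(1) by (simp add: b algebra_simps)
  have "x ^ 2 - 1 = of_nat p ^ 2 * ((y + of_int b) ^ 2 + (y + of_int b))"
    unfolding x assms(1) by (simp add: power2_eq_square algebra_simps)
  then show ?thesis using y unfolding pdvd_def by (intro exI[of _ "(y + of_int b) ^ 2 + (y + of_int b)"]) simp
qed

text \<open>If the value were odd, \<open>x\<close> and \<open>e\<close> would both be odd, and
  since odd squares are 1 modulo 4 the equation would give \<open>d = 1\<close> modulo 4.\<close>

lemma ramified_discI2:
  assumes p2: "p = 2" and d: "d mod 4 = 3"
  shows "ramified_disc d"
  unfolding ramified_disc_def
proof (intro allI impI)
  fix e x t assume x: "pint x" "pint t" and eq: "of_int d * e ^ 2 = x ^ 2 + 4 * t"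
  have od: "odd d" using d by presburger
  show "pdvd 1 (x ^ 2 + 4 * t)"
  proof (rule ccontr)
    assume n: "\<not> pdvd 1 (x ^ 2 + 4 * t)"
    have e: "pint e"
    proof (rule ccontr)
      assume "\<not> pint e"
      from not_pint_inverse[OF this] have e: "e \<noteq> 0" "pdvd 1 (1 / e)" by auto
      have "pdvd 1 ((1 / e) * ((1 / e) * (x ^ 2 + 4 * t)))"
        by (rule pdvd_mult_left[OF e(2) pint_mult[OF pdvd_imp_pint[OF e(2)]]]) (use x in simp)
      moreover have "(1 / e) * ((1 / e) * (x ^ 2 + 4 * t)) = of_int d"
        unfolding eq[symmetric] using e by (simp add: power2_eq_square)
      ultimately show False using od p2 pdvd_of_int[of 1 d] by simp
    qed
    have f: "pdvd 2 (4 * t)" unfolding pdvd_def by (intro exI[of _ t]) (use x p2 in simp)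
    have "\<not> pdvd 1 e"
    proof
      assume "pdvd 1 e"
      then have "pdvd 1 (of_int d * (e * e))" using e by (intro pdvd_mult_left pdvd_mult_right) auto
      then show False using n[folded eq] unfolding power2_eq_square by blast
    qed
    from odd_square[OF p2 e this] have e2: "pdvd 2 (e ^ 2 - 1)" .
    have "\<not> pdvd 1 x"
    proof
      assume "pdvd 1 x"
      then have "pdvd 1 (x * x + 4 * t)" using pdvd_mono[OF f, of 1] x
        by (intro pdvd_add[OF pdvd_mult_left]) auto
      then show False using n by (simp add: power2_eq_square)
    qed
    from odd_square[OF p2 x(1) this] have x2: "pdvd 2 (x ^ 2 - 1)" .
    have "pdvd 2 ((x ^ 2 - 1) + 4 * t - of_int d * (e ^ 2 - 1))"
      by (rule pdvd_diff[OF pdvd_add[OF x2 f] pdvd_mult_right[OF pint_of_int e2]])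
    moreover have "(x ^ 2 - 1) + 4 * t - of_int d * (e ^ 2 - 1) = of_int (d - 1)"
      using eq by (simp add: algebra_simps)
    ultimately have "4 dvd d - 1" using pdvd_of_int[of 2 "d - 1"] p2 by simp
    then show False using d by presburger
  qed
qed

section \<open>Multiples of a point in the kernel of reduction\<close>

text \<open>
  \<open>b2 mult_coeff m\<close> is the coefficient of \<open>u\<close> in the expansion of \<open>x(P) / x(m P)\<close> in powers of
  \<open>u = 1 / x(P)\<close>, whose constant term is \<open>m\<^sup>2\<close>.
\<close>

fun mult_coeff :: "nat \<Rightarrow> int" where
  "mult_coeff 0 = 0"
| "mult_coeff (Suc 0) = 0"
| "mult_coeff (Suc (Suc m)) = 2 * mult_coeff (Suc m) - mult_coeff m + int (Suc m) ^ 2"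

lemma mult_coeff: "12 * mult_coeff m = int m ^ 2 * (int m ^ 2 - 1)"
  by (induction m rule: mult_coeff.induct) (simp_all add: algebra_simps power2_eq_square)

lemma pdvd_divide:
  assumes D: "pdvd k (1 - D)" "D \<noteq> 0" "pint (1 / D)" and T: "pint T" "pdvd k (T - A)"
  shows "pdvd k (T * (1 / D) - A)"
proof -
  define i where "i = 1 / D"
  have "i * D = 1" using D by (simp add: i_def)
  then have e: "T * i - A = (T * i) * (1 - D) + (T - A)" by Groebner_Basis.algebra
  have "pdvd k (T * i - A)"
    unfolding e by (rule pdvd_add[OF pdvd_mult_right[OF pint_mult[OF T(1) D(3)[folded i_def]] D(1)] T(2)])
  then show ?thesis by (simp only: i_def)
qed

text \<open>Dividing the formula for the sum by that for the product gives
  \<open>1 / y + 1 / z\<close>, hence \<open>x1 / y + x1 / z = T / D\<close>. Modulo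
  \<open>p^2\<close> the right-hand side is \<open>2 (1 + h) + B2 u h\<close>; its part linear in
  \<open>u\<close> is the recursion defining \<open>mult_coeff\<close>.\<close>

lemma abscissa_step:
  assumes u: "pdvd 1 u" "u \<noteq> 0" and B: "pint B2" "pint B4" "pint B6" "pint B8"
    and x1: "x1 = 1 / u"
    and h: "x \<noteq> 0" "x1 / x = h" "pint h" "pdvd 2 (h - of_int (int m ^ 2) - B2 * u * of_int c)"
    and g: "z \<noteq> 0" "x1 / z = g" "pint g" "pdvd 2 (g - of_int (int k ^ 2) - B2 * u * of_int b)"
    and mk: "m = Suc k"
    and ne: "x1 \<noteq> x"
    and sum: "(y + z) * (x1 - x) ^ 2 = 2 * x1 * x * (x1 + x) + B2 * x1 * x + B4 * (x1 + x) + B6"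
    and prod: "y * z * (x1 - x) ^ 2 = x1 ^ 2 * x ^ 2 - B4 * x1 * x - B6 * (x1 + x) - B8"
  shows "y \<noteq> 0" "pint (x1 / y)"
    "pdvd 2 (x1 / y - of_int (int (Suc m) ^ 2) - B2 * u * of_int (2 * c - b + int m ^ 2))"
proof -
  \<comment> \<open>\<open>D\<close> is the right-hand side of \<open>prod\<close> divided by
    \<open>x1^2 x^2\<close>, and \<open>T\<close> is that of \<open>sum\<close> multiplied by
    \<open>u^3 h^2\<close>, both written in \<open>u\<close> and \<open>h\<close>.\<close>
  define D where "D = 1 - u ^ 2 * (B4 * h + u * (B6 * h * (1 + h)) + u ^ 2 * (B8 * h ^ 2))"
  define T where "T = 2 * (1 + h) + B2 * u * h + u ^ 2 * (B4 * h * (1 + h) + B6 * u * h ^ 2)"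
  have pu: "pint u" using u pdvd_imp_pint by blast
  have u2: "pdvd 2 (u ^ 2)" using pdvd_mult[OF u(1) u(1)] by (simp add: power2_eq_square numeral_2_eq_2)
  have inv: "a \<noteq> 0 \<and> w = 1 / (u * a)" if "w \<noteq> 0" "x1 / w = a" for w a
    unfolding that(2)[symmetric] x1 using that(1) u(2) by simp
  have hx: "h \<noteq> 0" "x = 1 / (u * h)" using inv[OF h(1,2)] by auto
  have gz: "g \<noteq> 0" "z = 1 / (u * g)" using inv[OF g(1,2)] by auto
  have one: "x1 * u = 1" "x * (u * h) = 1" using hx h(1) x1 u(2) by simp_all
  have D1: "pdvd 2 (1 - D)" unfolding D_def using B h(3) pu u2
    by (simp add: pdvd_mult_left)
  then have "pdvd 1 (D - 1)" using pdvd_mono[OF pdvd_minus[OF D1], of 1] by simp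
  then have "\<not> pdvd 1 D" by (rule unitI)
  moreover have "pint D" unfolding D_def using B h pu by simp
  ultimately have D: "D \<noteq> 0" "pint (1 / D)" using unit_inverse by auto
  have P: "x1 ^ 2 * x ^ 2 - B4 * x1 * x - B6 * (x1 + x) - B8 = x1 ^ 2 * x ^ 2 * D"
  proof -
    have "x1 ^ 2 * x ^ 2 * D = x1 ^ 2 * x ^ 2 - B4 * x1 * x * (x1 * u) * (x * (u * h))
        - B6 * (x1 * u) * (x * (u * h)) * (x * (x1 * u) + x1 * (x * (u * h))) - B8 * ((x1 * u) * (x * (u * h))) ^ 2"
      unfolding D_def by Groebner_Basis.algebra
    then show ?thesis unfolding one by (simp add: algebra_simps)
  qed
  show y: "y \<noteq> 0"
  proof
    assume "y = 0"
    then have "x1 ^ 2 * x ^ 2 * D = 0" using prod P by simp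
    then show False using D h(1) x1 u(2) by simp
  qed
  define f where "f = x1 / y"
  have yf: "f \<noteq> 0" "y = 1 / (u * f)" using inv[OF y] by (auto simp: f_def)
  have one': "y * (u * f) = 1" "z * (u * g) = 1" using yf gz y g(1) u(2) by simp_all
  define S where "S = 2 * x1 * x * (x1 + x) + B2 * x1 * x + B4 * (x1 + x) + B6"
  have "(y + z) * (y * z * (x1 - x) ^ 2) = S * (y * z)"
    unfolding S_def sum[symmetric] by (simp only: ac_simps)
  then have S: "(y + z) * (x1 ^ 2 * x ^ 2 * D) = S * (y * z)" unfolding prod P .
  have "S = (S * (y * z)) * (u ^ 2 * f * g)"
  proof -
    have "(S * (y * z)) * (u ^ 2 * f * g) = S * (y * (u * f)) * (z * (u * g))" by Groebner_Basis.algebra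
    then show ?thesis unfolding one' by simp
  qed
  also have "\<dots> = (x1 ^ 2 * x ^ 2 * D) * u * ((y * (u * f)) * g + (z * (u * g)) * f)"
    unfolding S[symmetric] by Groebner_Basis.algebra
  finally have S2: "S = (x1 ^ 2 * x ^ 2 * D) * u * (g + f)" unfolding one' by simp
  have "(f + g) * D = (f + g) * D * (x1 * u) ^ 2 * (x * (u * h)) ^ 2" unfolding one by simp
  also have "\<dots> = S * (u ^ 3 * h ^ 2)" unfolding S2 by Groebner_Basis.algebra
  also have "\<dots> = 2 * (x1 * u) * (x * (u * h)) * ((x1 * u) * h + x * (u * h)) + B2 * (x1 * u) * (x * (u * h)) * u * h
       + B4 * ((x1 * u) * h + x * (u * h)) * u ^ 2 * h + B6 * u ^ 3 * h ^ 2"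
    unfolding S_def by Groebner_Basis.algebra
  also have "\<dots> = T" unfolding one T_def by Groebner_Basis.algebra
  finally have "(f + g) * D = T" .
  then have fg: "f = T * (1 / D) - g" using D by (simp add: field_simps)
  have pT: "pint T" unfolding T_def using B h pu by simp
  show "pint (x1 / y)" unfolding f_def[symmetric] fg by (rule pint_diff[OF pint_mult[OF pT D(2)] g(3)])
  have "pdvd 2 (T - (2 * (1 + h) + B2 * u * h))" unfolding T_def using u2 B h pu
    by (simp add: pdvd_mult_left)
  from pdvd_divide[OF D1 D pT this] have f1: "pdvd 2 (f - (2 * (1 + h) + B2 * u * h - g))"
    unfolding fg by (simp add: algebra_simps)
  \<comment> \<open>The last summand cancels the term quadratic in \<open>u\<close> that arises from
    the product.\<close>
  have "pdvd 2 ((h - of_int (int m ^ 2) - B2 * u * of_int c) * (2 + B2 * u) + u ^ 2 * (B2 ^ 2 * of_int c))"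
    by (rule pdvd_add[OF pdvd_mult_left[OF h(4)] pdvd_mult_left[OF u2]]) (use B pu in auto)
  from pdvd_add[OF f1 pdvd_diff[OF this g(4)]]
  show "pdvd 2 (x1 / y - of_int (int (Suc m) ^ 2) - B2 * u * of_int (2 * c - b + int m ^ 2))"
    unfolding f_def[symmetric] mk by (simp add: algebra_simps power2_eq_square)
qed

text \<open>Let \<open>l = 2 n + 1\<close>. Equality of the abscissas with indices \<open>n\<close>
  and \<open>n + 1\<close> makes \<open>l + B2 u d\<close> divisible by \<open>p^2\<close>, where
  \<open>d = l (l^2 - 1) / 24\<close>. Modulo \<open>p\<close> this gives \<open>p = l\<close>. If
  \<open>p > 3\<close>, then \<open>p\<close> divides both \<open>d\<close> and \<open>u\<close>, so
  \<open>p^2\<close> would divide \<open>l\<close>. For \<open>l = 3\<close> the coefficient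
  \<open>d\<close> is 1 and the contradiction disappears.\<close>

lemma kernel_of_reduction:
  fixes x :: "nat \<Rightarrow> rat" and n :: nat
  assumes B: "pint B2" "pint B4" "pint B6" "pint B8" and n: "n \<ge> 1"
    and x1: "\<not> pint (x 1)"
    and dbl: "x 2 * (4 * x 1 ^ 3 + B2 * x 1 ^ 2 + 2 * B4 * x 1 + B6) = x 1 ^ 4 - B4 * x 1 ^ 2 - 2 * B6 * x 1 - B8"
    and step: "\<And>m. 2 \<le> m \<Longrightarrow> m \<le> n \<Longrightarrow> x 1 \<noteq> x m \<and>
       (x (m + 1) + x (m - 1)) * (x 1 - x m) ^ 2 = 2 * x 1 * x m * (x 1 + x m) + B2 * x 1 * x m + B4 * (x 1 + x m) + B6 \<and>
       x (m + 1) * x (m - 1) * (x 1 - x m) ^ 2 = x 1 ^ 2 * x m ^ 2 - B4 * x 1 * x m - B6 * (x 1 + x m) - B8"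
    and fin: "x (n + 1) = x n" and prime: "prime (2 * n + 1)"
  shows "p = 3 \<and> n = 1"
proof -
  define u where "u = 1 / x 1"
  have u: "pdvd 1 u" "u \<noteq> 0" "x 1 = 1 / u" using not_pint_inverse[OF x1] by (auto simp: u_def)
  have pu: "pint u" using u pdvd_imp_pint by blast
  have u2: "pdvd 2 (u ^ 2)" using pdvd_mult[OF u(1) u(1)] by (simp add: power2_eq_square numeral_2_eq_2)
  define Q where "Q m \<longleftrightarrow> x m \<noteq> 0 \<and> pint (x 1 / x m) \<and>
    pdvd 2 (x 1 / x m - of_int (int m ^ 2) - B2 * u * of_int (mult_coeff m))" for m
  have Q1: "Q 1" using u by (simp add: Q_def)
  \<comment> \<open>The two summands coincide here, so duplication replaces
    \<open>abscissa_step\<close>; \<open>D\<close> and \<open>T\<close> are its numerator and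
    denominator scaled by \<open>u^4\<close> and \<open>u^3\<close>.\<close>
  have Q2: "Q 2"
  proof -
    define D where "D = 1 - u ^ 2 * (B4 + u * (2 * B6) + u ^ 2 * B8)"
    define T where "T = 4 + B2 * u + u ^ 2 * (2 * B4 + u * B6)"
    have D1: "pdvd 2 (1 - D)" unfolding D_def using B pu u2
      by (simp add: pdvd_mult_left)
    then have "pdvd 1 (D - 1)" using pdvd_mono[OF pdvd_minus[OF D1], of 1] by simp
    then have "\<not> pdvd 1 D" by (rule unitI)
    moreover have "pint D" unfolding D_def using B pu by simp
    ultimately have D: "D \<noteq> 0" "pint (1 / D)" using unit_inverse by auto
    have e: "x 2 * T = x 1 * D"
    proof -
      have one: "x 1 * u = 1" using u by simp
      have "x 2 * (4 * (x 1 * u) ^ 3 + B2 * (x 1 * u) ^ 2 * u + 2 * B4 * (x 1 * u) * u ^ 2 + B6 * u ^ 3) =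
          (x 1 ^ 4 - B4 * x 1 ^ 2 - 2 * B6 * x 1 - B8) * u ^ 3"
        unfolding dbl[symmetric] by Groebner_Basis.algebra
      also have "\<dots> = x 1 * ((x 1 * u) ^ 3 - B4 * (x 1 * u) * u ^ 2 - 2 * B6 * u ^ 3) - B8 * u ^ 3"
        by Groebner_Basis.algebra
      also have "B8 * u ^ 3 = x 1 * (u ^ 4 * B8)"
      proof -
        have "x 1 * (u ^ 4 * B8) = (x 1 * u) * (B8 * u ^ 3)" by Groebner_Basis.algebra
        then show ?thesis unfolding one mult_1 by (rule sym)
      qed
      finally show ?thesis unfolding one T_def D_def power_one mult_1_right by Groebner_Basis.algebra
    qed
    have nz: "x 2 \<noteq> 0" using e D u by auto
    have q: "x 1 / x 2 = T * (1 / D)" using e nz D by (simp add: field_simps)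
    have pT: "pint T" unfolding T_def using B pu by simp
    have "pdvd 2 (T - (4 + B2 * u))" unfolding T_def using u2 B pu
      by (simp add: pdvd_mult_left)
    from pdvd_divide[OF D1 D pT this] have "pdvd 2 (x 1 / x 2 - (4 + B2 * u))" unfolding q .
    moreover have "mult_coeff 2 = 1" by (simp add: numeral_2_eq_2)
    moreover have "pint (x 1 / x 2)" unfolding q by (rule pint_mult[OF pT D(2)])
    ultimately show ?thesis unfolding Q_def using nz by (simp add: diff_diff_eq)
  qed
  \<comment> \<open>The shift starts the induction at the multiple 1, since the multiple 0 is the
    point at infinity and has no abscissa.\<close>
  have Q: "m < Suc n \<Longrightarrow> Q (Suc m)" for m
  proof (induction m rule: less_induct)
    case (less m)
    consider "m = 0" | "m = 1" | k where "m = Suc (Suc k)" by (metis One_nat_def not0_implies_Suc)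
    then show ?case
    proof cases
      case 3
      have q: "Q (Suc (Suc k))" "Q (Suc k)" using less 3 by auto
      have s: "2 \<le> Suc (Suc k)" "Suc (Suc k) \<le> n" using less 3 by auto
      note st = step[OF s]
      show ?thesis unfolding 3 Q_def mult_coeff.simps(3)[of "Suc k"]
        using abscissa_step[OF u(1,2) B u(3), of "x (Suc (Suc k))" _ "Suc (Suc k)" "mult_coeff (Suc (Suc k))"
             "x (Suc k)" _ "Suc k" "mult_coeff (Suc k)" "x (Suc (Suc (Suc k)))"] q st
        unfolding Q_def by simp
    qed (use Q1 Q2 in \<open>simp_all add: numeral_2_eq_2\<close>)
  qed
  obtain k where k: "n = Suc k" using n by (cases n) auto
  have q: "Q (n + 1)" "Q n" using Q[of n] Q[of k] k by auto
  define d where "d = mult_coeff (n + 1) - mult_coeff n"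
  have "pdvd 2 ((x 1 / x n - of_int (int n ^ 2) - B2 * u * of_int (mult_coeff n)) -
    (x 1 / x (n + 1) - of_int (int (n + 1) ^ 2) - B2 * u * of_int (mult_coeff (n + 1))))"
    using q unfolding Q_def by (elim conjE) (rule pdvd_diff)
  then have F: "pdvd 2 (of_int (int (2 * n + 1)) + B2 * u * of_int d)"
    unfolding fin d_def by (simp add: algebra_simps power2_eq_square)
  have "pdvd 1 (B2 * u * of_int d)" by (rule pdvd_mult_left[OF pdvd_mult_right[OF B(1) u(1)]]) simp
  from pdvd_diff[OF pdvd_mono[OF F, of 1] this] have "pdvd 1 (of_int (int (2 * n + 1)))" by simp
  then have "int p dvd int (2 * n + 1)" by (subst (asm) pdvd_of_int) simp
  then have "p dvd 2 * n + 1" by (simp only: int_dvd_int_iff)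
  then have pl: "p = 2 * n + 1" using prime_p prime primes_dvd_imp_eq by blast
  have "n = 1"
  proof (rule ccontr)
    assume "n \<noteq> 1"
    then have p5: "p > 3" using pl n by simp
    have "24 * d = int p * (int p ^ 2 - 1)"
      using mult_coeff[of n] mult_coeff[of "n + 1"] unfolding d_def pl
      by (simp add: algebra_simps power2_eq_square power3_eq_cube)
    then have "int p dvd 24 * d" by simp
    moreover have "\<not> int p dvd 24"
    proof
      assume "int p dvd 24"
      then have "p dvd 2 ^ 3 * 3" using int_dvd_int_iff[of p 24] by simp
      then have "p dvd 2 \<or> p dvd 3" using prime_p by (metis prime_dvd_mult_iff prime_dvd_power)
      then show False using p5 by (auto dest: dvd_imp_le)
    qed
    ultimately have "int p dvd d" using prime_int_p by (simp add: prime_dvd_mult_iff)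
    then have "pdvd 1 (of_int d)" by (subst pdvd_of_int) simp
    then have "pdvd (1 + 1) (u * of_int d)" by (rule pdvd_mult[OF u(1)])
    from pdvd_mult_right[OF B(1) this] have "pdvd 2 (B2 * (u * of_int d))" by (simp add: numeral_2_eq_2)
    from pdvd_diff[OF F this] have "pdvd 2 (of_int (int (2 * n + 1)))"
      by (simp only: mult.assoc add_diff_cancel_right')
    then have "pdvd 2 (of_int (int p))" unfolding pl[symmetric] .
    then have "int p ^ 2 dvd int p" by (subst (asm) pdvd_of_int)
    then have "int p * int p dvd int p * 1" by (simp add: power2_eq_square)
    then have "int p dvd 1" using p5 by (subst (asm) dvd_mult_cancel_left) simp
    then show False using prime_int_p not_prime_unit by blast
  qed
  then show ?thesis using pl by simp
qed

end

section \<open>Quadratic fields\<close>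

lemma ring_of_type_algebra_simps [simp]:
  "carrier ring_of_type_algebra = UNIV" "\<zero>\<^bsub>ring_of_type_algebra\<^esub> = 0" "\<one>\<^bsub>ring_of_type_algebra\<^esub> = 1"
  "a \<oplus>\<^bsub>ring_of_type_algebra\<^esub> b = a + b" "a \<otimes>\<^bsub>ring_of_type_algebra\<^esub> b = a * b"
  by (simp_all add: ring_of_type_algebra_def)

lemma subfield_closed:
  fixes K :: "'k::field set"
  assumes "subfield K ring_of_type_algebra"
  shows "0 \<in> K" "1 \<in> K" "a \<in> K \<Longrightarrow> b \<in> K \<Longrightarrow> a + b \<in> K" "a \<in> K \<Longrightarrow> b \<in> K \<Longrightarrow> a * b \<in> K"
    "a \<in> K \<Longrightarrow> - a \<in> K" "a \<in> K \<Longrightarrow> inverse a \<in> K"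
proof -
  interpret cring "ring_of_type_algebra :: 'k ring" by (rule cring_from_type_algebra)
  interpret F: subfield K "ring_of_type_algebra :: 'k ring" by fact
  show "0 \<in> K" using subringE(2)[OF F.subring_axioms] by simp
  show o: "1 \<in> K" using subringE(3)[OF F.subring_axioms] by simp
  show "a \<in> K \<Longrightarrow> b \<in> K \<Longrightarrow> a + b \<in> K" using subringE(7)[OF F.subring_axioms, of a b] by simp
  show m: "a \<in> K \<Longrightarrow> b \<in> K \<Longrightarrow> a * b \<in> K" for a b using subringE(6)[OF F.subring_axioms, of a b] by simp
  have neg: "- a = \<ominus>\<^bsub>ring_of_type_algebra\<^esub> a" for a :: 'k
    using minus_equality[of "- a" a] by simp
  show "a \<in> K \<Longrightarrow> - a \<in> K" unfolding neg using subringE(5)[OF F.subring_axioms] by simp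
  show "inverse a \<in> K" if a: "a \<in> K"
  proof (cases "a = 0")
    case True
    then show ?thesis using a by simp
  next
    case False
    then have "a \<in> K - {\<zero>\<^bsub>ring_of_type_algebra\<^esub>}" using a by simp
    note i = subfield_m_inv[OF assms this]
    have "a * inv\<^bsub>ring_of_type_algebra\<^esub> a = 1" using i(2) by simp
    then have "inverse a = inv\<^bsub>ring_of_type_algebra\<^esub> a" by (rule inverse_unique)
    then show ?thesis using i(1) by simp
  qed
qed

lemma rat_vector_space: "vector_space (\<lambda>(c::rat) (x::'k::field_char_0). of_rat c * x)"
  by unfold_locales (simp_all add: algebra_simps of_rat_add of_rat_mult)

locale quadratic_field =
  fixes K :: "'k::field_char_0 set" and s :: 'k and d :: rat
  assumes s_sq: "s * s = of_rat d" and s_irr: "s \<notin> \<rat>"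
    and K_eq: "K = {of_rat u + of_rat v * s | u v. True}"
begin

lemma K_coords: "z \<in> K \<Longrightarrow> (\<And>u v. z = of_rat u + of_rat v * s \<Longrightarrow> P) \<Longrightarrow> P"
  using K_eq by auto

lemma coordsI [simp]: "of_rat u + of_rat v * s \<in> K" using K_eq by auto

lemma coords_unique:
  assumes "of_rat u + of_rat v * s = of_rat u' + of_rat v' * s"
  shows "u = u'" "v = v'"
proof -
  show v: "v = v'"
  proof (rule ccontr)
    assume n: "v \<noteq> v'"
    have "of_rat (v - v') * s = of_rat (u' - u)" using assms by (simp add: of_rat_diff algebra_simps)
    then have "s = of_rat ((u' - u) / (v - v'))" using n by (simp add: of_rat_divide field_simps)
    then show False using s_irr by simp
  qed
  show "u = u'" using assms v by simp
qed

definition conj :: "'k \<Rightarrow> 'k" where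
  "conj z = (THE w. \<exists>u v. z = of_rat u + of_rat v * s \<and> w = of_rat u - of_rat v * s)"

lemma conj_coords [simp]: "conj (of_rat u + of_rat v * s) = of_rat u - of_rat v * s"
  unfolding conj_def by (rule the_equality) (use coords_unique in blast)+

lemma conj_rat [simp]: "conj (of_rat u) = of_rat u"
  using conj_coords[of u 0] by simp

lemma rat_K [simp]: "of_rat u \<in> K" using coordsI[of u 0] by simp

lemma add_K [simp]: "a \<in> K \<Longrightarrow> b \<in> K \<Longrightarrow> a + b \<in> K"
  and conj_add: "a \<in> K \<Longrightarrow> b \<in> K \<Longrightarrow> conj (a + b) = conj a + conj b"
proof -
  assume "a \<in> K" "b \<in> K"
  then obtain u v u' v' where e: "a = of_rat u + of_rat v * s" "b = of_rat u' + of_rat v' * s"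
    by (metis K_coords)
  have ab: "a + b = of_rat (u + u') + of_rat (v + v') * s" by (simp add: e of_rat_add algebra_simps)
  show "a + b \<in> K" unfolding ab by (rule coordsI)
  show "conj (a + b) = conj a + conj b" unfolding ab conj_coords unfolding e conj_coords of_rat_add by Groebner_Basis.algebra
qed

lemma mult_K [simp]: "a \<in> K \<Longrightarrow> b \<in> K \<Longrightarrow> a * b \<in> K"
  and conj_mult: "a \<in> K \<Longrightarrow> b \<in> K \<Longrightarrow> conj (a * b) = conj a * conj b"
proof -
  assume "a \<in> K" "b \<in> K"
  then obtain u v u' v' where e: "a = of_rat u + of_rat v * s" "b = of_rat u' + of_rat v' * s"
    by (metis K_coords)
  have ab: "a * b = of_rat (u * u' + v * v' * d) + of_rat (u * v' + v * u') * s"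
    unfolding e of_rat_add of_rat_mult s_sq[symmetric] by Groebner_Basis.algebra
  show "a * b \<in> K" unfolding ab by (rule coordsI)
  show "conj (a * b) = conj a * conj b"
    unfolding ab conj_coords unfolding e conj_coords of_rat_add of_rat_mult s_sq[symmetric] by Groebner_Basis.algebra
qed

lemma minus_K [simp]: "a \<in> K \<Longrightarrow> - a \<in> K" and conj_minus: "a \<in> K \<Longrightarrow> conj (- a) = - conj a"
proof -
  assume "a \<in> K"
  then obtain u v where e: "a = of_rat u + of_rat v * s" by (metis K_coords)
  have m: "- a = of_rat (- u) + of_rat (- v) * s" by (simp add: e of_rat_minus)
  show "- a \<in> K" unfolding m by (rule coordsI)
  show "conj (- a) = - conj a" unfolding m conj_coords unfolding e conj_coords by (simp add: of_rat_minus)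
qed

lemma diff_K [simp]: "a \<in> K \<Longrightarrow> b \<in> K \<Longrightarrow> a - b \<in> K"
  and conj_diff: "a \<in> K \<Longrightarrow> b \<in> K \<Longrightarrow> conj (a - b) = conj a - conj b"
  using add_K[of a "- b"] conj_add[of a "- b"] conj_minus[of b] by simp_all

lemma conj_K [simp]: "a \<in> K \<Longrightarrow> conj a \<in> K"
proof -
  assume "a \<in> K"
  then obtain u v where "a = of_rat u + of_rat v * s" by (metis K_coords)
  then show ?thesis using coordsI[of u "- v"] by (simp add: of_rat_minus)
qed

lemma conj_conj [simp]: "a \<in> K \<Longrightarrow> conj (conj a) = a"
proof -
  assume "a \<in> K"
  then obtain u v where "a = of_rat u + of_rat v * s" by (metis K_coords)
  then show ?thesis using conj_coords[of u "- v"] by (simp add: of_rat_minus)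
qed

lemma conj_eq_0 [simp]: "a \<in> K \<Longrightarrow> conj a = 0 \<longleftrightarrow> a = 0"
  using conj_conj[of a] conj_rat[of 0] by (metis of_rat_0)

lemma trace_rat: "a \<in> K \<Longrightarrow> a + conj a \<in> \<rat>" and norm_rat: "a \<in> K \<Longrightarrow> a * conj a \<in> \<rat>"
proof -
  assume "a \<in> K"
  then obtain u v where e: "a = of_rat u + of_rat v * s" by (metis K_coords)
  show "a + conj a \<in> \<rat>" by (simp add: e)
  have "a * conj a = of_rat (u * u - v * v * d)"
    unfolding e conj_coords of_rat_diff of_rat_mult s_sq[symmetric] by Groebner_Basis.algebra
  then show "a * conj a \<in> \<rat>" by simp
qed

lemma conj_fixed: "a \<in> K \<Longrightarrow> conj a = a \<Longrightarrow> a \<in> \<rat>"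
  using trace_rat[of a] by (metis Rats_divide Rats_number_of mult_2 nonzero_mult_div_cancel_left zero_neq_numeral)

lemma conj_anti: "a \<in> K \<Longrightarrow> conj a = - a \<Longrightarrow> \<exists>v. a = of_rat v * s"
proof -
  assume "a \<in> K" "conj a = - a"
  moreover then obtain u v where e: "a = of_rat u + of_rat v * s" by (metis K_coords)
  ultimately have "of_rat u - of_rat v * s = - of_rat u - of_rat v * s" by simp
  then have "u = 0" by simp
  then show ?thesis using e by auto
qed

lemma inverse_K [simp]: "a \<in> K \<Longrightarrow> inverse a \<in> K"
proof (cases "a = 0")
  case False
  assume a: "a \<in> K"
  have "conj a \<noteq> 0" using a False by simp
  then have "inverse a = inverse (a * conj a) * conj a" using False by (simp add: field_simps)
  moreover obtain q where "a * conj a = of_rat q" using norm_rat[OF a] by (auto simp: Rats_def)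
  ultimately have "inverse a = of_rat (inverse q) * conj a" by (simp add: of_rat_inverse)
  then show ?thesis using a by simp
qed simp

lemma divide_K [simp]: "a \<in> K \<Longrightarrow> b \<in> K \<Longrightarrow> a / b \<in> K"
  by (simp add: divide_inverse)

lemma conj_divide: "a \<in> K \<Longrightarrow> b \<in> K \<Longrightarrow> conj (a / b) = conj a / conj b"
proof (cases "b = 0")
  case True
  then show ?thesis using conj_rat[of 0] by simp
next
  case False
  assume ab: "a \<in> K" "b \<in> K"
  have "conj b \<noteq> 0" using ab False by simp
  moreover have "conj (a / b) * conj b = conj a" using ab False by (simp flip: conj_mult)
  ultimately show ?thesis by (simp add: field_simps)
qed

lemma power_K [simp]: "a \<in> K \<Longrightarrow> a ^ n \<in> K"
  by (induction n) (use rat_K[of 1] in auto)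

lemma conj_power: "a \<in> K \<Longrightarrow> conj (a ^ n) = conj a ^ n"
  by (induction n) (use conj_rat[of 1] in \<open>auto simp: conj_mult\<close>)

lemma of_int_K [simp]: "of_int n \<in> K" and conj_of_int [simp]: "conj (of_int n) = of_int n"
  using rat_K[of "of_int n"] conj_rat[of "of_int n"] by simp_all

lemma numeral_K [simp]: "numeral n \<in> K" and conj_numeral [simp]: "conj (numeral n) = numeral n"
  using of_int_K[of "numeral n"] conj_of_int[of "numeral n"] by simp_all

lemma conj_inj: "a \<in> K \<Longrightarrow> b \<in> K \<Longrightarrow> conj a = conj b \<longleftrightarrow> a = b"
  by (metis conj_conj)

lemma conj_poly:
  assumes "\<forall>i. poly.coeff f i \<in> \<int>" "a \<in> K"
  shows "poly f a \<in> K \<and> conj (poly f a) = poly f (conj a)"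
  using assms(1)
proof (induction f)
  case 0
  then show ?case using rat_K[of 0] conj_rat[of 0] by simp
next
  case (pCons c f)
  have "c \<in> \<int>" "\<forall>i. poly.coeff f i \<in> \<int>"
    using pCons.prems by (metis coeff_pCons_0, metis coeff_pCons_Suc)
  moreover then obtain n where "c = of_int n" by (auto elim: Ints_cases)
  ultimately show ?case using pCons.IH assms(2) by (auto simp: conj_add conj_mult)
qed

lemma algebraic_int_conj:
  assumes "a \<in> K" "algebraic_int a"
  shows "algebraic_int (conj a)"
  using assms(2)
proof (cases rule: algebraic_int.cases)
  case (1 f)
  have "poly f (conj a) = conj (poly f a)" using conj_poly[OF 1(2) assms(1)] by simp
  then have "poly f (conj a) = 0" using 1(3) conj_rat[of 0] by simp
  then show ?thesis using 1 by (intro algebraic_int.intros)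
qed

end

text \<open>Any irrational \<open>b\<close> in \<open>K\<close> forms a basis together with 1;
  completing the square in its quadratic equation yields \<open>s\<close>.\<close>

lemma quadratic_number_field_coords:
  fixes K :: "'k::field_char_0 set"
  assumes "quadratic_number_field K"
  shows "\<exists>s d. quadratic_field K s d"
proof -
  interpret rv: vector_space "\<lambda>(c::rat) (x::'k::field_char_0). of_rat c * x" by (rule rat_vector_space)
  have sf: "subfield K ring_of_type_algebra" and dim: "rv.dim K = 2"
    using assms by (auto simp: quadratic_number_field_def)
  note cl = subfield_closed[OF sf]
  obtain B where B: "B \<subseteq> K" "rv.independent B" "K \<subseteq> rv.span B" "card B = 2"
    using rv.basis_exists[of K] dim by metis
  have fB: "finite B" using B(4) by (metis card.infinite zero_neq_numeral)
  have natK: "of_nat n \<in> K" for n by (induction n) (auto intro: cl)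
  have intK: "of_int n \<in> K" for n by (cases n) (auto intro: cl natK simp del: of_nat_Suc)
  have ratK: "of_rat q \<in> K" for q
  proof -
    obtain a b where "q = of_int a / of_int b" by (metis quotient_of_div surj_pair)
    then have "of_rat q = of_int a * inverse (of_int b :: 'k)" by (simp add: of_rat_mult of_rat_inverse divide_inverse)
    then show ?thesis using cl(4)[OF intK[of a] cl(6)[OF intK[of b]]] by simp
  qed
  have span1: "z \<in> rv.span {1} \<longleftrightarrow> z \<in> \<rat>" for z
    by (auto simp: rv.span_breakdown_eq[of z 1 "{}"] Rats_def)
  have "\<exists>b\<in>K. b \<notin> \<rat>"
  proof (rule ccontr)
    assume "\<not> ?thesis"
    then have "B \<subseteq> rv.span {1}" using B(1) span1 by auto
    then have "card B \<le> card {1 :: 'k}" using rv.independent_span_bound[OF _ B(2)] by blast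
    then show False using B(4) by simp
  qed
  then obtain b where b: "b \<in> K" "b \<notin> \<rat>" by blast
  have ind: "rv.independent {b, 1}"
    using b(2) span1 by (intro rv.independent_insertI) (auto simp: rv.independent_empty)
  have b1: "b \<noteq> 1" using b by auto
  have sp: "\<exists>u v. z = of_rat u + of_rat v * b" if z: "z \<in> K" for z
  proof -
    have "z \<in> rv.span {b, 1}"
    proof (rule ccontr)
      assume n: "z \<notin> rv.span {b, 1}"
      then have i: "rv.independent {z, b, 1}" by (rule rv.independent_insertI[OF _ ind])
      have "z \<notin> {b, 1}" using n rv.span_base by blast
      then have "card {z, b, 1} = 3" using b1 by simp
      moreover have "{z, b, 1} \<subseteq> rv.span B" using z b(1) cl(2) B(3) by auto
      from rv.independent_span_bound[OF fB i this] have "card {z, b, 1} \<le> 2" using B(4) by simp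
      ultimately show False by simp
    qed
    then obtain v where "z - of_rat v * b \<in> \<rat>" using rv.span_breakdown_eq[of z b "{1}"] span1 by auto
    then obtain u where "z - of_rat v * b = of_rat u" by (auto simp: Rats_def)
    then show ?thesis by (intro exI[of _ u] exI[of _ v]) (simp add: algebra_simps)
  qed
  obtain m n where bb: "b * b = of_rat m + of_rat n * b" using sp[OF cl(4)[OF b(1) b(1)]] by auto
  define s where "s = 2 * b - of_rat n"
  have "s * s = 4 * (b * b) - 4 * of_rat n * b + of_rat n * of_rat n"
    by (simp add: s_def algebra_simps)
  also have "\<dots> = of_rat (4 * m + n * n)" unfolding bb by (simp add: of_rat_add of_rat_mult algebra_simps)
  finally have s2: "s * s = of_rat (4 * m + n * n)" .
  have bs: "b = of_rat (n / 2) + of_rat (1 / 2) * s" by (simp add: s_def of_rat_divide algebra_simps)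
  have "quadratic_field K s (4 * m + n * n)"
  proof
    show "s * s = of_rat (4 * m + n * n)" by (fact s2)
    show "s \<notin> \<rat>"
    proof
      assume "s \<in> \<rat>"
      then have "b \<in> \<rat>" unfolding bs by simp
      then show False using b by simp
    qed
    have "s = b + (b + - of_rat n)" by (simp add: s_def)
    then have sK: "s \<in> K" using cl(3)[OF b(1) cl(3)[OF b(1) cl(5)[OF ratK[of n]]]] by (simp only:)
    have "of_rat u + of_rat v * s \<in> K" for u v by (rule cl(3)[OF ratK cl(4)[OF ratK sK]])
    moreover have "\<exists>u v. z = of_rat u + of_rat v * s" if z: "z \<in> K" for z
    proof -
      obtain u v where "z = of_rat u + of_rat v * b" using sp[OF z] by blast
      then have "z = of_rat (u + v * (n / 2)) + of_rat (v * (1 / 2)) * s"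
        by (subst (asm) bs) (simp only: of_rat_add of_rat_mult distrib_left add.assoc mult.assoc)
      then show ?thesis by blast
    qed
    ultimately show "K = {of_rat u + of_rat v * s | u v. True}" by blast
  qed
  then show ?thesis by blast
qed

lemma quadratic_field_rescale:
  assumes "quadratic_field K s d" and c: "c \<noteq> 0" and s': "s' = of_rat c * s"
  shows "quadratic_field K s' (c ^ 2 * d)"
proof -
  interpret quadratic_field K s d by fact
  show ?thesis
  proof
    show "s' * s' = of_rat (c ^ 2 * d)"
      unfolding s' of_rat_mult of_rat_power s_sq[symmetric] by (simp add: power2_eq_square)
    have s: "s = of_rat (inverse c) * s'" using c by (simp add: s' of_rat_inverse)
    show "s' \<notin> \<rat>" using s s_irr by (metis Rats_mult Rats_of_rat)
    have "of_rat u + of_rat v * s = of_rat u + of_rat (v * inverse c) * s'" for u v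
      by (simp add: s of_rat_mult)
    moreover have "of_rat u + of_rat v * s' = of_rat u + of_rat (v * c) * s" for u v
      by (simp add: s' of_rat_mult)
    ultimately show "K = {of_rat u + of_rat v * s' | u v. True}" unfolding K_eq by blast
  qed
qed

section \<open>Ramified primes\<close>

lemma ring_on_simps [simp]:
  "carrier (ring_on S) = S" "\<zero>\<^bsub>ring_on S\<^esub> = 0" "\<one>\<^bsub>ring_on S\<^esub> = 1"
  "a \<oplus>\<^bsub>ring_on S\<^esub> b = a + b" "a \<otimes>\<^bsub>ring_on S\<^esub> b = a * b"
  by (simp_all add: ring_of_type_algebra_def)

text \<open>Ramification as a nonzero nilpotent modulo \<open>p\<close>: if
  \<open>(p) = I^2 J\<close>, then elements of \<open>I J\<close> have squares divisible by
  \<open>p\<close>, but not all of them are divisible by \<open>p\<close>. This form can be used in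
  computations in \<open>K\<close> without ideals.\<close>

lemma ramifies_in_element:
  fixes K :: "'k::field_char_0 set"
  assumes ram: "ramifies_in p K" and "p \<noteq> 0" and pK: "of_nat p \<in> K"
  defines "C \<equiv> {x \<in> K. algebraic_int x}"
  shows "\<forall>a\<in>C. \<forall>b\<in>C. a + b \<in> C \<and> a * b \<in> C"
    and "\<exists>a\<in>C. \<exists>b\<in>C. a * a = of_nat p * b \<and> (\<forall>c\<in>C. a \<noteq> of_nat p * c)"
proof -
  define R where "R = ring_on C"
  have R: "ring_of_integers K = R" by (simp add: ring_of_integers_def R_def C_def)
  obtain I where I: "primeideal I R" and div: "(I [^]\<^bsub>ideals_set R\<^esub> (2::nat)) divides\<^bsub>ideals_set R\<^esub> (PIdl\<^bsub>R\<^esub> (of_nat p))"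
    using ram unfolding ramifies_in_def R Let_def by blast
  interpret primeideal I R by (rule I)
  have [simp]: "carrier R = C" "a \<oplus>\<^bsub>R\<^esub> b = a + b" "a \<otimes>\<^bsub>R\<^esub> b = a * b" "\<one>\<^bsub>R\<^esub> = 1" for a b
    by (simp_all only: R_def ring_on_simps)
  \<comment> \<open>A prime ideal presupposes a ring, so closure is contained in the hypothesis of
    ramification.\<close>
  show "\<forall>a\<in>C. \<forall>b\<in>C. a + b \<in> C \<and> a * b \<in> C"
    using add.m_closed m_closed by simp
  have pC: "of_nat p \<in> C" unfolding C_def using pK by simp
  have idI: "ideal I R" by (rule is_ideal)
  interpret ids: comm_monoid "ideals_set R" by (rule ideals_set_is_comm_monoid)
  have ids [simp]: "carrier (ideals_set R) = {I. ideal I R}" "A \<otimes>\<^bsub>ideals_set R\<^esub> B = A \<cdot>\<^bsub>R\<^esub> B" for A B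
    by (simp_all add: ideals_set_def)
  have one: "\<one>\<^bsub>ideals_set R\<^esub> \<cdot>\<^bsub>R\<^esub> I = I" using ids.l_one[of I] idI by simp
  obtain J where J: "ideal J R" and e: "PIdl\<^bsub>R\<^esub> (of_nat p) = (I \<cdot>\<^bsub>R\<^esub> I) \<cdot>\<^bsub>R\<^esub> J"
    using div idI by (auto simp: factor_def numeral_2_eq_2 one)
  \<comment> \<open>If no such element existed, \<open>A = I J\<close> would be contained in \<open>(p) = I A\<close>, so that \<open>(p) = I (p)\<close>.\<close>
  define A where "A = I \<cdot>\<^bsub>R\<^esub> J"
  have A: "ideal A R" unfolding A_def by (rule ideal_prod_is_ideal[OF idI J])
  have PA: "PIdl\<^bsub>R\<^esub> (of_nat p) = I \<cdot>\<^bsub>R\<^esub> A"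
    unfolding e A_def using ideal_prod_assoc[OF idI idI J] .
  have P: "PIdl\<^bsub>R\<^esub> (of_nat p) = {c * of_nat p | c. c \<in> C}" by (simp add: cgenideal_def)
  show "\<exists>a\<in>C. \<exists>b\<in>C. a * a = of_nat p * b \<and> (\<forall>c\<in>C. a \<noteq> of_nat p * c)"
  proof (rule ccontr)
    assume n: "\<not> ?thesis"
    have AI: "A \<subseteq> I" using ideal_prod_inter[OF idI J] by (auto simp: A_def)
    have AC: "A \<subseteq> C" using ideal.Icarr[OF A] by auto
    have AP: "A \<subseteq> {c * of_nat p | c. c \<in> C}"
    proof
      fix a assume a: "a \<in> A"
      have "a \<otimes>\<^bsub>R\<^esub> a \<in> I \<cdot>\<^bsub>R\<^esub> A" using a AI by (intro ideal_prod.prod) auto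
      then obtain b where "b \<in> C" "a * a = of_nat p * b" using PA P by (auto simp: mult.commute)
      then obtain c where "c \<in> C" "a = of_nat p * c" using n a AC by blast
      then show "a \<in> {c * of_nat p | c. c \<in> C}" by (auto simp: mult.commute)
    qed
    have "\<exists>c\<in>I. x = c * of_nat p" if "x \<in> I \<cdot>\<^bsub>R\<^esub> A" for x
      using that
    proof (induction rule: ideal_prod.induct)
      case (prod i j)
      then obtain c where "c \<in> C" "j = c * of_nat p" using AP by auto
      then show ?case using prod I_r_closed[of i c] by (intro bexI[of _ "i * c"]) auto
    next
      case (sum x y)
      then obtain c c' where "c \<in> I" "x = c * of_nat p" "c' \<in> I" "y = c' * of_nat p" by auto
      then show ?case using additive_subgroup.a_closed[OF additive_subgroup_axioms, of c c'] by (intro bexI[of _ "c + c'"]) (auto simp: algebra_simps)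
    qed
    moreover have "of_nat p \<in> I \<cdot>\<^bsub>R\<^esub> A" unfolding PA[symmetric] using cgenideal_self[of "of_nat p"] pC by simp
    ultimately obtain c where "c \<in> I" "of_nat p = c * of_nat p" by blast
    then have "\<one>\<^bsub>R\<^esub> \<in> I" using \<open>p \<noteq> 0\<close> by simp
    then show False using one_imp_carrier I_notcarr by blast
  qed
qed

text \<open>Let \<open>T\<close> and \<open>N\<close> be trace and norm of the nilpotent
  \<open>a\<close>. Since \<open>p\<close> divides \<open>T\<close> and divides \<open>N\<close>
  exactly once, \<open>T^2 - 4 N\<close> is divisible by an odd \<open>p\<close> exactly once. For
  \<open>p = 2\<close> a factor 4 is removed, and \<open>T'^2 - N\<close> is 2 or 3 modulo 4 because
  \<open>N\<close> is 2 modulo 4.\<close>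

lemma ramified_quadratic:
  fixes K :: "'k::field_char_0 set"
  assumes qn: "quadratic_number_field K" and p: "prime p" and ram: "ramifies_in p K"
  shows "\<exists>s d. quadratic_field K s (of_int d) \<and> padic.ramified_disc p d"
proof -
  interpret padic p by standard (fact p)
  obtain s0 d0 where "quadratic_field K s0 d0" using quadratic_number_field_coords[OF qn] by blast
  then interpret quadratic_field K s0 d0 .
  define C where "C = {x \<in> K. algebraic_int x}"
  have p0: "p \<noteq> 0" using p by auto
  have pK: "of_nat p \<in> K" using of_int_K[of "int p"] by simp
  note rie = ramifies_in_element[OF ram p0 pK, folded C_def]
  obtain a b where a: "a \<in> C" and b: "b \<in> C" and ab: "a * a = of_nat p * b"
    and ndiv: "\<forall>c\<in>C. a \<noteq> of_nat p * c"
    using rie(2) by blast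
  have aK: "a \<in> K" and bK: "b \<in> K" using a b by (auto simp: C_def)
  have C_conj: "conj x \<in> C" if "x \<in> C" for x using that algebraic_int_conj by (auto simp: C_def)
  have C_int: "of_int n \<in> C" for n by (simp add: C_def)
  have norm: "\<exists>n. x * conj x = of_int n" if "x \<in> C" for x
  proof -
    have "algebraic_int (x * conj x)" using rie(1) that C_conj[OF that] by (auto simp: C_def)
    then have "x * conj x \<in> \<int>" using norm_rat that by (auto simp: C_def intro: rational_algebraic_int_is_int)
    then show ?thesis by (auto elim: Ints_cases)
  qed
  have "algebraic_int (a + conj a)" using rie(1) a C_conj[OF a] by (auto simp: C_def)
  then have "a + conj a \<in> \<int>" using trace_rat aK by (auto intro: rational_algebraic_int_is_int)
  then obtain T where T: "a + conj a = of_int T" by (auto elim: Ints_cases)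
  obtain N where N: "a * conj a = of_int N" using norm[OF a] by blast
  obtain M where M: "b * conj b = of_int M" using norm[OF b] by blast
  \<comment> \<open>The minimal polynomial of \<open>a\<close> turns out to be Eisenstein at \<open>p\<close>.\<close>
  have root: "a * a = of_int T * a - of_int N" unfolding T[symmetric] N[symmetric] by Groebner_Basis.algebra
  have "of_int (N * N) = (of_int (int p ^ 2 * M) :: 'k)"
  proof -
    have "conj a * conj a = of_nat p * conj b"
      using conj_mult[OF aK aK] conj_mult[OF pK bK] ab conj_of_int[of "int p"] by simp
    then have "(a * conj a) * (a * conj a) = of_nat p ^ 2 * (b * conj b)"
      using ab by Groebner_Basis.algebra
    then show ?thesis by (simp add: N M)
  qed
  then have "N * N = int p ^ 2 * M" by (simp only: of_int_eq_iff)
  then have "int p dvd N * N" by simp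
  then have pN: "int p dvd N" using prime_int_p by (simp add: prime_dvd_mult_iff)
  then obtain N' where N': "N = int p * N'" by blast
  \<comment> \<open>Otherwise \<open>T\<close> is invertible modulo \<open>p\<close>, and
    \<open>T a = p (b + N')\<close> makes \<open>a\<close> itself a multiple of
    \<open>p\<close>.\<close>
  have pT: "int p dvd T"
  proof (rule ccontr)
    assume "\<not> int p dvd T"
    then have "coprime T (int p)" using prime_imp_coprime[OF prime_int_p] by (simp add: coprime_commute)
    then obtain m where "[T * m = 1] (mod int p)" using cong_solve_coprime_int by blast
    then obtain k where k: "T * m - 1 = int p * k" by (auto simp: cong_iff_dvd_diff)
    have "of_int T * a = of_nat p * (b + of_int N')"
      using root ab by (simp add: N' algebra_simps)
    moreover have "a = of_int m * (of_int T * a) - of_int (T * m - 1) * a" by (simp add: algebra_simps)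
    ultimately have "a = of_nat p * (of_int m * (b + of_int N') + of_int (- k) * a)"
      unfolding k by (simp add: algebra_simps)
    moreover have "of_int m * (b + of_int N') + of_int (- k) * a \<in> C"
      using rie(1) a b C_int by blast
    ultimately show False using ndiv by blast
  qed
  then obtain T' where T': "T = int p * T'" by blast
  \<comment> \<open>Otherwise \<open>a / p\<close> satisfies a monic equation over the integers,
    against the choice of \<open>a\<close>.\<close>
  have pN2: "\<not> int p ^ 2 dvd N"
  proof
    assume "int p ^ 2 dvd N"
    then obtain k where k: "N = int p ^ 2 * k" by blast
    define c where "c = a / of_nat p"
    have ac: "a = of_nat p * c" using p0 by (simp add: c_def)
    have "of_nat p ^ 2 * (c * c) = of_nat p ^ 2 * (of_int T' * c - of_int k)"
      using root unfolding ac T' k by (simp add: power2_eq_square algebra_simps)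
    then have "c * c = of_int T' * c - of_int k" using p0 by (simp only: mult_cancel_left) simp
    then have "algebraic_int c"
      by (intro algebraic_int.intros[of "[:of_int k, - of_int T', 1:]"])
         (auto simp: coeff_pCons algebra_simps split: nat.split)
    moreover have "c \<in> K" unfolding c_def using aK pK by simp
    ultimately have "c \<in> C" by (simp add: C_def)
    then show False using ndiv ac by blast
  qed
  obtain u v where uv: "a = of_rat u + of_rat v * s0" using aK by (metis K_coords)
  \<comment> \<open>A rational \<open>a\<close> would be an integer with square \<open>N\<close>, so
    that \<open>p^2\<close> would divide \<open>N\<close>.\<close>
  have v0: "v \<noteq> 0"
  proof
    assume "v = 0"
    then have "conj a = a" using uv by simp
    then have "a + a = of_int T" "a * a = of_int N" using T N by simp_all
    moreover have "4 * (a * a) = (a + a) * (a + a)" by Groebner_Basis.algebra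
    ultimately have "of_int (4 * N) = (of_int (T * T) :: 'k)" by simp
    then have "4 * N = T * T" by (simp only: of_int_eq_iff)
    have "a \<in> \<rat>" using uv \<open>v = 0\<close> by simp
    then have "a \<in> \<int>" using a by (auto simp: C_def intro: rational_algebraic_int_is_int)
    then obtain n where n: "a = of_int n" by (auto elim: Ints_cases)
    then have "of_int (n * n) = (of_int N :: 'k)" using \<open>a * a = of_int N\<close> by simp
    then have "n * n = N" by (simp only: of_int_eq_iff)
    then have "int p dvd n" using pN prime_int_p by (auto simp: prime_dvd_mult_iff)
    then have "int p ^ 2 dvd N" using \<open>n * n = N\<close> by (metis mult_dvd_mono power2_eq_square)
    then show False using pN2 by simp
  qed
  have diff: "a - conj a = of_rat (2 * v) * s0" by (simp add: uv of_rat_mult)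
  have D: "(a - conj a) * (a - conj a) = of_int (T * T - 4 * N)"
    unfolding of_int_diff of_int_mult T[symmetric] of_int_numeral N[symmetric] by Groebner_Basis.algebra
  show ?thesis
  proof (cases "p = 2")
    case False
    have q: "quadratic_field K (a - conj a) ((2 * v) ^ 2 * d0)"
      by (rule quadratic_field_rescale[OF quadratic_field_axioms _ diff]) (use v0 in simp)
    have "of_rat ((2 * v) ^ 2 * d0) = (of_rat (of_int (T * T - 4 * N)) :: 'k)"
      using quadratic_field.s_sq[OF q, unfolded D] by (simp only: of_rat_of_int_eq)
    then have "(2 * v) ^ 2 * d0 = of_int (T * T - 4 * N)" by (simp only: of_rat_eq_iff)
    then have "quadratic_field K (a - conj a) (of_int (T * T - 4 * N))" using q by simp
    moreover have "ramified_disc (T * T - 4 * N)"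
    proof (rule ramified_discI1)
      show "int p dvd T * T - 4 * N" using pT pN by simp
      show "\<not> int p ^ 2 dvd T * T - 4 * N"
      proof
        assume "int p ^ 2 dvd T * T - 4 * N"
        moreover have "int p ^ 2 dvd T * T" using pT by (metis mult_dvd_mono power2_eq_square)
        ultimately have "int p ^ 2 dvd T * T - (T * T - 4 * N)" by (rule dvd_diff[rotated])
        then have "int p ^ 2 dvd 4 * N" by simp
        moreover have "\<not> p dvd 2 ^ 2"
          using False p by (metis prime_dvd_power primes_dvd_imp_eq two_is_prime_nat)
        then have "coprime (p ^ 2) 4" using prime_imp_coprime[OF p] by simp
        then have "coprime (int (p ^ 2)) (int 4)" by (simp only: coprime_int_iff)
        then have "coprime (int p ^ 2) 4" by simp
        ultimately have "int p ^ 2 dvd N" by (simp add: coprime_dvd_mult_right_iff)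
        then show False using pN2 by simp
      qed
    qed
    ultimately show ?thesis by blast
  next
    case True
    define s where "s = of_rat v * s0"
    have q: "quadratic_field K s (v ^ 2 * d0)"
      by (rule quadratic_field_rescale[OF quadratic_field_axioms v0]) (simp add: s_def)
    have TT: "T = 2 * T'" using T' True by simp
    have "4 * (s * s) = 4 * of_int (T' * T' - N)"
    proof -
      have "a - conj a = 2 * s" unfolding diff s_def by (simp add: of_rat_mult)
      then have "4 * (s * s) = (a - conj a) * (a - conj a)" by Groebner_Basis.algebra
      then show ?thesis unfolding D TT by simp
    qed
    from mult_left_cancel[THEN iffD1, OF _ this] have ss: "s * s = of_int (T' * T' - N)" by simp
    have "of_rat (v ^ 2 * d0) = (of_rat (of_int (T' * T' - N)) :: 'k)"
      using quadratic_field.s_sq[OF q, unfolded ss] by (simp only: of_rat_of_int_eq)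
    then have "v ^ 2 * d0 = of_int (T' * T' - N)" by (simp only: of_rat_eq_iff)
    then have "quadratic_field K s (of_int (T' * T' - N))" using q by simp
    moreover have "ramified_disc (T' * T' - N)"
    proof -
      have N2: "N mod 4 = 2" using pN pN2 True by simp presburger
      show ?thesis
      proof (cases "even T'")
        case even: True
        then obtain t where "T' = 2 * t" by blast
        then have m: "(T' * T' - N) mod 4 = 2" using N2 by simp presburger
        have "2 dvd T' * T' - N" "\<not> 4 dvd T' * T' - N" using m by presburger+
        then show ?thesis using True by (intro ramified_discI1) simp_all
      next
        case False
        then obtain t where "T' = 2 * t + 1" by (elim oddE)
        then have "T' * T' = 4 * (t * t + t) + 1" by (simp add: algebra_simps)
        then have "(T' * T' - N) mod 4 = 3" using N2 by presburger
        then show ?thesis by (rule ramified_discI2[OF True])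
      qed
    qed
    ultimately show ?thesis by blast
  qed
qed

section \<open>The torsion points on which conjugation acts as negation\<close>

lemma map_weierstrass_sel [simp]:
  "a1 (map_weierstrass f W) = f (a1 W)" "a2 (map_weierstrass f W) = f (a2 W)" "a3 (map_weierstrass f W) = f (a3 W)"
  "a4 (map_weierstrass f W) = f (a4 W)" "a6 (map_weierstrass f W) = f (a6 W)"
  by (cases W; simp)+

abbreviation over_field :: "int weierstrass \<Rightarrow> 'a::ring_1 weierstrass" where
  "over_field W \<equiv> map_weierstrass of_int W"

lemma over_invariants:
  "b2 (over_field W) = of_int (b2 W)" "b4 (over_field W) = of_int (b4 W)" "b6 (over_field W) = of_int (b6 W)"
  "b8 (over_field W) = of_int (b8 W)" "disc (over_field W) = of_int (disc W)"
  by (simp_all add: b2_def b4_def b6_def b8_def disc_def Let_def)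

lemma same_abscissa:
  fixes W :: "'a::field weierstrass"
  assumes "on_curve W (Affine x y1)" "on_curve W (Affine x y2)"
  shows "y1 = y2 \<or> y2 = - y1 - a1 W * x - a3 W"
proof -
  have "(y1 - y2) * (y2 - (- y1 - a1 W * x - a3 W)) = 0"
    using assms unfolding on_curve.simps by Groebner_Basis.algebra
  then show ?thesis by auto
qed

locale twisted_torsion = quadratic_field K s d
  for K :: "'k::field_char_0 set" and s :: 'k and d :: rat +
  fixes W :: "int weierstrass" and l n :: nat
  assumes disc_nz: "disc W \<noteq> 0" and prime_l: "prime l" and l_eq: "l = 2 * n + 1"
begin

abbreviation Wk :: "'k weierstrass" where "Wk \<equiv> over_field W"
abbreviation G :: "'k point monoid" where "G \<equiv> point_group Wk"

lemma disc_k: "disc Wk \<noteq> 0" using disc_nz by (simp add: over_invariants)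

sublocale G: comm_group G by (rule comm_group_point_group[OF disc_k])

lemma points_iff: "P \<in> points Wk K \<longleftrightarrow> on_curve Wk P \<and> set_point P \<subseteq> K"
  by (simp add: points_def)

section \<open>Conjugation and the group law\<close>

lemma point_add_cases:
  assumes "set_point P \<subseteq> K" "set_point Q \<subseteq> K"
  shows "set_point (point_add Wk P Q) \<subseteq> K \<and>
    map_point conj (point_add Wk P Q) = point_add Wk (map_point conj P) (map_point conj Q)"
proof (cases "P = Infinity \<or> Q = Infinity")
  case True
  then show ?thesis using assms by (cases P; cases Q) auto
next
  case False
  then obtain x1 y1 x2 y2 where PQ: "P = Affine x1 y1" "Q = Affine x2 y2"
    by (metis point.exhaust)
  then have [simp]: "x1 \<in> K" "y1 \<in> K" "x2 \<in> K" "y2 \<in> K" using assms by auto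
  note cs = conj_add conj_diff conj_mult conj_minus conj_power conj_divide
  have c0: "conj x1 = conj x2 \<and> conj y1 + conj y2 + of_int (a1 W) * conj x2 + of_int (a3 W) = 0 \<longleftrightarrow>
      x1 = x2 \<and> y1 + y2 + of_int (a1 W) * x2 + of_int (a3 W) = 0"
    using conj_inj[of x1 x2] conj_eq_0[of "y1 + y2 + of_int (a1 W) * x2 + of_int (a3 W)"] by (simp add: cs)
  define L where "L = (if x1 = x2
                    then (3 * x1 ^ 2 + 2 * a2 Wk * x1 + a4 Wk - a1 Wk * y1) / (2 * y1 + a1 Wk * x1 + a3 Wk)
                    else (y2 - y1) / (x2 - x1))"
  have L: "L \<in> K" "conj L = (if conj x1 = conj x2
                    then (3 * conj x1 ^ 2 + 2 * a2 Wk * conj x1 + a4 Wk - a1 Wk * conj y1) / (2 * conj y1 + a1 Wk * conj x1 + a3 Wk)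
                    else (conj y2 - conj y1) / (conj x2 - conj x1))"
    by (simp_all add: L_def cs conj_inj)
  show ?thesis
  proof (cases "x1 = x2 \<and> y1 + y2 + of_int (a1 W) * x2 + of_int (a3 W) = 0")
    case True
    then show ?thesis using c0 by (simp add: PQ)
  next
    case F: False
    define x3 where "x3 = L ^ 2 + a1 Wk * L - a2 Wk - x1 - x2"
    define y3 where "y3 = - (L + a1 Wk) * x3 - (y1 - L * x1) - a3 Wk"
    have [simp]: "x3 \<in> K" "y3 \<in> K" using L(1) by (simp_all add: x3_def y3_def)
    have r: "point_add Wk P Q = Affine x3 y3"
      using F by (simp add: PQ L_def x3_def y3_def Let_def)
    have "point_add Wk (map_point conj P) (map_point conj Q) =
       (let v = conj y1 - conj L * conj x1; x = conj L ^ 2 + a1 Wk * conj L - a2 Wk - conj x1 - conj x2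
        in Affine x (- (conj L + a1 Wk) * x - v - a3 Wk))"
      using F c0 unfolding L(2) PQ by (simp add: Let_def)
    also have "\<dots> = Affine (conj x3) (conj y3)"
      using L(1) by (simp add: x3_def y3_def Let_def cs)
    finally show ?thesis by (simp add: r)
  qed
qed

lemma on_curve_conj: "set_point P \<subseteq> K \<Longrightarrow> on_curve Wk P \<Longrightarrow> on_curve Wk (map_point conj P)"
proof (cases P)
  case (Affine x y)
  assume "set_point P \<subseteq> K" "on_curve Wk P"
  then have [simp]: "x \<in> K" "y \<in> K" and
    e: "y ^ 2 + of_int (a1 W) * x * y + of_int (a3 W) * y = x ^ 3 + of_int (a2 W) * x ^ 2 + of_int (a4 W) * x + of_int (a6 W)"
    using Affine by auto
  from arg_cong[OF e, of conj] show ?thesis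
    using Affine by (simp add: conj_add conj_mult conj_power)
qed simp

lemma point_neg_K: "set_point P \<subseteq> K \<Longrightarrow> set_point (point_neg Wk P) \<subseteq> K"
  by (cases P) auto

lemma set_point_conj: "set_point P \<subseteq> K \<Longrightarrow> set_point (map_point conj P) \<subseteq> K"
  by (cases P) auto

lemma conj_point_neg: "set_point P \<subseteq> K \<Longrightarrow> map_point conj (point_neg Wk P) = point_neg Wk (map_point conj P)"
  by (cases P) (auto simp: conj_diff conj_mult conj_minus)

lemma inv_eq: "on_curve Wk P \<Longrightarrow> inv\<^bsub>G\<^esub> P = point_neg Wk P"
  by (rule point_inv_eq_neg[OF disc_k])

lemma pow_K:
  assumes "P \<in> points Wk K"
  shows "P [^]\<^bsub>G\<^esub> (k::nat) \<in> points Wk K \<and> map_point conj (P [^]\<^bsub>G\<^esub> k) = map_point conj P [^]\<^bsub>G\<^esub> k"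
proof (induction k)
  case (Suc k)
  have "set_point (P [^]\<^bsub>G\<^esub> k) \<subseteq> K" "set_point P \<subseteq> K" "on_curve Wk (P [^]\<^bsub>G\<^esub> k)" "on_curve Wk P"
    using Suc assms by (auto simp: points_iff)
  then show ?case using point_add_cases[of "P [^]\<^bsub>G\<^esub> k" P] Suc by (auto simp: points_iff point_add_on_curve)
qed (simp add: points_iff)

text \<open>These points correspond to the rational \<open>l\<close>-torsion points of the quadratic
  twist of the curve by \<open>d\<close>.\<close>

definition minus_torsion :: "'k point set" where
  "minus_torsion = {P \<in> points Wk K. P [^]\<^bsub>G\<^esub> l = Infinity \<and> map_point conj P = point_neg Wk P}"

lemma minus_torsion_pow:
  assumes "P \<in> minus_torsion"
  shows "P [^]\<^bsub>G\<^esub> (k::nat) \<in> minus_torsion"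
proof -
  have P: "P \<in> points Wk K" "P [^]\<^bsub>G\<^esub> l = Infinity" "map_point conj P = point_neg Wk P" "on_curve Wk P"
    using assms by (auto simp: minus_torsion_def points_iff)
  have c: "on_curve Wk (P [^]\<^bsub>G\<^esub> k)" using pow_K[OF P(1)] by (simp add: points_iff)
  have "(P [^]\<^bsub>G\<^esub> k) [^]\<^bsub>G\<^esub> l = (P [^]\<^bsub>G\<^esub> l) [^]\<^bsub>G\<^esub> k"
    using P(4) by (simp add: G.nat_pow_pow mult.commute)
  also have "\<dots> = Infinity" using P(2) G.nat_pow_one[of k] by simp
  finally have "(P [^]\<^bsub>G\<^esub> k) [^]\<^bsub>G\<^esub> l = Infinity" .
  moreover have "map_point conj (P [^]\<^bsub>G\<^esub> k) = point_neg Wk (P [^]\<^bsub>G\<^esub> k)"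
    using pow_K[OF P(1), of k] P(3,4) G.nat_pow_inv[of P k] inv_eq c by simp
  ultimately show ?thesis using pow_K[OF P(1)] by (simp add: minus_torsion_def)
qed

lemma exists_minus_torsion:
  assumes "P \<in> torsion Wk K l - points Wk \<rat>"
  shows "\<exists>Q\<in>minus_torsion. Q \<noteq> Infinity"
proof -
  have P: "P \<in> points Wk K" "on_curve Wk P" "set_point P \<subseteq> K" "point_mult Wk l P = Infinity"
    and nr: "\<not> set_point P \<subseteq> \<rat>"
    using assms by (auto simp: torsion_def points_def)
  have Pl: "P [^]\<^bsub>G\<^esub> l = Infinity" using P(4) point_mult_eq_pow[OF disc_k P(2)] by simp
  define P' where "P' = map_point conj P"
  have P': "on_curve Wk P'" "set_point P' \<subseteq> K" "P' [^]\<^bsub>G\<^esub> l = Infinity"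
    using on_curve_conj[OF P(3,2)] set_point_conj[OF P(3)] pow_K[OF P(1), of l] Pl by (auto simp: P'_def)
  have PP: "map_point conj P' = P" unfolding P'_def using P(3) by (cases P) auto
  define Q where "Q = point_add Wk P (point_neg Wk P')"
  have Pc: "P \<in> carrier G" "P' \<in> carrier G" using P(2) P'(1) by simp_all
  have Qi: "Q = P \<otimes>\<^bsub>G\<^esub> inv\<^bsub>G\<^esub> P'" using inv_eq P' by (simp add: Q_def)
  have Qc: "on_curve Wk Q" "set_point Q \<subseteq> K"
    using point_add_on_curve[OF P(2) point_neg_on_curve[OF P'(1)]]
      point_add_cases[OF P(3) point_neg_K[OF P'(2)]] by (simp_all add: Q_def)
  have "Q [^]\<^bsub>G\<^esub> l = P [^]\<^bsub>G\<^esub> l \<otimes>\<^bsub>G\<^esub> (inv\<^bsub>G\<^esub> P') [^]\<^bsub>G\<^esub> l"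
    unfolding Qi using G.nat_pow_distrib[of P "inv\<^bsub>G\<^esub> P'" l] G.inv_closed[of P'] P(2) P'(1)
    by (simp only: point_group_simps mem_Collect_eq)
  also have "(inv\<^bsub>G\<^esub> P') [^]\<^bsub>G\<^esub> l = inv\<^bsub>G\<^esub> (P' [^]\<^bsub>G\<^esub> l)" using P' by (simp add: G.nat_pow_inv)
  finally have "Q [^]\<^bsub>G\<^esub> l = Infinity" using Pl P'(3) G.inv_one by simp
  moreover have "map_point conj Q = point_neg Wk Q"
  proof -
    have "map_point conj Q = P' \<otimes>\<^bsub>G\<^esub> inv\<^bsub>G\<^esub> P"
      using point_add_cases[OF P(3) point_neg_K[OF P'(2)]] conj_point_neg[OF P'(2)] PP inv_eq[OF P(2)]
      by (simp add: Q_def P'_def)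
    also have "\<dots> = inv\<^bsub>G\<^esub> Q" unfolding Qi using Pc by (simp add: G.inv_mult_group del: point_group_simps)
    finally show ?thesis using inv_eq[OF Qc(1)] by simp
  qed
  moreover have "Q \<noteq> Infinity"
  proof
    assume "Q = Infinity"
    then have "P \<otimes>\<^bsub>G\<^esub> inv\<^bsub>G\<^esub> P' = \<one>\<^bsub>G\<^esub>" using Qi by simp
    from G.inv_equality[OF this G.inv_closed[OF Pc(2)] Pc(1)] have "P = P'"
      using Pc(2) by (simp del: point_group_simps)
    then have "set_point P \<subseteq> \<rat>" unfolding P'_def using P(3) by (cases P) (auto intro: conj_fixed)
    then show False using nr by simp
  qed
  ultimately show ?thesis using Qc by (auto simp: minus_torsion_def points_iff)
qed

lemma minus_torsion_affine:
  assumes "P \<in> minus_torsion" "P \<noteq> Infinity"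
  obtains x y e where "P = Affine (of_rat x) y" "eta Wk (of_rat x) y = of_rat e * s"
    "on_curve Wk (Affine (of_rat x) y)"
proof -
  obtain X0 y where P: "P = Affine X0 y" using assms(2) by (cases P) auto
  have K [simp]: "X0 \<in> K" "y \<in> K" and c: "on_curve Wk P"
    and e: "conj X0 = X0" "conj y = - y - of_int (a1 W) * X0 - of_int (a3 W)"
    using assms by (auto simp: minus_torsion_def points_iff P)
  obtain x where x: "X0 = of_rat x" using conj_fixed[OF K(1) e(1)] by (auto simp: Rats_def)
  have "conj (eta Wk X0 y) = - eta Wk X0 y" by (simp add: eta_def conj_add conj_mult e algebra_simps)
  moreover have "eta Wk X0 y \<in> K" by (simp add: eta_def)
  ultimately obtain v where "eta Wk X0 y = of_rat v * s" using conj_anti by blast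
  then show ?thesis using that P x c by blast
qed

lemma pow_eq_one_iff:
  assumes "P \<in> minus_torsion" "P \<noteq> Infinity"
  shows "P [^]\<^bsub>G\<^esub> (k::nat) = Infinity \<longleftrightarrow> l dvd k"
proof -
  have P: "P \<in> carrier G" "P [^]\<^bsub>G\<^esub> l = \<one>\<^bsub>G\<^esub>"
    using assms by (auto simp: minus_torsion_def points_iff)
  then have "G.ord P dvd l" using G.pow_eq_id by blast
  moreover have "G.ord P \<noteq> 1" using G.ord_eq_1[OF P(1)] assms(2) by simp
  ultimately have "G.ord P = l" using prime_l by (metis prime_nat_iff)
  then show ?thesis using G.pow_eq_id[OF P(1), of k] by simp
qed

section \<open>Abscissas of these points and of their multiples\<close>

definition abscissas :: "rat set" where
  "abscissas = {x. \<exists>y. Affine (of_rat x) y \<in> minus_torsion}"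

abbreviation Wq :: "rat weierstrass" where "Wq \<equiv> over_field W"

lemma invariants_rat:
  "b2 Wk = of_rat (b2 Wq)" "b4 Wk = of_rat (b4 Wq)" "b6 Wk = of_rat (b6 Wq)" "b8 Wk = of_rat (b8 Wq)"
  by (simp_all add: over_invariants)

lemma psi2_sq_rat: "psi2_sq Wk (of_rat x) = of_rat (psi2_sq Wq x)"
  by (simp add: psi2_sq_def invariants_rat of_rat_add of_rat_mult of_rat_power)

lemma phi2_rat: "phi2 Wk (of_rat x) = of_rat (phi2 Wq x)"
  by (simp add: phi2_def invariants_rat of_rat_diff of_rat_mult of_rat_power)

lemma exists_abscissa:
  assumes "P \<in> torsion Wk K l - points Wk \<rat>"
  shows "abscissas \<noteq> {}"
proof -
  obtain Q where Q: "Q \<in> minus_torsion" "Q \<noteq> Infinity" using exists_minus_torsion[OF assms] by blast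
  then obtain x y where "Q = Affine (of_rat x) y" by (metis minus_torsion_affine)
  then show ?thesis using Q unfolding abscissas_def by auto
qed

lemma abscissa_psi2:
  assumes "x \<in> abscissas"
  shows "\<exists>e. d * e ^ 2 = psi2_sq Wq x"
proof -
  obtain y where "Affine (of_rat x) y \<in> minus_torsion" using assms by (auto simp: abscissas_def)
  then obtain e where e: "eta Wk (of_rat x) y = of_rat e * s" and c: "on_curve Wk (Affine (of_rat x) y)"
    by (elim minus_torsion_affine) auto
  have "of_rat (d * e ^ 2) = (of_rat e * s) ^ 2"
    unfolding of_rat_mult s_sq[symmetric] of_rat_power by Groebner_Basis.algebra
  also have "\<dots> = of_rat (psi2_sq Wq x)" using eta_sq[OF c] e psi2_sq_rat by simp
  finally show ?thesis by (auto simp only: of_rat_eq_iff)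
qed

text \<open>The tangent slope \<open>m\<close> in the coordinates \<open>x\<close> and
  \<open>eta\<close> has a rational product with \<open>eta\<close>, which is a rational multiple of
  \<open>s\<close>. So \<open>m\<close> is one too, and \<open>m^2\<close> has the form
  \<open>d e^2\<close>.\<close>

lemma abscissa_double:
  assumes "Affine (of_rat x) y \<in> minus_torsion"
    "Affine (of_rat x) y [^]\<^bsub>G\<^esub> (2::nat) = Affine (of_rat x') y'"
  shows "x' * psi2_sq Wq x = phi2 Wq x" "\<exists>e. d * e ^ 2 = b2 Wq + 8 * x + 4 * x'"
proof -
  let ?P = "Affine (of_rat x :: 'k) y"
  obtain e where e: "eta Wk (of_rat x) y = of_rat e * s" and c: "on_curve Wk ?P"
    using assms(1) by (elim minus_torsion_affine) auto
  have P2: "point_add Wk ?P ?P = Affine (of_rat x') y'"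
    using assms(2) c by (simp add: numeral_2_eq_2)
  have nz: "eta Wk (of_rat x) y \<noteq> 0"
  proof
    assume "eta Wk (of_rat x) y = 0"
    then show False using P2 by (simp add: eta_def algebra_simps)
  qed
  obtain m where m: "m * eta Wk (of_rat x) y = 6 * of_rat x ^ 2 + b2 Wk * of_rat x + b4 Wk"
    "m ^ 2 = b2 Wk + 8 * of_rat x + 4 * of_rat x'"
    using point_double[OF nz] P2 by (metis point.inject)
  have es: "eta Wk (of_rat x) y ^ 2 = of_rat (psi2_sq Wq x)" using eta_sq[OF c] psi2_sq_rat by simp
  have "4 * of_rat (x' * psi2_sq Wq x) = (4 * of_rat (phi2 Wq x) :: 'k)"
  proof -
    have "(6 * of_rat x ^ 2 + b2 Wk * of_rat x + b4 Wk) ^ 2 = m ^ 2 * eta Wk (of_rat x) y ^ 2"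
      unfolding m(1)[symmetric] by (simp add: power_mult_distrib)
    then have "(b2 Wk + 8 * of_rat x + 4 * of_rat x') * of_rat (psi2_sq Wq x) =
      of_rat (psi2_sq Wq x) * (b2 Wk + 8 * of_rat x) + 4 * of_rat (phi2 Wq x)"
      unfolding psi2_phi2[of "of_rat x" Wk] m(2) es psi2_sq_rat phi2_rat by simp
    then show ?thesis unfolding of_rat_mult by Groebner_Basis.algebra
  qed
  from mult_left_cancel[THEN iffD1, OF _ this] show "x' * psi2_sq Wq x = phi2 Wq x"
    by (simp only: of_rat_eq_iff) simp
  have e0: "e \<noteq> 0" and s0: "s \<noteq> 0" using nz e by auto
  have q: "6 * of_rat x ^ 2 + b2 Wk * of_rat x + b4 Wk = of_rat (6 * x ^ 2 + b2 Wq * x + b4 Wq)" (is "_ = of_rat ?q")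
    by (simp add: invariants_rat of_rat_add of_rat_mult of_rat_power)
  have d0: "d \<noteq> 0" using s_sq s0 by auto
  have "m * (of_rat e * of_rat d) = (m * (of_rat e * s)) * s"
    unfolding s_sq[symmetric] by (simp only: ac_simps)
  then have "m * (of_rat e * of_rat d) = of_rat ?q * s" unfolding m(1)[unfolded e q] .
  then have ms: "m = of_rat (?q / (e * d)) * s"
    using e0 d0 by (simp add: of_rat_divide of_rat_mult field_simps)
  have "of_rat (d * (?q / (e * d)) ^ 2) = m ^ 2"
    unfolding ms of_rat_mult of_rat_power s_sq[symmetric] by Groebner_Basis.algebra
  also have "\<dots> = of_rat (b2 Wq + 8 * x + 4 * x')"
    unfolding m(2) by (simp add: invariants_rat of_rat_add of_rat_mult)
  finally show "\<exists>e. d * e ^ 2 = b2 Wq + 8 * x + 4 * x'" by (auto simp only: of_rat_eq_iff)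
qed

lemma n_pos: "n \<ge> 1" using prime_l l_eq by (cases n) auto

lemma multiple_affine:
  assumes "P \<in> minus_torsion" "P \<noteq> Infinity" "0 < k" "k < l"
  shows "\<exists>x y. P [^]\<^bsub>G\<^esub> (k::nat) = Affine (of_rat x) y"
proof -
  have "P [^]\<^bsub>G\<^esub> k \<noteq> Infinity" using pow_eq_one_iff[OF assms(1,2)] assms(3,4) by (auto dest: dvd_imp_le)
  then show ?thesis using minus_torsion_pow[OF assms(1)] minus_torsion_affine by metis
qed

lemma exists_double:
  assumes "x \<in> abscissas"
  shows "\<exists>x'\<in>abscissas. x' * psi2_sq Wq x = phi2 Wq x \<and> (\<exists>e. d * e ^ 2 = b2 Wq + 8 * x + 4 * x')"
proof -
  obtain y where P: "Affine (of_rat x) y \<in> minus_torsion" using assms by (auto simp: abscissas_def)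
  obtain x' y' where x': "Affine (of_rat x) y [^]\<^bsub>G\<^esub> (2::nat) = Affine (of_rat x') y'"
    using multiple_affine[OF P, of 2] n_pos l_eq by auto
  then have "x' \<in> abscissas" using minus_torsion_pow[OF P, of 2] by (auto simp: abscissas_def)
  then show ?thesis using abscissa_double[OF P x'] by blast
qed

text \<open>\<open>xs k\<close> is the abscissa of the \<open>k\<close>-th multiple for
  \<open>0 < k < l\<close>. The multiples \<open>n\<close> and \<open>n + 1\<close> add up to
  \<open>l\<close> and are opposite. Up to \<open>m = n\<close> the addition formulas apply, since
  neither \<open>m - 1\<close> nor \<open>m + 1\<close> is a multiple of \<open>l\<close>.\<close>

lemma abscissa_sequence:
  assumes "x \<in> abscissas"
  obtains xs :: "nat \<Rightarrow> rat" where "xs 1 = x"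
    "xs 2 * psi2_sq Wq (xs 1) = phi2 Wq (xs 1)" "xs (n + 1) = xs n"
    "\<And>m. 2 \<le> m \<Longrightarrow> m \<le> n \<Longrightarrow> xs 1 \<noteq> xs m \<and>
       (xs (m + 1) + xs (m - 1)) * (xs 1 - xs m) ^ 2 =
         2 * xs 1 * xs m * (xs 1 + xs m) + b2 Wq * xs 1 * xs m + b4 Wq * (xs 1 + xs m) + b6 Wq \<and>
       xs (m + 1) * xs (m - 1) * (xs 1 - xs m) ^ 2 =
         xs 1 ^ 2 * xs m ^ 2 - b4 Wq * xs 1 * xs m - b6 Wq * (xs 1 + xs m) - b8 Wq"
proof -
  obtain y where P: "Affine (of_rat x) y \<in> minus_torsion" using assms by (auto simp: abscissas_def)
  define P where "P = Affine (of_rat x :: 'k) y"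
  note P = P[folded P_def] and Pn = point.distinct(2)[of "of_rat x :: 'k" y, folded P_def]
  have Pc: "P \<in> carrier G" using P by (auto simp: minus_torsion_def points_iff)
  define Q where "Q k = P [^]\<^bsub>G\<^esub> k" for k :: nat
  have Qc: "Q k \<in> carrier G" for k using Pc by (simp add: Q_def del: point_group_simps)
  have "\<forall>k. \<exists>x y. 0 < k \<and> k < l \<longrightarrow> Q k = Affine (of_rat x) y"
    unfolding Q_def using multiple_affine[OF P Pn] by blast
  then obtain xs ys where xy: "0 < k \<Longrightarrow> k < l \<Longrightarrow> Q k = Affine (of_rat (xs k)) (ys k)" for k
    by metis
  have Q1: "Q 1 = P" using Pc by (simp add: Q_def del: point_group_simps)
  have l1: "1 < l" using n_pos l_eq by simp
  have P1: "P = Affine (of_rat (xs 1)) (ys 1)" using xy[of 1] l1 Q1 by simp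
  then have x1: "xs 1 = x" by (simp add: P_def)
  have Qinj: "l dvd k - j" if "Q k = Q j" "j \<le> k" for k j
  proof -
    have "Q k = Q (k - j) \<otimes>\<^bsub>G\<^esub> Q j" unfolding Q_def using Pc that(2) by (subst G.nat_pow_mult) auto
    then have "Q (k - j) = \<one>\<^bsub>G\<^esub>" using that(1) Qc G.r_cancel_one' by (metis)
    then show ?thesis unfolding Q_def using pow_eq_one_iff[OF P Pn] by simp
  qed
  have Qneg: "l dvd k + j" if "Q k = inv\<^bsub>G\<^esub> Q j" for k j
  proof -
    have "Q (k + j) = Q k \<otimes>\<^bsub>G\<^esub> Q j" unfolding Q_def using Pc by (simp add: G.nat_pow_mult del: point_group_simps)
    then have "Q (k + j) = \<one>\<^bsub>G\<^esub>" using that Qc G.l_inv by metis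
    then show ?thesis unfolding Q_def using pow_eq_one_iff[OF P Pn] by simp
  qed
  show ?thesis
  proof (rule that[of xs])
    show "xs 1 = x" by (fact x1)
    have "2 < l" using n_pos l_eq by simp
    then have "Q 2 = Affine (of_rat (xs 2)) (ys 2)" using xy by simp
    then show "xs 2 * psi2_sq Wq (xs 1) = phi2 Wq (xs 1)"
      using abscissa_double(1)[of "xs 1" "ys 1" "xs 2" "ys 2"] P P1 by (simp add: Q_def)
    have "Q (n + 1) \<otimes>\<^bsub>G\<^esub> Q n = \<one>\<^bsub>G\<^esub>"
    proof -
      have "Q (n + 1) \<otimes>\<^bsub>G\<^esub> Q n = Q (n + 1 + n)" unfolding Q_def using Pc by (rule G.nat_pow_mult)
      also have "n + 1 + n = l" using l_eq by simp
      finally show ?thesis using pow_eq_one_iff[OF P Pn, of l] by (simp add: Q_def)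
    qed
    then have "inv\<^bsub>G\<^esub> (Q n) = Q (n + 1)" using Qc G.inv_equality by blast
    then have "point_neg Wk (Q n) = Q (n + 1)" using inv_eq[of "Q n"] Qc[of n] by simp
    then show "xs (n + 1) = xs n" using xy[of n] xy[of "n + 1"] n_pos l_eq by simp
    fix m assume m: "2 \<le> m" "m \<le> n"
    have ml: "m < l" "m + 1 < l" "m - 1 < l" "0 < m - 1" using m l_eq by auto
    have Qm: "Q m = Affine (of_rat (xs m)) (ys m)" using xy m ml by simp
    have Qmc: "on_curve Wk (Affine (of_rat (xs m)) (ys m))" using Qc[of m] Qm by simp
    have P1c: "on_curve Wk (Affine (of_rat (xs 1)) (ys 1))" using Pc P1 by simp
    have ne: "xs 1 \<noteq> xs m"
    proof
      assume e: "xs 1 = xs m"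
      consider "ys 1 = ys m" | "ys m = - ys 1 - a1 Wk * of_rat (xs 1) - a3 Wk"
        using same_abscissa[of Wk "of_rat (xs 1)" "ys 1" "ys m"] P1c Qmc e by auto
      then show False
      proof cases
        case 1
        then have "Q m = Q 1" using Qm Q1 P1 e by simp
        then have "l dvd m - 1" using Qinj m by simp
        then show False using ml by (auto dest: dvd_imp_le)
      next
        case 2
        then have "Q m = point_neg Wk P" unfolding P1 Qm using e by simp
        then have "Q m = inv\<^bsub>G\<^esub> Q 1" using inv_eq[of P] Pc Q1 by simp
        then have "l dvd m + 1" by (rule Qneg)
        then show False using ml by (auto dest: dvd_imp_le)
      qed
    qed
    then have ne': "(of_rat (xs 1) :: 'k) \<noteq> of_rat (xs m)" by simp
    obtain xp yp xm ym where sp: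
      "point_add Wk (Affine (of_rat (xs 1)) (ys 1)) (Affine (of_rat (xs m)) (ys m)) = Affine xp yp"
      "point_add Wk (Affine (of_rat (xs 1)) (ys 1)) (point_neg Wk (Affine (of_rat (xs m)) (ys m))) = Affine xm ym"
      and eqs: "(xp + xm) * (of_rat (xs 1) - of_rat (xs m)) ^ 2 = 2 * of_rat (xs 1) * of_rat (xs m) * (of_rat (xs 1) + of_rat (xs m))
        + b2 Wk * of_rat (xs 1) * of_rat (xs m) + b4 Wk * (of_rat (xs 1) + of_rat (xs m)) + b6 Wk"
      "xp * xm * (of_rat (xs 1) - of_rat (xs m)) ^ 2 = of_rat (xs 1) ^ 2 * of_rat (xs m) ^ 2
        - b4 Wk * of_rat (xs 1) * of_rat (xs m) - b6 Wk * (of_rat (xs 1) + of_rat (xs m)) - b8 Wk"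
      using sum_prod_abscissas[OF P1c Qmc ne'] by metis
    have "P \<otimes>\<^bsub>G\<^esub> Q m = Q (m + 1)" using G.nat_pow_Suc2[OF Pc, of m]
      by (simp only: Q_def Suc_eq_plus1)
    then have xp: "xp = of_rat (xs (m + 1))" using sp(1) xy[of "m + 1"] ml P1 Qm by simp
    \<comment> \<open>The difference \<open>P - Q m\<close> is the negative of
      \<open>Q (m - 1)\<close>, which has the same abscissa.\<close>
    have "Q m = Q (m - 1) \<otimes>\<^bsub>G\<^esub> P"
      using m by (cases m) (simp_all add: Q_def del: point_group_simps)
    then have "P \<otimes>\<^bsub>G\<^esub> inv\<^bsub>G\<^esub> Q m = P \<otimes>\<^bsub>G\<^esub> (inv\<^bsub>G\<^esub> P \<otimes>\<^bsub>G\<^esub> inv\<^bsub>G\<^esub> Q (m - 1))"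
      using Pc Qc[of "m - 1"] by (simp add: G.inv_mult_group del: point_group_simps)
    also have "\<dots> = inv\<^bsub>G\<^esub> Q (m - 1)"
      using Pc Qc[of "m - 1"] by (simp add: G.m_assoc[symmetric] del: point_group_simps)
    finally have "point_add Wk P (point_neg Wk (Q m)) = point_neg Wk (Q (m - 1))"
      using inv_eq[of "Q m"] inv_eq[of "Q (m - 1)"] Qc[of m] Qc[of "m - 1"] by simp
    then have xm: "xm = of_rat (xs (m - 1))" using sp(2) xy[of "m - 1"] ml P1 Qm by simp
    have "of_rat ((xs (m + 1) + xs (m - 1)) * (xs 1 - xs m) ^ 2) = (of_rat
         (2 * xs 1 * xs m * (xs 1 + xs m) + b2 Wq * xs 1 * xs m + b4 Wq * (xs 1 + xs m) + b6 Wq) :: 'k)"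
      using eqs(1) unfolding xp xm invariants_rat
      by (simp only: of_rat_add of_rat_mult of_rat_diff of_rat_power of_rat_numeral_eq)
    moreover have "of_rat (xs (m + 1) * xs (m - 1) * (xs 1 - xs m) ^ 2) = (of_rat
         (xs 1 ^ 2 * xs m ^ 2 - b4 Wq * xs 1 * xs m - b6 Wq * (xs 1 + xs m) - b8 Wq) :: 'k)"
      using eqs(2) unfolding xp xm invariants_rat
      by (simp only: of_rat_add of_rat_mult of_rat_diff of_rat_power of_rat_numeral_eq)
    ultimately show "xs 1 \<noteq> xs m \<and>
       (xs (m + 1) + xs (m - 1)) * (xs 1 - xs m) ^ 2 =
         2 * xs 1 * xs m * (xs 1 + xs m) + b2 Wq * xs 1 * xs m + b4 Wq * (xs 1 + xs m) + b6 Wq \<and>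
       xs (m + 1) * xs (m - 1) * (xs 1 - xs m) ^ 2 =
         xs 1 ^ 2 * xs m ^ 2 - b4 Wq * xs 1 * xs m - b6 Wq * (xs 1 + xs m) - b8 Wq"
      using ne by (simp only: of_rat_eq_iff simp_thms)
  qed
qed

end

section \<open>The reduction at a ramified prime\<close>

lemma half_mod:
  assumes "prime p" "p \<noteq> 2"
  shows "\<exists>h. int p dvd 2 * h - 1"
proof -
  have "odd p" using assms by (metis prime_odd_nat prime_ge_2_nat le_neq_implies_less)
  then obtain k where "p = 2 * k + 1" by (elim oddE)
  then have "2 * int (k + 1) - 1 = int p" by simp
  then show ?thesis by (intro exI[of _ "int (k + 1)"]) simp
qed

text \<open>For odd \<open>p\<close> choose \<open>y\<close> with \<open>2 y + a1 x + a3 = 0\<close>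
  modulo \<open>p\<close>; then \<open>psi2_sq\<close> gives the equation and
  \<open>psi2_phi2\<close> the derivative in \<open>x\<close>. Modulo 2, \<open>psi2_sq\<close> only
  says that \<open>a1 x + a3\<close> is even; then \<open>phi2\<close> is the square of the
  derivative in \<open>x\<close>.\<close>

lemma singular_if_psi2_phi2:
  assumes p: "prime p" and psi: "int p dvd psi2_sq W x" and phi: "int p dvd phi2 W x"
  shows "\<exists>y. singular_mod p W x y"
proof (cases "p = 2")
  case True
  have sq: "psi2_sq W x = (a1 W * x + a3 W) ^ 2 + 4 * (x ^ 3 + a2 W * x ^ 2 + a4 W * x + a6 W)"
    unfolding psi2_sq_def b2_def b4_def b6_def by Groebner_Basis.algebra
  have ev: "even (a1 W * x + a3 W)" using psi True unfolding sq by simp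
  have phi': "even (phi2 W x)" using phi True by simp
  \<comment> \<open>The equation reduces to \<open>y^2 = x^3 + a2 x^2 + a4 x + a6\<close>, and every
    residue modulo 2 is its own square.\<close>
  define y where "y = x ^ 3 + a2 W * x ^ 2 + a4 W * x + a6 W"
  have "even (y ^ 2 + a1 W * x * y + a3 W * y - (x ^ 3 + a2 W * x ^ 2 + a4 W * x + a6 W))"
    using ev unfolding y_def[symmetric]
    by (cases "even x"; cases "even y"; cases "even (a1 W)"; cases "even (a3 W)") simp_all
  moreover have "even (a1 W * y - (3 * x ^ 2 + 2 * a2 W * x + a4 W))"
    using ev phi' unfolding y_def phi2_def b4_def b6_def b8_def
    by (cases "even x"; cases "even (a1 W)"; cases "even (a2 W)"; cases "even (a3 W)"; cases "even (a4 W)";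
        cases "even (a6 W)") simp_all
  moreover have "even (2 * y + a1 W * x + a3 W)" using ev by simp
  ultimately have "singular_mod p W x y"
    unfolding singular_mod_def True cong_iff_dvd_diff
    by (simp only: of_nat_numeral diff_0_right simp_thms)
  then show ?thesis by blast
next
  case False
  have pp: "prime (int p)" using p by simp
  have n2: "\<not> int p dvd 2"
    using False p by (metis int_dvd_int_iff of_nat_numeral primes_dvd_imp_eq two_is_prime_nat)
  define q where "q = 6 * x ^ 2 + b2 W * x + b4 W"
  have "q ^ 2 = psi2_sq W x * (b2 W + 8 * x) + 4 * phi2 W x" unfolding q_def by (rule psi2_phi2)
  then have "int p dvd q ^ 2" using psi phi by simp
  then have q: "int p dvd q" using pp prime_dvd_power by blast
  obtain h where h: "int p dvd 2 * h - 1" using half_mod[OF p False] by blast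
  define y where "y = - (h * (a1 W * x + a3 W))"
  define e where "e = 2 * y + a1 W * x + a3 W"
  have "e = - ((2 * h - 1) * (a1 W * x + a3 W))" by (simp add: e_def y_def algebra_simps)
  then have e: "int p dvd e" using h by simp
  define F where "F = y ^ 2 + a1 W * x * y + a3 W * y - (x ^ 3 + a2 W * x ^ 2 + a4 W * x + a6 W)"
  have "2 * (2 * F) = e * e - psi2_sq W x"
    unfolding F_def e_def psi2_sq_def b2_def b4_def b6_def by Groebner_Basis.algebra
  then have "int p dvd 2 * (2 * F)" using e psi by simp
  then have F: "int p dvd F" using n2 by (simp only: prime_dvd_mult_iff[OF pp] simp_thms)
  define H where "H = a1 W * y - (3 * x ^ 2 + 2 * a2 W * x + a4 W)"
  have "2 * H = a1 W * e - q" unfolding H_def e_def q_def b2_def b4_def by Groebner_Basis.algebra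
  then have "int p dvd 2 * H" using e q by simp
  then have "int p dvd H" using pp n2 by (simp add: prime_dvd_mult_iff)
  then have "singular_mod p W x y"
    using F e unfolding singular_mod_def by (simp add: cong_iff_dvd_diff F_def H_def e_def)
  then show ?thesis by blast
qed

text \<open>The tangent cone at the singular point has discriminant \<open>b2 + 12 x\<close>. For
  odd \<open>p\<close> the singular abscissa is unique modulo \<open>p\<close>, so this is the given
  sum. For \<open>p = 2\<close> the sum makes \<open>a1\<close> even, and each residue is a
  square.\<close>

lemma double_tangent_if:
  assumes p: "prime p" and x: "int p dvd psi2_sq W x" "int p dvd phi2 W x"
    and x': "int p dvd psi2_sq W x'" "int p dvd phi2 W x'"
    and sum: "int p dvd b2 W + 8 * x + 4 * x'"
  shows "double_tangent_mod p W x"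
proof (cases "p = 2")
  case True
  have "even (a1 W)" using sum True by (simp add: b2_def)
  moreover have "even (- m - m ^ 2)" for m :: int by simp
  from this[of "3 * x + a2 W"] have "even (- (3 * x + a2 W) - (3 * x + a2 W) ^ 2)" .
  ultimately show ?thesis unfolding double_tangent_mod_def True
    by (intro exI[of _ "3 * x + a2 W"]) (simp add: cong_iff_dvd_diff del: minus_add_distrib)
next
  case False
  have pp: "prime (int p)" using p by simp
  have n2: "\<not> int p dvd 2"
    using False p by (metis int_dvd_int_iff of_nat_numeral primes_dvd_imp_eq two_is_prime_nat)
  have q: "int p dvd 6 * z ^ 2 + b2 W * z + b4 W" if "int p dvd psi2_sq W z" "int p dvd phi2 W z" for z
  proof -
    have "int p dvd (6 * z ^ 2 + b2 W * z + b4 W) ^ 2" unfolding psi2_phi2 using that by simp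
    then show ?thesis using pp prime_dvd_power by blast
  qed
  \<comment> \<open>Uniqueness: a cubic with leading coefficient 4, invertible modulo
    \<open>p\<close>, cannot have two different double roots.\<close>
  have "2 * (2 * (x - x') ^ 3) = 2 * ((6 * x ^ 2 + b2 W * x + b4 W) + (6 * x' ^ 2 + b2 W * x' + b4 W)) * (x - x')
      - 2 * (psi2_sq W x - psi2_sq W x')"
    unfolding psi2_sq_def by Groebner_Basis.algebra
  also have "int p dvd \<dots>" by (rule dvd_diff[OF dvd_mult2[OF dvd_mult[OF dvd_add[OF q[OF x] q[OF x']]]] dvd_mult[OF dvd_diff[OF x(1) x'(1)]]])
  finally have "int p dvd 2 * (2 * (x - x') ^ 3)" .
  then have "int p dvd (x - x') ^ 3" using n2 by (simp only: prime_dvd_mult_iff[OF pp] simp_thms)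
  then have xx: "int p dvd x - x'" using pp prime_dvd_power by blast
  obtain h where h: "int p dvd 2 * h - 1" using half_mod[OF p False] by blast
  define \<alpha> where "\<alpha> = - (h * a1 W)"
  have "a1 W - - 2 * \<alpha> = - ((2 * h - 1) * a1 W)" by (simp add: \<alpha>_def algebra_simps)
  then have c1: "int p dvd a1 W - - 2 * \<alpha>" using h by simp
  have "2 * (2 * (- (3 * x + a2 W) - \<alpha> ^ 2)) =
      (a1 W - - 2 * \<alpha>) * (a1 W - 2 * \<alpha>) - (b2 W + 8 * x + 4 * x') - 4 * (x - x')"
    unfolding b2_def by Groebner_Basis.algebra
  also have "int p dvd \<dots>" by (rule dvd_diff[OF dvd_diff[OF dvd_mult2[OF c1] sum] dvd_mult[OF xx]])
  finally have "int p dvd 2 * (2 * (- (3 * x + a2 W) - \<alpha> ^ 2))" .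
  then have "int p dvd - (3 * x + a2 W) - \<alpha> ^ 2" using n2 by (simp only: prime_dvd_mult_iff[OF pp] simp_thms)
  then show ?thesis using c1 unfolding double_tangent_mod_def cong_iff_dvd_diff by blast
qed

lemma additive_model_at_ramified:
  assumes tw: "twisted_torsion K s (of_int d) W l n" and p: "prime p" and ram: "padic.ramified_disc p d"
    and ne: "twisted_torsion.abscissas K s W l \<noteq> {}" and pl: "p \<noteq> l \<or> l > 3"
  shows "\<exists>x y. singular_mod p W x y \<and> double_tangent_mod p W x"
proof -
  interpret padic p by standard (fact p)
  interpret twisted_torsion K s "of_int d" W l n by (fact tw)
  have B: "pint (b2 Wq)" "pint (b4 Wq)" "pint (b6 Wq)" "pint (b8 Wq)"
    by (simp_all add: over_invariants)
  have int: "pint x" if x: "x \<in> abscissas" for x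
  proof (rule ccontr)
    assume n: "\<not> pint x"
    obtain xs :: "nat \<Rightarrow> rat" where xs: "xs 1 = x"
      "xs 2 * psi2_sq Wq (xs 1) = phi2 Wq (xs 1)" "xs (n + 1) = xs n"
      "\<And>m. 2 \<le> m \<Longrightarrow> m \<le> n \<Longrightarrow> xs 1 \<noteq> xs m \<and>
       (xs (m + 1) + xs (m - 1)) * (xs 1 - xs m) ^ 2 =
         2 * xs 1 * xs m * (xs 1 + xs m) + b2 Wq * xs 1 * xs m + b4 Wq * (xs 1 + xs m) + b6 Wq \<and>
       xs (m + 1) * xs (m - 1) * (xs 1 - xs m) ^ 2 =
         xs 1 ^ 2 * xs m ^ 2 - b4 Wq * xs 1 * xs m - b6 Wq * (xs 1 + xs m) - b8 Wq"
      using abscissa_sequence[OF x] by blast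
    have "p = 3 \<and> n = 1"
      by (rule kernel_of_reduction[OF B n_pos, of xs])
        (use n xs prime_l l_eq in \<open>simp_all add: psi2_sq_def phi2_def\<close>)
    then show False using pl l_eq by simp
  qed
  have psi: "pdvd 1 (psi2_sq Wq x)" if x: "x \<in> abscissas" for x
  proof -
    obtain e where e: "of_int d * e ^ 2 = psi2_sq Wq x" using abscissa_psi2[OF x] by blast
    \<comment> \<open>This has the shape of a square plus four times an integral number, as
      \<open>ramified_disc\<close> requires.\<close>
    have sq: "psi2_sq Wq x = (a1 Wq * x + a3 Wq) ^ 2 + 4 * (x ^ 3 + a2 Wq * x ^ 2 + a4 Wq * x + a6 Wq)"
      unfolding psi2_sq_def b2_def b4_def b6_def by Groebner_Basis.algebra
    have "pint (a1 Wq * x + a3 Wq)" "pint (x ^ 3 + a2 Wq * x ^ 2 + a4 Wq * x + a6 Wq)"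
      using int[OF x] by simp_all
    then show ?thesis using ram e unfolding ramified_disc_def sq by blast
  qed
  \<comment> \<open>The abscissa \<open>x'\<close> of the double is integral, so its numerator is
    divisible by \<open>p\<close> whenever its denominator is. This does the work of a reduction
    map.\<close>
  have phi: "pdvd 1 (phi2 Wq x)" if x: "x \<in> abscissas" for x
  proof -
    obtain x' where x': "x' \<in> abscissas" "x' * psi2_sq Wq x = phi2 Wq x"
      using exists_double[OF x] by blast
    show ?thesis unfolding x'(2)[symmetric] by (rule pdvd_mult_right[OF int[OF x'(1)] psi[OF x]])
  qed
  \<comment> \<open>Singularity modulo \<open>p\<close> is stated for integers, so
    \<open>p\<close>-integral abscissas are replaced by integer representatives.\<close>
  have res: "int p dvd psi2_sq W a \<and> int p dvd phi2 W a" if x: "x \<in> abscissas" and a: "pdvd 1 (x - of_int a)" for x a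
  proof -
    have "psi2_sq Wq x - of_int (psi2_sq W a) = (x - of_int a) *
      (4 * (x ^ 2 + x * of_int a + of_int a ^ 2) + b2 Wq * (x + of_int a) + 2 * b4 Wq)"
      unfolding psi2_sq_def over_invariants by (simp add: power2_eq_square power3_eq_cube algebra_simps)
    moreover have "pint (4 * (x ^ 2 + x * of_int a + of_int a ^ 2) + b2 Wq * (x + of_int a) + 2 * b4 Wq)"
      using int[OF x] B by simp
    ultimately have "pdvd 1 (psi2_sq Wq x - of_int (psi2_sq W a))" using pdvd_mult_left[OF a] by simp
    from pdvd_diff[OF psi[OF x] this] have "pdvd 1 (of_int (psi2_sq W a))" by simp
    then have 1: "int p dvd psi2_sq W a" by (subst (asm) pdvd_of_int) simp
    have "phi2 Wq x - of_int (phi2 W a) = (x - of_int a) *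
      ((x + of_int a) * (x ^ 2 + of_int a ^ 2) - b4 Wq * (x + of_int a) - 2 * b6 Wq)"
      unfolding phi2_def over_invariants by (simp add: power2_eq_square power4_eq_xxxx algebra_simps)
    moreover have "pint ((x + of_int a) * (x ^ 2 + of_int a ^ 2) - b4 Wq * (x + of_int a) - 2 * b6 Wq)"
      using int[OF x] B by simp
    ultimately have "pdvd 1 (phi2 Wq x - of_int (phi2 W a))" using pdvd_mult_left[OF a] by simp
    from pdvd_diff[OF phi[OF x] this] have "pdvd 1 (of_int (phi2 W a))" by simp
    then have "int p dvd phi2 W a" by (subst (asm) pdvd_of_int) simp
    then show ?thesis using 1 by simp
  qed
  obtain x where x: "x \<in> abscissas" using ne by blast
  obtain x' e where x': "x' \<in> abscissas" and e: "of_int d * e ^ 2 = b2 Wq + 8 * x + 4 * x'"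
    using exists_double[OF x] by blast
  obtain a where a: "pdvd 1 (x - of_int a)" using residue[OF int[OF x]] by blast
  obtain a' where a': "pdvd 1 (x' - of_int a')" using residue[OF int[OF x']] by blast
  have sq: "b2 Wq + 8 * x + 4 * x' = a1 Wq ^ 2 + 4 * (a2 Wq + 2 * x + x')"
    by (simp add: b2_def)
  have "pint (a1 Wq)" "pint (a2 Wq + 2 * x + x')" using int x x' by simp_all
  then have s1: "pdvd 1 (b2 Wq + 8 * x + 4 * x')" using ram e unfolding ramified_disc_def sq by blast
  have s2: "pdvd 1 (8 * (x - of_int a) + 4 * (x' - of_int a'))"
    using a a' by (intro pdvd_add pdvd_mult_right) auto
  have e2: "of_int (b2 W + 8 * a + 4 * a') = (b2 Wq + 8 * x + 4 * x') - (8 * (x - of_int a) + 4 * (x' - of_int a'))"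
    by (simp add: over_invariants algebra_simps)
  have "pdvd 1 (of_int (b2 W + 8 * a + 4 * a'))" unfolding e2 by (rule pdvd_diff[OF s1 s2])
  then have "int p dvd b2 W + 8 * a + 4 * a'" by (subst (asm) pdvd_of_int) simp
  then show ?thesis
    using double_tangent_if[OF p] singular_if_psi2_phi2[OF p] res[OF x a] res[OF x' a'] by blast
qed

section \<open>Minimal models and the conductor\<close>

lemma integral_model_disc:
  assumes "elliptic_curve E" "integral_model E W"
  shows "disc W \<noteq> 0"
proof
  assume "disc W = 0"
  then have "disc (over_field W :: rat weierstrass) = 0" by (simp add: over_invariants)
  moreover obtain u r s t where "transforms u r s t E (over_field W)"
    using assms(2) unfolding integral_model_def isomorphic_iff by blast
  ultimately have "disc E = 0" using disc_transforms by fastforce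
  then show False using assms(1) by (simp add: elliptic_curve_def)
qed

lemma exists_integral_model: "\<exists>W. integral_model E W"
proof -
  define N where "N = (\<Prod>q\<in>{a1 E, a2 E, a3 E, a4 E, a6 E}. snd (quotient_of q))"
  have N: "of_int N \<noteq> (0::rat)" by (auto simp: N_def quotient_of_denom_pos' less_imp_neq[symmetric])
  have *: "\<exists>m. of_int N ^ Suc k * q = of_int m" if "q \<in> {a1 E, a2 E, a3 E, a4 E, a6 E}" for q k
  proof -
    have "snd (quotient_of q) dvd N" unfolding N_def using that by (intro dvd_prodI) auto
    then obtain c where c: "N = snd (quotient_of q) * c" by blast
    have "q = of_int (fst (quotient_of q)) / of_int (snd (quotient_of q))"
      by (metis prod.collapse quotient_of_div)
    moreover have "of_int (snd (quotient_of q)) \<noteq> (0::rat)" using quotient_of_denom_pos'[of q] by simp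
    ultimately have "of_int N * q = of_int (c * fst (quotient_of q))" unfolding c
      by (metis (no_types, opaque_lifting) mult.commute mult.left_commute nonzero_mult_div_cancel_left of_int_mult times_divide_eq_right)
    then have "of_int N ^ Suc k * q = of_int (N ^ k * (c * fst (quotient_of q)))"
      by (simp add: mult.assoc mult.left_commute)
    then show ?thesis by blast
  qed
  obtain c1 c2 c3 c4 c6 where c: "of_int N ^ 1 * a1 E = of_int c1" "of_int N ^ 2 * a2 E = of_int c2"
    "of_int N ^ 3 * a3 E = of_int c3" "of_int N ^ 4 * a4 E = of_int c4" "of_int N ^ 6 * a6 E = of_int c6"
    using *[of "a1 E" 0] *[of "a2 E" 1] *[of "a3 E" 2] *[of "a4 E" 3] *[of "a6 E" 5]
    by (auto simp: eval_nat_numeral)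
  \<comment> \<open>Scaling by \<open>u = 1 / N\<close> multiplies the coefficient \<open>ai\<close>
    by \<open>N^i\<close>, which clears its denominator.\<close>
  have "transforms (1 / of_int N) 0 0 0 E (over_field (Weierstrass c1 c2 c3 c4 c6))"
    unfolding transforms_def using N by (simp add: c[symmetric] power_divide)
  then show ?thesis unfolding integral_model_def isomorphic_iff by blast
qed

lemma exists_minimal_model: "\<exists>W. minimal_model p E W"
proof -
  obtain W0 where "integral_model E W0" using exists_integral_model by blast
  from ex_has_least_nat[of "integral_model E", OF this, of "\<lambda>W. multiplicity (int p) (disc W)"]
  show ?thesis unfolding minimal_model_def by blast
qed

text \<open>An integral model whose discriminant is prime to \<open>p\<close> is minimal at
  \<open>p\<close>, so bad primes divide the discriminant of any one integral model.\<close>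

lemma finite_bad_primes:
  assumes "elliptic_curve E"
  shows "finite {p. prime p \<and> \<not> good_reduction E p}"
proof -
  obtain W where W: "integral_model E W" using exists_integral_model by blast
  have d: "disc W \<noteq> 0" by (rule integral_model_disc[OF assms W])
  have "{p. prime p \<and> \<not> good_reduction E p} \<subseteq> {p. p dvd nat \<bar>disc W\<bar>}"
  proof safe
    fix p :: nat assume p: "prime p" "\<not> good_reduction E p"
    have "int p dvd disc W"
    proof (rule ccontr)
      assume n: "\<not> int p dvd disc W"
      then have "multiplicity (int p) (disc W) = 0" by (rule not_dvd_imp_multiplicity_0)
      then have "minimal_model p E W" using W by (simp add: minimal_model_def)
      then show False using p n by (auto simp: good_reduction_def)
    qed
    then show "p dvd nat \<bar>disc W\<bar>" by (simp add: nat_abs_dvd_iff dvd_nat_abs_iff)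
  qed
  moreover have "finite {p. p dvd nat \<bar>disc W\<bar>}" using d by (intro finite_divisors_nat) simp
  ultimately show ?thesis by (rule finite_subset)
qed

text \<open>The two reduction types may be witnessed by different minimal models; these share the
  valuation of the discriminant, which is positive at a singular reduction.\<close>

lemma additive_imp_not_good:
  assumes E: "elliptic_curve E" and p: "prime p" and add: "additive_reduction E p"
  shows "\<not> good_reduction E p"
proof
  assume "good_reduction E p"
  then obtain V where V: "minimal_model p E V" "\<not> int p dvd disc V" by (auto simp: good_reduction_def)
  obtain W x y where W: "minimal_model p E W" and s: "singular_mod p W x y"
    using add by (auto simp: additive_reduction_def)
  have "int p dvd disc W"
    using s unfolding singular_mod_def cong_iff_dvd_diff by (intro singular_dvd_disc[of _ y W x]) auto
  moreover have "disc W \<noteq> 0" using integral_model_disc[OF E] W by (auto simp: minimal_model_def)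
  ultimately have "multiplicity (int p) (disc W) \<noteq> 0"
    using p prime_elem_multiplicity_eq_zero_iff[of "int p" "disc W"] by simp
  moreover have "multiplicity (int p) (disc W) \<le> multiplicity (int p) (disc V)"
    using V W by (auto simp: minimal_model_def)
  ultimately show False using V(2) not_dvd_imp_multiplicity_0 by fastforce
qed

text \<open>The exponent is 2 plus a natural number. Finiteness of the set of bad primes matters
  because a product over an infinite set is 1 by default.\<close>

lemma additive_imp_square_dvd_conductor:
  assumes "elliptic_curve E" "prime p" "additive_reduction E p"
  shows "p ^ 2 dvd conductor E"
proof -
  have "p \<in> {p. prime p \<and> \<not> good_reduction E p}" using additive_imp_not_good assms by blast
  then have "p ^ conductor_exponent E p dvd conductor E"
    unfolding conductor_def using finite_bad_primes[OF assms(1)] by (intro dvd_prodI)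
  moreover have "p ^ 2 dvd p ^ conductor_exponent E p"
    using assms(3) by (intro le_imp_power_dvd) (simp add: conductor_exponent_def)
  ultimately show ?thesis by (rule dvd_trans[rotated])
qed

section \<open>Transfer of the torsion point to a minimal model\<close>

lemma transforms_of_rat:
  assumes "transforms u r s t E W"
  shows "transforms (of_rat u) (of_rat r) (of_rat s) (of_rat t) (base_change E :: 'k::field_char_0 weierstrass) (base_change W)"
proof -
  have h: "u \<noteq> 0"
    "u * a1 W = a1 E + 2 * s"
    "u ^ 2 * a2 W = a2 E - s * a1 E + 3 * r - s ^ 2"
    "u ^ 3 * a3 W = a3 E + r * a1 E + 2 * t"
    "u ^ 4 * a4 W = a4 E - s * a3 E + 2 * r * a2 E - (t + r * s) * a1 E + 3 * r ^ 2 - 2 * s * t"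
    "u ^ 6 * a6 W = a6 E + r * a4 E + r ^ 2 * a2 E + r ^ 3 - t * a3 E - t ^ 2 - r * t * a1 E"
    using assms unfolding transforms_def by blast+
  note k = h(2-6)[THEN arg_cong, of "of_rat :: rat \<Rightarrow> 'k",
    unfolded of_rat_mult of_rat_add of_rat_diff of_rat_power of_rat_numeral_eq]
  show ?thesis unfolding transforms_def map_weierstrass_sel
    using h(1) k by (simp only: of_rat_eq_0_iff not_False_eq_True simp_thms)
qed

text \<open>The substitution has rational coefficients, so it and its inverse preserve both
  coordinates in \<open>K\<close> and rational coordinates.\<close>

lemma torsion_point_on_model:
  assumes K: "quadratic_field K s d" and tr: "transforms u r v t E (over_field W)"
    and P: "P \<in> torsion (base_change E) K l - points (base_change E) \<rat>"
  shows "\<exists>Q. Q \<in> torsion (over_field W) K l - points (over_field W) \<rat>"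
proof -
  interpret quadratic_field K s d by fact
  let ?T = "transform (of_rat u) (of_rat r) (of_rat v) (of_rat t)"
  have "base_change (over_field W) = (over_field W :: 'a weierstrass)"
    by (simp add: weierstrass.map_comp comp_def)
  then have trk: "transforms (of_rat u) (of_rat r) (of_rat v) (of_rat t) (base_change E :: 'a weierstrass) (over_field W)"
    using transforms_of_rat[OF tr, where 'k = 'a] by simp
  then have u: "of_rat u \<noteq> (0 :: 'a)" by (simp add: transforms_def)
  have Pc: "on_curve (base_change E) P" "set_point P \<subseteq> K" "\<not> set_point P \<subseteq> \<rat>" "point_mult (base_change E) l P = Infinity"
    using P by (auto simp: torsion_def points_def)
  obtain x y where xy: "P = Affine x y" using Pc(3) by (cases P) auto
  then have [simp]: "x \<in> K" "y \<in> K" using Pc by auto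
  define x' where "x' = (x - of_rat r) / of_rat u ^ 2"
  define y' where "y' = (y - of_rat v * of_rat u ^ 2 * x' - of_rat t) / of_rat u ^ 3"
  have [simp]: "x' \<in> K" "y' \<in> K" by (simp_all add: x'_def y'_def)
  have T: "?T (Affine x' y') = P" using u by (simp add: xy x'_def y'_def)
  have c: "on_curve (over_field W) (Affine x' y')"
    using on_curve_transform[OF trk, of "Affine x' y'"] Pc(1) unfolding T by blast
  have "?T (point_mult (over_field W) l (Affine x' y')) = Infinity"
    using point_mult_transform[OF trk c, of l] T Pc(4) by simp
  then have "point_mult (over_field W) l (Affine x' y') = Infinity"
    by (cases "point_mult (over_field W) l (Affine x' y')") auto
  moreover have "\<not> (x' \<in> \<rat> \<and> y' \<in> \<rat>)"
  proof
    assume "x' \<in> \<rat> \<and> y' \<in> \<rat>"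
    then have "set_point (?T (Affine x' y')) \<subseteq> \<rat>" by auto
    then show False using Pc(3) unfolding T by blast
  qed
  ultimately show ?thesis using c by (intro exI[of _ "Affine x' y'"]) (auto simp: torsion_def points_def)
qed

text \<open>Both parts of the theorem are covered by the single condition
  \<open>p \<noteq> l \<or> l > 3\<close>. The generator \<open>s\<close> and the integer
  \<open>d\<close> are chosen anew for each \<open>p\<close>.\<close>

lemma additive_at_ramified:
  assumes E: "elliptic_curve E" and l: "prime l" "l \<ge> 3" and K: "quadratic_number_field K"
    and P: "\<exists>P. P \<in> torsion (base_change E) K l - points (base_change E) \<rat>"
    and p: "prime p" "ramifies_in p K" "p \<noteq> l \<or> l > 3"
  shows "additive_reduction E p \<and> p ^ 2 dvd conductor E"
proof -
  obtain W where W: "minimal_model p E W" using exists_minimal_model by blast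
  then have iW: "integral_model E W" by (simp add: minimal_model_def)
  obtain u r v t where tr: "transforms u r v t E (over_field W)"
    using iW unfolding integral_model_def isomorphic_iff by blast
  obtain s d where q: "quadratic_field K s (of_int d)" and ram: "padic.ramified_disc p d"
    using ramified_quadratic[OF K p(1,2)] by blast
  obtain Q where Q: "Q \<in> torsion (over_field W) K l - points (over_field W) \<rat>"
    using torsion_point_on_model[OF q tr] P by blast
  have "odd l" using l by (simp add: prime_odd_nat)
  then obtain n where n: "l = 2 * n + 1" by (elim oddE)
  interpret quadratic_field K s "of_int d" by (fact q)
  interpret twisted_torsion K s "of_int d" W l n
    by standard (use integral_model_disc[OF E iW] l n in auto)
  have "\<exists>x y. singular_mod p W x y \<and> double_tangent_mod p W x"
    by (rule additive_model_at_ramified[OF twisted_torsion_axioms p(1) ram exists_abscissa[OF Q] p(3)])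
  then have "additive_reduction E p" using W unfolding additive_reduction_def by blast
  then show ?thesis using additive_imp_square_dvd_conductor[OF E p(1)] by blast
qed

theorem theorem1p7:
  fixes E :: "rat weierstrass"
    and l :: nat
    and K :: "'k::field_char_0 set"
  assumes "elliptic_curve E"
    and "prime l" and "l \<ge> 3"
    and "quadratic_number_field K"
    and "\<exists>P. P \<in> torsion (base_change E) K l - points (base_change E) \<rat>"
  shows "(\<forall>p. prime p \<and> p \<noteq> l \<and> ramifies_in p K \<longrightarrow>
            additive_reduction E p \<and> p ^ 2 dvd conductor E) \<and>
         (l > 3 \<and> ramifies_in l K \<longrightarrow>
            additive_reduction E l \<and> l ^ 2 dvd conductor E)"
  using additive_at_ramified[OF assms] assms(2) by blast

end
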